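(* Let $d \geq 1$ and let $R$ be a non-degenerate indefinite quadratic form in $d$ variables with integer matrix. For an integer $N \geq 1$ and a sequence $a : \mathbb{Z}^d \to \mathbb{C}$ supported on $[-N,N]^d$, define $$F_a(\alpha,\boldsymbol{\theta}) = \sum_{\mathbf{n} \in \mathbb{Z}^d} a(\mathbf{n})\, e(\alpha R(\mathbf{n}) + \boldsymbol{\theta}\cdot \mathbf{n}), \qquad (\alpha,\boldsymbol{\theta}) \in \mathbb{T}\times\mathbb{T}^d.$$ There exists a constant $C > 0$ such that for every $p > \frac{2(d+2)}{d}$, $$\int_{\{ |F_a| \geq C N^{d/4} \|a\|_2 \}} |F_a|^p \,\mathrm{d}m \lesssim N^{\frac{dp}{2} - (d+2)} \|a\|_2^p,$$ for all integers $N \geq 1$ and all $a$ supported on $[-N,N]^d$, where the implied constant may depend on $R$, $d$ and $p$ but not on $N$ or $a$.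
   Context: $e(x) = e^{2\pi i x}$, $\mathbb{T} = \mathbb{R}/\mathbb{Z}$, $\mathrm{d}m$ is Lebesgue (Haar probability) measure on $\mathbb{T}^{d+1}$, and $\|a\|_2 = (\sum_{\mathbf{n}} |a(\mathbf{n})|^2)^{1/2}$. A quadratic form is non-degenerate if its matrix is non-singular, and indefinite if it takes both positive and negative values. *)

theory Defs
  imports "HOL-Analysis.Analysis"
begin

definition e :: "real \<Rightarrow> complex" where
  "e x = exp (2 * of_real pi * \<i> * of_real x)"

definition quad_form :: "real^'d^'d \<Rightarrow> real^'d \<Rightarrow> real" where
  "quad_form A x = x \<bullet> (A *v x)"

text \<open>A quadratic form is given by its (symmetric) matrix; here the entries are integers.\<close>

definition integer_form_matrix :: "real^'d^'d \<Rightarrow> bool" where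
  "integer_form_matrix A \<longleftrightarrow> transpose A = A \<and> (\<forall>i j. A $ i $ j \<in> \<int>)"

definition nondegenerate :: "real^'d^'d \<Rightarrow> bool" where
  "nondegenerate A \<longleftrightarrow> invertible A"

definition indefinite :: "real^'d^'d \<Rightarrow> bool" where
  "indefinite A \<longleftrightarrow> (\<exists>x. quad_form A x > 0) \<and> (\<exists>y. quad_form A y < 0)"

definition real_vec :: "int^'d \<Rightarrow> real^'d" where
  "real_vec n = (\<chi> i. real_of_int (n $ i))"

definition supported_on_box :: "nat \<Rightarrow> (int^'d \<Rightarrow> complex) \<Rightarrow> bool" where
  "supported_on_box N a \<longleftrightarrow> (\<forall>n. a n \<noteq> 0 \<longrightarrow> (\<forall>i. \<bar>n $ i\<bar> \<le> int N))"

definition l2norm :: "(int^'d \<Rightarrow> complex) \<Rightarrow> real" where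
  "l2norm a = sqrt (\<Sum>\<^sub>\<infinity>n. (cmod (a n))\<^sup>2)"

definition F :: "real^'d^'d \<Rightarrow> (int^'d \<Rightarrow> complex) \<Rightarrow> real \<times> (real^'d) \<Rightarrow> complex" where
  "F A a = (\<lambda>(\<alpha>, \<theta>). \<Sum>\<^sub>\<infinity>n.
     a n * e (\<alpha> * quad_form A (real_vec n) + \<theta> \<bullet> real_vec n))"

text \<open>The torus of dimension \<open>d + 1\<close> is represented by the fundamental domain
  \<open>[0,1) \<times> [0,1)\<^sup>d\<close> with Lebesgue measure. When \<open>A\<close> has integer entries, the function \<open>F A a\<close>
  has period 1 in each coordinate, so it is a function on the torus.\<close>

definition torus :: "(real \<times> (real^'d)) measure" where
  "torus = restrict_space lborel ({0..<1} \<times> {\<theta>. \<forall>i. 0 \<le> \<theta> $ i \<and> \<theta> $ i < 1})"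

end

(*
By duality, the level set E of |F_a| at height t satisfies
  t^2 |E|^2 <= ||a||^2 <f * K, f>,  f unimodular on E,
where K is a smoothly truncated exponential sum over all frequencies (n, R(n)).  Weyl differencing
gives |K| <= C (N^2/L)^(d/2), without logarithmic loss, outside the major arcs |alpha - b/q| <= L/(q N^2),
q <= L; with L ~ (t / (N^(d/2) ||a||))^(-4/d) this is a small multiple of t^2 / ||a||^2 and is absorbed.
The condition t >= C N^(d/4) ||a|| says exactly that L <= N/3, so that the major arcs are disjoint and
of measure at most 1/2.  On the major arcs one uses only the Fourier side: the coefficient at frequency
0 reproduces at most half of <f * K, f>, and the coefficient at k /= 0 is at most
L log L #{h <= L : h | k} / (N^2 + |k|), whose high moments are as small as if the divisor function were
bounded by L^eps.  A truncation at a suitable height then yields |E| up to an arbitrarily small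
loss in the exponent of t, and dyadic summation over t gives the integral.

To have only finite Fourier analysis, the torus is cut into translates of a cell indexed by a finite
grid; on each translated grid the estimate is uniform, because a translation only changes the
phases of a.
*)
theory Submission
  imports Defs "HOL-Computational_Algebra.Primes"
begin

text \<open>Put \<delta> = t / (N^(d/2) ||a||), so that L ~ \<delta>^(-4/d). If every nonzero
  coefficient were at most L / N^2, Parseval would give |E| of order N^(-(d+2)) \<delta>^(-(2 +
  4/d)), and 2 + 4/d is exactly the critical exponent 2(d+2)/d. For p above it a small power of
  \<delta> may be lost, but nothing that grows with N; hence every loss is kept a power of L. The
  obstacle is that the coefficients are not controlled that well pointwise: for L small against log
  N, the frequency k = lcm(1, ..., L) lies below N^2 and is divisible by every h <= L. The divisor
  bound applied to k itself would lose a power of N. In the R-th moment it is applied instead to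
  least common multiples of at most R numbers h <= L; these are at most L^R, so only a power of L is
  lost, and a large R makes the moment nearly as good as a pointwise bound. The factor N! in the
  grid size is harmless, because all estimates are relative to the number of grid points.\<close>

lemma e_add: "e (x + y) = e x * e y"
  by (simp add: e_def distrib_left distrib_right exp_add of_real_add)

lemma e_0 [simp]: "e 0 = 1"
  by (simp add: e_def)

lemma e_eq_cis: "e x = cis (2 * pi * x)"
  by (simp add: e_def cis_conv_exp mult_ac)

lemma norm_e [simp]: "cmod (e x) = 1"
  by (simp add: e_eq_cis)

lemma cnj_e: "cnj (e x) = e (- x)"
  by (simp add: e_eq_cis cis_cnj)

lemma e_of_int [simp]: "e (of_int m) = 1"
  by (simp add: e_eq_cis)

lemma e_sum: "e (\<Sum>i\<in>I. f i) = (\<Prod>i\<in>I. e (f i))"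
  by (induction I rule: infinite_finite_induct) (simp_all add: e_add)

section \<open>Distance to the nearest integer and geometric sums\<close>

definition int_dist :: "real \<Rightarrow> real" where
  "int_dist x = \<bar>x - of_int (round x)\<bar>"

lemma int_dist_le: "int_dist x \<le> \<bar>x - of_int m\<bar>"
  unfolding int_dist_def by (rule round_diff_minimal)

lemma int_dist_nonneg [simp]: "0 \<le> int_dist x"
  by (simp add: int_dist_def)

lemma int_dist_le_half: "int_dist x \<le> 1/2"
  unfolding int_dist_def by (metis of_int_round_abs_le abs_minus_commute)

lemma int_dist_eq_abs: "\<bar>x\<bar> \<le> 1/2 \<Longrightarrow> int_dist x = \<bar>x\<bar>"
proof (cases "round x = 0")
  case False
  assume x: "\<bar>x\<bar> \<le> 1/2"
  have "1 \<le> \<bar>real_of_int (round x)\<bar>" using False by linarith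
  then show ?thesis using x int_dist_le[of x 0] unfolding int_dist_def by linarith
qed (simp add: int_dist_def)

text \<open>Jordan's inequality: a concave graph lies above its chord.\<close>

lemma sin_ge_linear:
  assumes "0 \<le> y" "y \<le> pi/2"
  shows "2 * y / pi \<le> sin y"
proof -
  have conc: "concave_on {0..pi/2} sin"
  proof (rule f''_le0_imp_concave)
    show "(sin has_real_derivative cos x) (at x)" for x by (auto intro!: derivative_eq_intros)
    show "(cos has_real_derivative - sin x) (at x)" for x by (auto intro!: derivative_eq_intros)
    show "- sin x \<le> 0" if "x \<in> {0..pi/2}" for x using that by (auto intro!: sin_ge_zero)
  qed auto
  have "sin ((1 - 2*y/pi) *\<^sub>R 0 + (2*y/pi) *\<^sub>R (pi/2)) \<ge> (1 - 2*y/pi) * sin 0 + (2*y/pi) * sin (pi/2)"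
    by (rule concave_onD[OF conc]) (use assms in \<open>auto simp: field_simps\<close>)
  then show ?thesis by simp
qed

text \<open>The modulus is exactly 2 sin(pi ||x||), with ||x|| the distance to the nearest integer;
  Jordan's inequality linearises the sine.\<close>

lemma norm_e_minus_1: "cmod (e x - 1) \<ge> 4 * int_dist x"
proof -
  define s where "s = x - of_int (round x)"
  have "e x = e s * e (of_int (round x))" unfolding e_add[symmetric] by (simp add: s_def)
  then have es: "e x = e s" by simp
  have s: "\<bar>s\<bar> \<le> 1/2" using int_dist_le_half[of x] by (simp add: int_dist_def s_def)
  have "(cmod (e s - 1))\<^sup>2 = (2 * sin (pi * \<bar>s\<bar>))\<^sup>2"
  proof -
    have "(cmod (e s - 1))\<^sup>2 = (cos (2 * pi * s) - 1)\<^sup>2 + (sin (2 * pi * s))\<^sup>2"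
      by (simp add: e_eq_cis cmod_power2)
    also have "\<dots> = 2 - 2 * cos (2 * (pi * s))"
      using sin_cos_squared_add[of "2 * pi * s"] by (simp add: power2_eq_square algebra_simps)
    also have "\<dots> = (2 * sin (pi * s))\<^sup>2" unfolding cos_double_sin by (simp add: power2_eq_square)
    also have "\<dots> = (2 * sin (pi * \<bar>s\<bar>))\<^sup>2" by (auto simp: abs_if)
    finally show ?thesis .
  qed
  moreover have "2 * sin (pi * \<bar>s\<bar>) \<ge> 2 * (2 * (pi * \<bar>s\<bar>) / pi)"
    using sin_ge_linear[of "pi * \<bar>s\<bar>"] s by simp
  ultimately have "cmod (e s - 1) = 2 * sin (pi * \<bar>s\<bar>)"
    by (metis (no_types, lifting) abs_ge_zero mult_nonneg_nonneg norm_ge_zero order_trans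
        pi_ge_zero power2_eq_iff_nonneg divide_nonneg_nonneg zero_le_numeral)
  then show ?thesis using \<open>2 * sin (pi * \<bar>s\<bar>) \<ge> _\<close> by (simp add: es int_dist_def s_def)
qed

lemma sum_e_telescope:
  fixes a b :: int assumes "a \<le> b"
  shows "(e x - 1) * (\<Sum>r\<in>{a..<b}. e (of_int r * x)) = e (of_int b * x) - e (of_int a * x)"
  using assms
proof (induction b rule: int_ge_induct)
  case (step b)
  have "{a..<b+1} = insert b {a..<b}" using step by auto
  then show ?case using step by (simp add: algebra_simps e_add)
qed simp

lemma norm_sum_e_le:
  fixes a b :: int assumes "int_dist x > 0"
  shows "cmod (\<Sum>r\<in>{a..<b}. e (of_int r * x)) \<le> 1 / (2 * int_dist x)"
proof (cases "a \<le> b")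
  case True
  let ?S = "\<Sum>r\<in>{a..<b}. e (of_int r * x)"
  have "4 * int_dist x * cmod ?S \<le> cmod (e x - 1) * cmod ?S"
    using norm_e_minus_1 by (intro mult_right_mono) auto
  also have "\<dots> \<le> 2" unfolding norm_mult[symmetric] sum_e_telescope[OF True]
    using norm_triangle_ineq4[of "e (of_int b * x)" "e (of_int a * x)"] by simp
  finally show ?thesis using assms by (simp add: field_simps)
qed (use assms in auto)

text \<open>The window may start anywhere, because the later windows \<open>weight_box\<close> and
  \<open>freqs\<close> are centred at 0. If M does not divide j, then e(j/M) - 1 is nonzero while
  the telescoped boundary terms cancel by periodicity.\<close>

lemma sum_e_complete:
  fixes a j M :: int assumes "M > 0"
  shows "(\<Sum>r\<in>{a..<a+M}. e (of_int r * (of_int j / of_int M))) = (if M dvd j then of_int M else 0)"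
proof (cases "M dvd j")
  case True
  then obtain c where "j = M * c" by blast
  then have "e (of_int r * (of_int j / of_int M)) = 1" for r :: int
    using assms e_of_int[of "r * c"] by simp
  then show ?thesis using True assms by (simp add: of_nat_nat)
next
  case False
  have "of_int j / of_int M - of_int m \<noteq> (0::real)" for m :: int
  proof
    assume "of_int j / of_int M - of_int m = (0::real)"
    then have "(of_int j :: real) = of_int (M * m)" using assms by (simp add: field_simps)
    then show False using False by (metis dvd_triv_left of_int_eq_iff)
  qed
  then have "int_dist (of_int j / of_int M) > 0" by (simp add: int_dist_def)
  then have ne: "e (of_int j / of_int M) - 1 \<noteq> 0" using norm_e_minus_1[of "of_int j / of_int M"] by auto
  have "e (of_int (a+M) * (of_int j / of_int M)) = e (of_int a * (of_int j / of_int M))"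
  proof -
    have "of_int (a+M) * (of_int j / of_int M) = of_int a * (of_int j / of_int M) + (of_int j :: real)"
      using assms by (simp add: field_simps)
    then show ?thesis by (simp only: e_add e_of_int mult_1_right)
  qed
  then have "(e (of_int j / of_int M) - 1) * (\<Sum>r\<in>{a..<a+M}. e (of_int r * (of_int j / of_int M))) = 0"
    using sum_e_telescope[of a "a+M" "of_int j / of_int M"] assms by simp
  then show ?thesis using ne False by simp
qed

text \<open>The frequencies are truncated by tents instead of a sharp cutoff: their second differences
  have total mass \<open>O(1/N)\<close>, and the resulting quadratic decay is what keeps the Weyl bound
  free of logarithms.\<close>

definition tent :: "nat \<Rightarrow> int \<Rightarrow> real" where
  "tent N m = max 0 (2 - of_int \<bar>m\<bar> / real N)"

lemma tent_bounds: "0 \<le> tent N m" "tent N m \<le> 2"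
  by (auto simp: tent_def)

lemma tent_ge_1: "N \<ge> 1 \<Longrightarrow> \<bar>m\<bar> \<le> int N \<Longrightarrow> 1 \<le> tent N m"
  by (auto simp: tent_def field_simps simp flip: of_int_abs)

lemma tent_eq_0: "N \<ge> 1 \<Longrightarrow> \<bar>m\<bar> \<ge> 2 * int N \<Longrightarrow> tent N m = 0"
proof -
  assume "N \<ge> 1" and "\<bar>m\<bar> \<ge> 2 * int N"
  then have "2 * real N \<le> of_int \<bar>m\<bar>" by linarith
  then show ?thesis using \<open>N \<ge> 1\<close> by (auto simp: tent_def field_simps)
qed

lemma tent_lipschitz: "\<bar>tent N (m + 1) - tent N m\<bar> \<le> 1 / N"
proof -
  have max_lip: "\<bar>max 0 (2 - a) - max 0 (2 - b)\<bar> \<le> c" if "b - c \<le> a" "a \<le> b + c" for a b c :: real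
    using that by (auto simp: max_def)
  have "of_int \<bar>m\<bar> / real N - 1 / N \<le> of_int \<bar>m + 1\<bar> / real N"
    "of_int \<bar>m + 1\<bar> / real N \<le> of_int \<bar>m\<bar> / real N + 1 / N"
    unfolding diff_divide_distrib[symmetric] add_divide_distrib[symmetric]
    by (intro divide_right_mono; linarith)+
  then show ?thesis unfolding tent_def by (rule max_lip)
qed

text \<open>The tent is piecewise linear, so only the kinks at 0 and at -2N, 2N count, with slope
  jumps -2/N and 1/N, 1/N. Multiplication by N makes all values integers and turns the claim into
  integer arithmetic.\<close>

lemma tent_second_difference:
  assumes "N \<ge> 1"
  shows "\<bar>tent N (m + 1) - 2 * tent N m + tent N (m - 1)\<bar>
    \<le> (of_bool (m = 2 * int N) + of_bool (m = - 2 * int N) + 2 * of_bool (m = 0)) / N"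
proof -
  have t: "real N * tent N k = of_int (max 0 (2 * int N - \<bar>k\<bar>))" for k
    using assms by (auto simp: tent_def max_def field_simps)
  have "\<bar>real N * tent N (m + 1) - 2 * (real N * tent N m) + real N * tent N (m - 1)\<bar>
    = of_int \<bar>max 0 (2 * int N - \<bar>m + 1\<bar>) - 2 * max 0 (2 * int N - \<bar>m\<bar>) + max 0 (2 * int N - \<bar>m - 1\<bar>)\<bar>"
    unfolding t by simp
  also have "\<dots> \<le> of_int (of_bool (m = 2 * int N) + of_bool (m = - 2 * int N) + 2 * of_bool (m = 0))"
    using assms by (intro of_int_le_iff[THEN iffD2]) (auto simp: max_def)
  finally have "\<bar>real N * (tent N (m + 1) - 2 * tent N m + tent N (m - 1))\<bar>
    \<le> of_bool (m = 2 * int N) + of_bool (m = - 2 * int N) + 2 * of_bool (m = 0)"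
    by (simp add: algebra_simps)
  then show ?thesis using assms by (simp add: abs_mult pos_le_divide_eq mult.commute[of _ "real N"] del: of_bool_eq_iff)
qed

section \<open>Exponential sums in one variable\<close>

text \<open>Discrete Leibniz rule. For two tents the first two terms live on the kinks, and the last
  two are O(1/N^2) at each of O(N) points, so the total mass stays O(1/N).\<close>

lemma second_difference_mult:
  fixes f g :: "int \<Rightarrow> real"
  shows "f (m+1) * g (m+1) - 2 * (f m * g m) + f (m-1) * g (m-1)
    = f m * (g (m+1) - 2 * g m + g (m-1)) + g m * (f (m+1) - 2 * f m + f (m-1))
      + (f (m+1) - f m) * (g (m+1) - g m) + (f m - f (m-1)) * (g m - g (m-1))"
  by (simp add: algebra_simps)

text \<open>Taking the second difference of u multiplies the sum by e(-x) - 2 + e(x) = -|e(x) -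
  1|^2. No boundary terms arise, because u already vanishes at -b and b.\<close>

lemma sum_by_parts_twice:
  fixes u :: "int \<Rightarrow> real"
  assumes u0: "\<And>m. \<bar>m\<bar> \<ge> b \<Longrightarrow> u m = 0" and "b \<ge> 0"
  shows "cmod (\<Sum>m\<in>{-b..b}. of_real (u m) * e (of_int m * x)) * (4 * int_dist x)\<^sup>2
    \<le> (\<Sum>m\<in>{-b..b}. \<bar>u (m+1) - 2 * u m + u (m-1)\<bar>)"
proof -
  let ?U = "\<Sum>m\<in>{-b..b}. of_real (u m) * e (of_int m * x)"
  have up: "(\<Sum>m\<in>{-b..b}. of_real (u (m+1)) * e (of_int m * x)) = e (-x) * ?U"
  proof -
    have "e (-x) * ?U = (\<Sum>m\<in>{-b..b}. of_real (u m) * e (of_int (m - 1) * x))"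
      unfolding sum_distrib_left
      by (intro sum.cong refl) (simp add: e_add[symmetric] algebra_simps)
    also have "\<dots> = (\<Sum>m\<in>{-b+1..b+1}. of_real (u m) * e (of_int (m - 1) * x))"
      by (rule sum.mono_neutral_cong) (use u0 assms in auto)
    also have "\<dots> = (\<Sum>m\<in>{-b..b}. of_real (u (m+1)) * e (of_int m * x))"
      by (rule sum.reindex_bij_witness[of _ "\<lambda>m. m + 1" "\<lambda>m. m - 1"]) auto
    finally show ?thesis by simp
  qed
  have down: "(\<Sum>m\<in>{-b..b}. of_real (u (m-1)) * e (of_int m * x)) = e x * ?U"
  proof -
    have "e x * ?U = (\<Sum>m\<in>{-b..b}. of_real (u m) * e (of_int (m + 1) * x))"
      unfolding sum_distrib_left
      by (intro sum.cong refl) (simp add: e_add[symmetric] algebra_simps)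
    also have "\<dots> = (\<Sum>m\<in>{-b-1..b-1}. of_real (u m) * e (of_int (m + 1) * x))"
      by (rule sum.mono_neutral_cong) (use u0 assms in auto)
    also have "\<dots> = (\<Sum>m\<in>{-b..b}. of_real (u (m-1)) * e (of_int m * x))"
      by (rule sum.reindex_bij_witness[of _ "\<lambda>m. m - 1" "\<lambda>m. m + 1"]) auto
    finally show ?thesis by simp
  qed
  have "(\<Sum>m\<in>{-b..b}. of_real (u (m+1) - 2 * u m + u (m-1)) * e (of_int m * x))
      = (e (-x) - 2 + e x) * ?U"
    using up down by (simp add: algebra_simps sum.distrib sum_subtractf sum_distrib_left)
  also have "e (-x) - 2 + e x = - ((e x - 1) * cnj (e x - 1))"
    by (simp add: cnj_e algebra_simps e_add[symmetric])
  finally have "(cmod (e x - 1))\<^sup>2 * cmod ?U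
      = cmod (\<Sum>m\<in>{-b..b}. of_real (u (m+1) - 2 * u m + u (m-1)) * e (of_int m * x))"
    by (simp only: norm_mult norm_minus_cancel complex_mod_cnj power2_eq_square)
  also have "\<dots> \<le> (\<Sum>m\<in>{-b..b}. \<bar>u (m+1) - 2 * u m + u (m-1)\<bar>)"
    by (rule order_trans[OF norm_sum]) (simp only: norm_mult norm_of_real norm_e mult_1_right order_refl)
  finally have "(cmod (e x - 1))\<^sup>2 * cmod ?U \<le> (\<Sum>m\<in>{-b..b}. \<bar>u (m+1) - 2 * u m + u (m-1)\<bar>)" .
  moreover have "(4 * int_dist x)\<^sup>2 * cmod ?U \<le> (cmod (e x - 1))\<^sup>2 * cmod ?U"
    by (intro mult_right_mono power_mono norm_e_minus_1) auto
  ultimately show ?thesis by (simp add: mult.commute)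
qed

text \<open>Two bounds are merged into one formula: 4N terms of size at most 4 give 16 N, and
  summation by parts gives 2 N / (N ||x||)^2. As (1 + y)^2 <= 2 + 2 y^2, together they give 36 N.
  The shift h comes from Weyl differencing, and the bound is uniform in it.\<close>

lemma tent_sum_bound:
  assumes N: "N \<ge> 1"
  shows "cmod (\<Sum>m\<in>{-2 * int N..<2 * int N}. of_real (tent N (m + h) * tent N m) * e (of_int m * x))
    \<le> 40 * real N / (1 + real N * int_dist x)\<^sup>2"
proof -
  define b where "b = 2 * int N"
  define u where "u = (\<lambda>m. tent N (m + h) * tent N m)"
  let ?U = "\<Sum>m\<in>{-b..b}. of_real (u m) * e (of_int m * x)"
  have u0: "u m = 0" if "\<bar>m\<bar> \<ge> b" for m using that tent_eq_0[OF N, of m] by (simp add: u_def b_def)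
  have U: "(\<Sum>m\<in>{-2 * int N..<2 * int N}. of_real (tent N (m + h) * tent N m) * e (of_int m * x)) = ?U"
    by (rule sum.mono_neutral_cong_left) (use u0 in \<open>auto simp: b_def u_def\<close>)
  have u4: "0 \<le> u m" "u m \<le> 4" for m
    using mult_mono[OF tent_bounds(2)[of N "m+h"] tent_bounds(2)[of N m]] tent_bounds[of N]
    by (auto simp: u_def)
  have "?U = (\<Sum>m\<in>{-b..<b}. of_real (u m) * e (of_int m * x))"
    by (rule sum.mono_neutral_cong_right) (use u0 in auto)
  also have "cmod \<dots> \<le> (\<Sum>m\<in>{-b..<b}. 4)"
    by (rule sum_norm_le) (use u4 in \<open>auto simp: norm_mult\<close>)
  also have "\<dots> = 16 * real N" by (simp add: b_def)
  finally have triv: "cmod ?U \<le> 16 * real N" .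
  \<comment> \<open>Majorant for the second difference of one tent: point masses at the kinks. Its
    mass on any finite set is at most 4/N, so the shift by h does no harm.\<close>
  define D where "D = (\<lambda>m. (of_bool (m = 2 * int N) + of_bool (m = - 2 * int N) + 2 * of_bool (m = 0)) / real N)"
  have Dsum: "(\<Sum>m\<in>S. D m) \<le> 4 / N" if "finite S" for S
  proof -
    have single: "(\<Sum>m\<in>S. of_bool (m = c)) \<le> (1::real)" for c :: int
      using that by (simp add: sum.delta of_bool_def)
    have "(\<Sum>m\<in>S. D m) = ((\<Sum>m\<in>S. of_bool (m = 2 * int N)) + (\<Sum>m\<in>S. of_bool (m = - 2 * int N))
        + 2 * (\<Sum>m\<in>S. of_bool (m = 0))) / N"
      by (simp only: D_def sum_divide_distrib[symmetric] sum.distrib sum_distrib_left)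
    also have "\<dots> \<le> (1 + 1 + 2 * 1) / N"
      by (intro divide_right_mono add_mono mult_left_mono single) auto
    finally show ?thesis by simp
  qed
  have "\<bar>u (m+1) - 2 * u m + u (m-1)\<bar> \<le> 2 * D m + 2 * D (m + h) + 2 / N\<^sup>2" for m
  proof -
    let ?f = "\<lambda>m. tent N (m + h)" and ?g = "tent N"
    have "u (m+1) - 2 * u m + u (m-1) = ?f m * (?g (m+1) - 2 * ?g m + ?g (m-1)) + ?g m * (?f (m+1) - 2 * ?f m + ?f (m-1))
      + (?f (m+1) - ?f m) * (?g (m+1) - ?g m) + (?f m - ?f (m-1)) * (?g m - ?g (m-1))"
      unfolding u_def by (rule second_difference_mult)
    also have "\<bar>\<dots>\<bar> \<le> 2 * D m + 2 * D (m+h) + 1/N * (1/N) + 1/N * (1/N)"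
    proof -
      have abs4: "\<bar>p + q + r + s\<bar> \<le> P + Q + R + S" if "\<bar>p\<bar> \<le> P" "\<bar>q\<bar> \<le> Q" "\<bar>r\<bar> \<le> R" "\<bar>s\<bar> \<le> S" for p q r s P Q R S :: real
        using that by linarith
      show ?thesis
        using tent_bounds[of N] tent_lipschitz[of N "m + h"] tent_lipschitz[of N "m"]
          tent_lipschitz[of N "m + h - 1"] tent_lipschitz[of N "m - 1"]
          tent_second_difference[OF N, of m] tent_second_difference[OF N, of "m + h"]
        by (intro abs4; unfold abs_mult D_def; intro mult_mono) (simp_all add: algebra_simps)
    qed
    finally show ?thesis by (simp add: power2_eq_square)
  qed
  then have "(\<Sum>m\<in>{-b..b}. \<bar>u (m+1) - 2 * u m + u (m-1)\<bar>) \<le> (\<Sum>m\<in>{-b..b}. 2 * D m + 2 * D (m + h) + 2 / N\<^sup>2)"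
    by (intro sum_mono)
  also have "\<dots> = 2 * (\<Sum>m\<in>{-b..b}. D m) + 2 * (\<Sum>m\<in>{-b+h..b+h}. D m) + (4 * N + 1) * (2 / N\<^sup>2)"
  proof -
    have "(\<Sum>m\<in>{-b..b}. D (m + h)) = (\<Sum>m\<in>{-b+h..b+h}. D m)"
      by (rule sum.reindex_bij_witness[of _ "\<lambda>m. m - h" "\<lambda>m. m + h"]) auto
    then show ?thesis by (simp add: sum.distrib sum_distrib_left[symmetric] b_def)
  qed
  also have "\<dots> \<le> 2 * (4 / N) + 2 * (4 / N) + (5 * N) * (2 / N\<^sup>2)"
    using N by (intro add_mono mult_left_mono mult_right_mono Dsum) auto
  also have "\<dots> = 26 / N" using N by (simp add: field_simps power2_eq_square)
  finally have "cmod ?U * (4 * int_dist x)\<^sup>2 \<le> 26 / N"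
    using sum_by_parts_twice[of b u x] u0 by (simp add: b_def)
  then have "cmod ?U * (real N * int_dist x)\<^sup>2 \<le> 2 * N"
    using N by (simp add: field_simps power2_eq_square)
  moreover have "cmod ?U * (1 + real N * int_dist x)\<^sup>2 \<le> cmod ?U * (2 + 2 * (real N * int_dist x)\<^sup>2)"
  proof (rule mult_left_mono)
    show "(1 + real N * int_dist x)\<^sup>2 \<le> 2 + 2 * (real N * int_dist x)\<^sup>2"
      using zero_le_power2[of "1 - real N * int_dist x"] by (simp add: power2_eq_square algebra_simps)
  qed simp
  ultimately have "cmod ?U * (1 + real N * int_dist x)\<^sup>2 \<le> 40 * N"
    using triv by (simp add: distrib_left)
  moreover have "1 + real N * int_dist x > 0" by (simp add: add_pos_nonneg)
  ultimately show ?thesis unfolding U by (simp add: pos_le_divide_eq)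
qed

text \<open>The first term is 1, and the rest is compared with the integral of (1 + u/c)^(-2) over u
  > 0, which is c. The remainder c^2 / (c + n) makes the induction telescope.\<close>

lemma sum_inverse_square_le:
  fixes c :: real assumes "c > 0"
  shows "(\<Sum>j<n. 1 / (1 + real j / c)\<^sup>2) \<le> 1 + c"
proof -
  have "(\<Sum>j<Suc n. 1 / (1 + real j / c)\<^sup>2) \<le> 1 + c - c\<^sup>2 / (c + real n)" for n
  proof (induction n)
    case (Suc n)
    have "1 / (1 + real (Suc n) / c)\<^sup>2 = c\<^sup>2 / (c + real (Suc n))\<^sup>2"
      using assms by (simp add: field_simps power2_eq_square)
    also have "\<dots> \<le> c\<^sup>2 / ((c + real n) * (c + real (Suc n)))"
      using assms by (intro divide_left_mono) (auto simp: power2_eq_square intro!: mult_right_mono mult_pos_pos)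
    also have "\<dots> = c\<^sup>2 / (c + real n) - c\<^sup>2 / (c + real (Suc n))"
      using assms by (simp add: field_simps)
    finally show ?case using Suc by simp
  qed (use assms in \<open>simp add: power2_eq_square\<close>)
  moreover have "(\<Sum>j<n. 1 / (1 + real j / c)\<^sup>2) \<le> (\<Sum>j<Suc n. 1 / (1 + real j / c)\<^sup>2)"
    by (rule sum_mono2) auto
  moreover have "c\<^sup>2 / (c + real n) \<ge> 0" using assms by simp
  ultimately show ?thesis by (smt (verit))
qed

text \<open>Since q does not divide a r, the number a r / q is at least 1/q away from every integer.
  Replacing a/q by t moves the product by at most (1/q^2)(q/2) = 1/(2q), which is why r is limited
  to half a period.\<close>

lemma int_dist_separated:
  fixes q :: nat and a r :: int and t :: real
  assumes q: "q \<ge> 1" and cop: "coprime a (int q)" and t: "\<bar>t - of_int a / q\<bar> \<le> 1 / (real q)\<^sup>2"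
    and r: "r \<noteq> 0" "2 * \<bar>r\<bar> \<le> int q"
  shows "\<bar>t * of_int r - of_int m\<bar> \<ge> 1 / (2 * real q)"
proof -
  have "\<not> int q dvd r"
  proof
    assume "int q dvd r"
    then have "int q \<le> \<bar>r\<bar>" using r by (meson dvd_imp_le_int zdvd_imp_le abs_ge_zero dvd_abs_iff zero_less_abs_iff)
    then show False using r q by linarith
  qed
  then have "\<not> int q dvd a * r" using cop by (simp add: coprime_commute coprime_dvd_mult_right_iff)
  then have "a * r - m * int q \<noteq> 0" by (metis dvd_triv_right eq_iff_diff_eq_0)
  then have "1 \<le> \<bar>of_int (a * r - m * int q) :: real\<bar>" by linarith
  then have 1: "1 / q \<le> \<bar>of_int a / q * of_int r - of_int m :: real\<bar>"
  proof -
    have "of_int a / q * of_int r - of_int m = (of_int (a * r - m * int q) / q :: real)"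
      using q by (simp add: field_simps)
    then show ?thesis using \<open>1 \<le> \<bar>of_int (a * r - m * int q) :: real\<bar>\<close> q
      by (simp only: abs_divide abs_of_nat divide_right_mono of_nat_0_le_iff)
  qed
  have "\<bar>(t - of_int a / q) * of_int r\<bar> \<le> 1 / (real q)\<^sup>2 * (real q / 2)"
    unfolding abs_mult
  proof (rule mult_mono[OF t])
    show "\<bar>of_int r\<bar> \<le> real q / 2" using r(2) by linarith
  qed auto
  also have "\<dots> = 1 / (2 * real q)" using q by (simp add: power2_eq_square)
  finally have "\<bar>(t - of_int a / q) * of_int r\<bar> \<le> 1 / (2 * real q)" .
  moreover have "1 / real q = 1 / (2 * real q) + 1 / (2 * real q)" using q by (simp add: field_simps)
  ultimately show ?thesis using 1 by (simp add: algebra_simps)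
qed

lemma floor_eq_imp_close:
  fixes x y c :: real
  assumes "c > 0" "\<lfloor>c * x\<rfloor> = \<lfloor>c * y\<rfloor>"
  shows "\<bar>x - y\<bar> < 1 / c"
proof -
  have "\<bar>c * x - c * y\<bar> < 1" using assms(2) by linarith
  then have "c * \<bar>x - y\<bar> < 1" using assms(1) by (simp add: right_diff_distrib[symmetric] abs_mult)
  then show ?thesis using assms(1) by (simp add: field_simps)
qed

text \<open>Within a block of about q/2 integers the signed distances of t v to the nearest integer
  are 1/(2q)-separated, so each cell of length 1/(2q) holds at most one of them. The sum is thus at
  most two copies, one on each side of 0, of the series in \<open>sum_inverse_square_le\<close> with
  c = 2 q / N.\<close>

lemma block_sum_int_dist_le:
  fixes q N :: nat and a v0 w :: int and t :: real
  assumes N: "N \<ge> 1" and q: "q \<ge> 1" and cop: "coprime a (int q)" and t: "\<bar>t - of_int a / q\<bar> \<le> 1 / (real q)\<^sup>2"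
    and V: "V \<subseteq> {v0..<v0 + w}" and w: "2 * (w - 1) \<le> int q"
  shows "(\<Sum>v\<in>V. 1 / (1 + real N * int_dist (t * of_int v))\<^sup>2) \<le> 2 * (1 + 2 * real q / N)"
proof -
  define c where "c = 2 * real q / N"
  have c: "c > 0" using N q by (simp add: c_def)
  define s where "s = (\<lambda>v::int. t * of_int v - of_int (round (t * of_int v)))"
  define J where "J = (\<lambda>v. \<lfloor>2 * real q * s v\<rfloor>)"
  \<comment> \<open>A cell [z, z + 1) with z < 0 comes closest to 0 at its right end z + 1, so the
    indices start at 0 on both sides.\<close>
  define j where "j = (\<lambda>z::int. if z \<ge> 0 then nat z else nat (- z - 1))"
  define g where "g = (\<lambda>z. 1 / (1 + real (j z) / c)\<^sup>2)"
  have fin: "finite V" using V finite_subset by blast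
  have inj: "inj_on J V"
  proof (rule inj_onI, rule ccontr)
    fix v v' assume vv: "v \<in> V" "v' \<in> V" "J v = J v'" "v \<noteq> v'"
    then have "\<bar>s v - s v'\<bar> < 1 / (2 * real q)" using floor_eq_imp_close[of "2 * real q" "s v" "s v'"] q by (simp add: J_def)
    moreover have "s v - s v' = t * of_int (v - v') - of_int (round (t * of_int v) - round (t * of_int v'))"
      by (simp add: s_def algebra_simps)
    moreover have "2 * \<bar>v - v'\<bar> \<le> int q"
    proof -
      have "v \<in> {v0..<v0 + w}" "v' \<in> {v0..<v0 + w}" using V vv by blast+
      then have "\<bar>v - v'\<bar> \<le> w - 1" by (simp add: abs_if)
      then have "2 * \<bar>v - v'\<bar> \<le> 2 * (w - 1)" by (rule mult_left_mono) simp
      then show ?thesis using w by (rule order_trans)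
    qed
    ultimately show False using int_dist_separated[OF q cop t, of "v - v'" "round (t * of_int v) - round (t * of_int v')"] vv by simp
  qed
  have term_le: "1 / (1 + real N * int_dist (t * of_int v))\<^sup>2 \<le> g (J v)" for v
  proof -
    have "real (j (J v)) \<le> 2 * real q * \<bar>s v\<bar>"
    proof (cases "J v \<ge> 0")
      case True
      then have "real (j (J v)) = of_int \<lfloor>2 * real q * s v\<rfloor>" by (simp add: j_def J_def)
      also have "\<dots> \<le> 2 * real q * s v" by simp
      also have "\<dots> \<le> 2 * real q * \<bar>s v\<bar>" by (intro mult_left_mono) auto
      finally show ?thesis .
    next
      case False
      then have "real (j (J v)) = - of_int \<lfloor>2 * real q * s v\<rfloor> - 1" by (simp add: j_def J_def)
      also have "\<dots> \<le> - (2 * real q * s v)" by linarith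
      also have "\<dots> \<le> 2 * real q * \<bar>s v\<bar>" unfolding mult_minus_right[symmetric] by (intro mult_left_mono) auto
      finally show ?thesis .
    qed
    then have "real (j (J v)) / c \<le> real N * \<bar>s v\<bar>" using N q c by (simp add: c_def field_simps)
    then have "(1 + real (j (J v)) / c)\<^sup>2 \<le> (1 + real N * \<bar>s v\<bar>)\<^sup>2" using c by (intro power_mono) auto
    moreover have "(1 + real (j (J v)) / c)\<^sup>2 > 0" using c by (intro zero_less_power add_pos_nonneg) auto
    ultimately show ?thesis unfolding g_def int_dist_def s_def by (intro frac_le) auto
  qed
  obtain n where n: "J ` V \<subseteq> {- int n..<int n}"
  proof -
    have "finite (J ` V)" using fin by simp
    then obtain b where "\<forall>z\<in>J ` V. \<bar>z\<bar> \<le> b" by (metis finite_imageI Max_ge imageI)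
    then have "J ` V \<subseteq> {- int (nat b + 1)..<int (nat b + 1)}" by fastforce
    then show ?thesis by (rule that)
  qed
  have "(\<Sum>v\<in>V. 1 / (1 + real N * int_dist (t * of_int v))\<^sup>2) \<le> (\<Sum>v\<in>V. g (J v))"
    by (intro sum_mono term_le)
  also have "\<dots> = sum g (J ` V)" by (simp add: sum.reindex[OF inj])
  also have "\<dots> \<le> sum g {- int n..<int n}" by (rule sum_mono2) (use n in \<open>auto simp: g_def\<close>)
  also have "{- int n..<int n} = {0..<int n} \<union> {- int n..<0}" by auto
  also have "sum g ({0..<int n} \<union> {- int n..<0}) = sum g {0..<int n} + sum g {- int n..<0}"
    by (rule sum.union_disjoint) auto
  also have "sum g {0..<int n} = (\<Sum>i<n. 1 / (1 + real i / c)\<^sup>2)"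
    by (rule sum.reindex_bij_witness[of _ int nat]) (auto simp: g_def j_def)
  also have "sum g {- int n..<0} = (\<Sum>i<n. 1 / (1 + real i / c)\<^sup>2)"
    by (rule sum.reindex_bij_witness[of _ "\<lambda>i. - int i - 1" "\<lambda>z. nat (- z - 1)"]) (auto simp: g_def j_def)
  finally show ?thesis using sum_inverse_square_le[OF c, of n] by (simp add: c_def)
qed

lemma sum_int_dist_le:
  fixes q N H :: nat and a :: int and t :: real
  assumes N: "N \<ge> 1" and q: "q \<ge> 1" and cop: "coprime a (int q)" and t: "\<bar>t - of_int a / q\<bar> \<le> 1 / (real q)\<^sup>2"
  shows "(\<Sum>v\<in>{- int H..int H}. 1 / (1 + real N * int_dist (t * of_int v))\<^sup>2)
    \<le> (4 * real H / q + 2) * (2 * (1 + 2 * real q / N))"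
proof -
  \<comment> \<open>The longest block with 2 (w - 1) <= q. As also 2 w >= q, the interval meets at
    most 4 H / q + 2 blocks.\<close>
  define w where "w = int q div 2 + 1"
  have w: "w \<ge> 1" "2 * (w - 1) \<le> int q" "2 * w \<ge> int q" using q by (auto simp: w_def)
  let ?f = "\<lambda>v::int. 1 / (1 + real N * int_dist (t * of_int v))\<^sup>2"
  let ?I = "{- int H..int H}" and ?T = "{(- int H) div w..int H div w}"
  have "sum ?f ?I = (\<Sum>b\<in>?T. \<Sum>v\<in>{v\<in>?I. v div w = b}. ?f v)"
    by (rule sum.group[symmetric]) (use w in \<open>auto intro!: zdiv_mono1\<close>)
  also have "\<dots> \<le> (\<Sum>b\<in>?T. 2 * (1 + 2 * real q / N))"
  proof (rule sum_mono)
    fix b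
    have "{v\<in>?I. v div w = b} \<subseteq> {w * b..<w * b + w}"
    proof safe
      fix v
      have "v = w * (v div w) + v mod w" "0 \<le> v mod w" "v mod w < w" using w by auto
      then show "v \<in> {w * (v div w)..<w * (v div w) + w}" unfolding atLeastLessThan_iff by linarith
    qed
    from block_sum_int_dist_le[OF N q cop t this w(2)]
    show "(\<Sum>v\<in>{v\<in>?I. v div w = b}. ?f v) \<le> 2 * (1 + 2 * real q / N)" .
  qed
  also have "\<dots> = real (card ?T) * (2 * (1 + 2 * real q / N))" by simp
  also have "\<dots> \<le> (4 * real H / q + 2) * (2 * (1 + 2 * real q / N))"
  proof (rule mult_right_mono)
    have "w * (int H div w) \<le> int H" using w by (simp add: minus_mod_eq_mult_div[symmetric])
    moreover have "w * ((- int H) div w) \<ge> - int H - w + 1"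
    proof -
      have "- int H mod w < w" using w by simp
      then show ?thesis unfolding minus_mod_eq_mult_div[symmetric] by linarith
    qed
    ultimately have "w * (int H div w - (- int H) div w + 1) \<le> 2 * int H + 2 * w" by (simp add: algebra_simps)
    then have "of_int w * real_of_int (int H div w - (- int H) div w + 1) \<le> 2 * real H + 2 * of_int w"
      by (metis (mono_tags, lifting) of_int_add of_int_le_iff of_int_mult of_int_numeral of_int_of_nat_eq)
    moreover have "real (card ?T) \<le> real_of_int (int H div w - (- int H) div w + 1)"
    proof -
      have "(- int H) div w \<le> int H div w" using w by (intro zdiv_mono1) auto
      then show ?thesis by simp
    qed
    ultimately have "of_int w * real (card ?T) \<le> 2 * real H + 2 * of_int w"
      using w by (smt (verit) mult_left_mono of_int_0_le_iff)
    then have "real (card ?T) \<le> 2 * real H / of_int w + 2" using w by (simp add: field_simps)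
    also have "2 * real H / of_int w \<le> 2 * real H / (real q / 2)"
    proof (rule divide_left_mono)
      show "real q / 2 \<le> real_of_int w" using w(3) by linarith
    qed (use w q in auto)
    finally show "real (card ?T) \<le> 4 * real H / q + 2" by simp
  qed auto
  finally show ?thesis .
qed

section \<open>The Weyl bound for the smoothed kernel\<close>

definition int_box :: "int set \<Rightarrow> (int^'d) set" where
  "int_box S = {n. \<forall>i. n $ i \<in> S}"

lemma int_box_eq_image: "int_box S = vec_lambda ` (UNIV \<rightarrow>\<^sub>E S)"
proof (intro equalityI subsetI)
  fix n :: "int^'d" assume "n \<in> int_box S"
  then have "n = vec_lambda (\<lambda>i. n $ i)" "(\<lambda>i. n $ i) \<in> UNIV \<rightarrow>\<^sub>E S"
    by (auto simp: int_box_def vec_lambda_eta)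
  then show "n \<in> vec_lambda ` (UNIV \<rightarrow>\<^sub>E S)" by (rule image_eqI)
qed (auto simp: int_box_def)

lemma finite_int_box [simp]: "finite S \<Longrightarrow> finite (int_box S)"
  unfolding int_box_eq_image by (intro finite_imageI finite_PiE) auto

lemma sum_int_box_prod:
  fixes f :: "'d::finite \<Rightarrow> int \<Rightarrow> 'a::comm_semiring_1"
  assumes "finite S"
  shows "(\<Sum>n\<in>int_box S. \<Prod>i\<in>UNIV. f i (n $ i)) = (\<Prod>i\<in>UNIV. \<Sum>x\<in>S. f i x)"
proof -
  have inj: "inj_on vec_lambda (UNIV \<rightarrow>\<^sub>E S)"
    by (intro inj_onI) (metis vec_lambda_inverse UNIV_I)
  have "(\<Prod>i\<in>UNIV. \<Sum>x\<in>S. f i x) = (\<Sum>g\<in>UNIV \<rightarrow>\<^sub>E S. \<Prod>i\<in>UNIV. f i (g i))"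
    by (rule prod_sum_PiE) (use assms in auto)
  also have "\<dots> = (\<Sum>n\<in>int_box S. \<Prod>i\<in>UNIV. f i (n $ i))"
    unfolding int_box_eq_image by (simp add: sum.reindex[OF inj])
  finally show ?thesis by simp
qed

lemma card_int_box: "finite S \<Longrightarrow> card (int_box S :: (int^'d) set) = card S ^ CARD('d)"
  using sum_int_box_prod[of S "\<lambda>(_::'d) _. 1::nat"] by simp

lemma real_vec_add: "real_vec (m + n) = real_vec m + real_vec n"
  by (simp add: real_vec_def vec_eq_iff)

lemma real_vec_eq_iff [simp]: "real_vec m = real_vec n \<longleftrightarrow> m = n"
  by (simp add: real_vec_def vec_eq_iff)

lemma real_vec_nth [simp]: "real_vec n $ i = of_int (n $ i)"
  by (simp add: real_vec_def)

lemma quad_form_add: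
  assumes "transpose A = A"
  shows "quad_form A (x + y) = quad_form A x + quad_form A y + 2 * ((A *v y) \<bullet> x)"
proof -
  have "y \<bullet> (A *v x) = (A *v y) \<bullet> x"
    using assms by (metis dot_lmul_matrix vector_transpose_matrix)
  then show ?thesis
    by (simp add: quad_form_def inner_add_left inner_add_right matrix_vector_right_distrib inner_commute)
qed

definition box_weight :: "nat \<Rightarrow> int^'d \<Rightarrow> real" where
  "box_weight N n = (\<Prod>i\<in>UNIV. tent N (n $ i))"

lemma box_weight_nonneg [simp]: "0 \<le> box_weight N n"
  by (simp add: box_weight_def prod_nonneg tent_bounds)

lemma box_weight_le: "box_weight N (n::int^'d) \<le> 2 ^ CARD('d)"
proof -
  have "box_weight N n \<le> (\<Prod>i\<in>(UNIV::'d set). 2)"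
    unfolding box_weight_def by (intro prod_mono) (simp add: tent_bounds)
  then show ?thesis by simp
qed

lemma box_weight_ge_1: "N \<ge> 1 \<Longrightarrow> (\<And>i. \<bar>n $ i\<bar> \<le> int N) \<Longrightarrow> 1 \<le> box_weight N n"
  unfolding box_weight_def by (intro prod_ge_1) (simp add: tent_ge_1)

text \<open>Half-open, so that each coordinate runs over exactly one residue system modulo 4N,
  matching the spatial grid of step 1/(4N). Nothing is lost, since the tent vanishes at -2N and
  2N.\<close>

abbreviation weight_box :: "nat \<Rightarrow> (int^'d) set" where
  "weight_box N \<equiv> int_box {- 2 * int N..<2 * int N}"

lemma box_weight_eq_0:
  assumes "N \<ge> 1" "n \<notin> weight_box N"
  shows "box_weight N n = 0"
proof -
  obtain i where "n $ i \<notin> {- 2 * int N..<2 * int N}" using assms(2) by (auto simp: int_box_def)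
  then have "tent N (n $ i) = 0" using assms(1) by (intro tent_eq_0) auto
  then show ?thesis by (auto simp: box_weight_def)
qed

definition kernel :: "real^'d^'d \<Rightarrow> nat \<Rightarrow> real \<Rightarrow> real^'d \<Rightarrow> complex" where
  "kernel A N t \<theta> = (\<Sum>n\<in>weight_box N.
     of_real (box_weight N n) * e (t * quad_form A (real_vec n) + \<theta> \<bullet> real_vec n))"

text \<open>After differencing the phase is linear in m, with integer frequency vector v = 2 A h, so
  weight and phase both split as products over the coordinates.\<close>

lemma norm_differenced_sum_le:
  fixes A :: "real^'d^'d" and v h :: "int^'d"
  assumes N: "N \<ge> 1" and v: "2 *\<^sub>R (A *v real_vec h) = real_vec v"
  shows "cmod (\<Sum>m\<in>weight_box N. of_real (box_weight N (m + h) * box_weight N m)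
      * e (t * (2 * ((A *v real_vec h) \<bullet> real_vec m))))
    \<le> (\<Prod>i\<in>UNIV. 40 * real N / (1 + real N * int_dist (t * of_int (v $ i)))\<^sup>2)"
proof -
  have "2 * ((A *v real_vec h) \<bullet> real_vec m) = (\<Sum>i\<in>UNIV. of_int (v $ i) * of_int (m $ i))" for m
  proof -
    have "2 * ((A *v real_vec h) \<bullet> real_vec m) = real_vec v \<bullet> real_vec m" unfolding v[symmetric] by simp
    then show ?thesis by (simp add: inner_vec_def)
  qed
  then have "(\<Sum>m\<in>weight_box N. of_real (box_weight N (m + h) * box_weight N m)
      * e (t * (2 * ((A *v real_vec h) \<bullet> real_vec m))))
    = (\<Sum>m\<in>weight_box N. \<Prod>i\<in>UNIV. of_real (tent N (m $ i + h $ i) * tent N (m $ i))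
        * e (of_int (m $ i) * (t * of_int (v $ i))))"
    by (simp add: box_weight_def prod.distrib e_sum sum_distrib_left mult_ac)
  also have "\<dots> = (\<Prod>i\<in>UNIV. \<Sum>m\<in>{- 2 * int N..<2 * int N}. of_real (tent N (m + h $ i) * tent N m)
        * e (of_int m * (t * of_int (v $ i))))"
    by (rule sum_int_box_prod) simp
  also have "cmod \<dots> \<le> (\<Prod>i\<in>UNIV. 40 * real N / (1 + real N * int_dist (t * of_int (v $ i)))\<^sup>2)"
    unfolding prod_norm[symmetric] by (intro prod_mono conjI norm_ge_zero tent_sum_bound N)
  finally show ?thesis .
qed

text \<open>Weyl differencing: with n = m + h in the square, the terms quadratic in m cancel, and
  apart from a factor in h alone only the phase bilinear in (h, m) survives. Differences of points
  of the weight box lie in the doubled box; summing h over all of it is free, because the weight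
  vanishes at the added points.\<close>

lemma norm_kernel_square_le:
  fixes A :: "real^'d^'d"
  assumes N: "N \<ge> 1" and A: "transpose A = A"
    and V: "\<And>h. 2 *\<^sub>R (A *v real_vec h) = real_vec (V h)"
  shows "(cmod (kernel A N t \<theta>))\<^sup>2 \<le> (\<Sum>h\<in>int_box {- 4 * int N..<4 * int N}.
     \<Prod>i\<in>UNIV. 40 * real N / (1 + real N * int_dist (t * of_int (V h $ i)))\<^sup>2)"
proof -
  let ?B = "weight_box N :: (int^'d) set" and ?D = "int_box {- 4 * int N..<4 * int N} :: (int^'d) set"
  let ?R = "\<lambda>n. quad_form A (real_vec n)"
  let ?p = "\<lambda>n. t * ?R n + \<theta> \<bullet> real_vec n"
  have shift: "(\<Sum>n\<in>?B. of_real (box_weight N n * box_weight N m) * (e (?p n) * e (- ?p m)))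
     = (\<Sum>h\<in>?D. of_real (box_weight N (m + h) * box_weight N m) * (e (?p (m + h)) * e (- ?p m)))"
    if m: "m \<in> ?B" for m
  proof -
    have sub: "?B \<subseteq> (+) m ` ?D"
    proof
      fix n assume n: "n \<in> ?B"
      have "n - m \<in> ?D" unfolding int_box_def
      proof (intro CollectI allI)
        fix i
        have "n $ i \<in> {- 2 * int N..<2 * int N}" "m $ i \<in> {- 2 * int N..<2 * int N}"
          using m n by (auto simp: int_box_def)
        then show "(n - m) $ i \<in> {- 4 * int N..<4 * int N}" by auto
      qed
      then show "n \<in> (+) m ` ?D" by (intro image_eqI[of _ _ "n - m"]) auto
    qed
    have "(\<Sum>n\<in>?B. of_real (box_weight N n * box_weight N m) * (e (?p n) * e (- ?p m)))
      = (\<Sum>n\<in>(+) m ` ?D. of_real (box_weight N n * box_weight N m) * (e (?p n) * e (- ?p m)))"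
      by (rule sum.mono_neutral_cong_left) (use box_weight_eq_0[OF N] sub in auto)
    also have "(\<Sum>n\<in>(+) m ` ?D. of_real (box_weight N n * box_weight N m) * (e (?p n) * e (- ?p m)))
     = (\<Sum>h\<in>?D. of_real (box_weight N (m + h) * box_weight N m) * (e (?p (m + h)) * e (- ?p m)))"
      by (subst sum.reindex) auto
    finally show ?thesis .
  qed
  have "of_real ((cmod (kernel A N t \<theta>))\<^sup>2) = kernel A N t \<theta> * cnj (kernel A N t \<theta>)"
    by (simp only: complex_norm_square)
  also have "\<dots> = (\<Sum>m\<in>?B. \<Sum>n\<in>?B. of_real (box_weight N n * box_weight N m) * (e (?p n) * e (- ?p m)))"
    unfolding kernel_def cnj_sum complex_cnj_mult complex_cnj_complex_of_real cnj_e sum_product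
    by (subst sum.swap) (simp add: mult_ac)
  also have "\<dots> = (\<Sum>m\<in>?B. \<Sum>h\<in>?D. of_real (box_weight N (m + h) * box_weight N m) * (e (?p (m + h)) * e (- ?p m)))"
    by (intro sum.cong refl shift)
  also have "\<dots> = (\<Sum>h\<in>?D. e (?p h) * (\<Sum>m\<in>?B. of_real (box_weight N (m + h) * box_weight N m)
      * e (t * (2 * ((A *v real_vec h) \<bullet> real_vec m)))))"
  proof (subst sum.swap, intro sum.cong refl)
    fix h :: "int^'d"
    have "e (?p (m + h)) * e (- ?p m) = e (?p h) * e (t * (2 * ((A *v real_vec h) \<bullet> real_vec m)))" for m
      unfolding e_add[symmetric]
      unfolding real_vec_add quad_form_add[OF A]
      by (rule arg_cong[where f = e]) (simp add: algebra_simps inner_add_right)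
    then show "(\<Sum>m\<in>?B. of_real (box_weight N (m + h) * box_weight N m) * (e (?p (m + h)) * e (- ?p m)))
      = e (?p h) * (\<Sum>m\<in>?B. of_real (box_weight N (m + h) * box_weight N m)
      * e (t * (2 * ((A *v real_vec h) \<bullet> real_vec m))))"
      by (simp add: sum_distrib_left mult_ac)
  qed
  finally have "(cmod (kernel A N t \<theta>))\<^sup>2 = cmod (\<Sum>h\<in>?D. e (?p h) * (\<Sum>m\<in>?B. of_real (box_weight N (m + h) * box_weight N m)
      * e (t * (2 * ((A *v real_vec h) \<bullet> real_vec m)))))"
    by (metis abs_of_nonneg norm_of_real zero_le_power2)
  also have "\<dots> \<le> (\<Sum>h\<in>?D. \<Prod>i\<in>UNIV. 40 * real N / (1 + real N * int_dist (t * of_int (V h $ i)))\<^sup>2)"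
    by (rule sum_norm_le) (simp only: norm_mult norm_e mult_1_left norm_differenced_sum_le[OF N V])
  finally show ?thesis .
qed

text \<open>Non-degeneracy makes h -> 2 A h injective, with image in a box of side O(N). All
  summands are nonnegative, so the image may be enlarged to the full box, over which the sum factors
  into a d-th power; this takes the place of diagonalising the form.\<close>

lemma kernel_weyl_sum:
  fixes A :: "real^'d^'d"
  assumes A: "integer_form_matrix A" and nd: "nondegenerate A"
  obtains H0 :: nat where "\<And>N t \<theta>. N \<ge> 1 \<Longrightarrow> (cmod (kernel A N t \<theta>))\<^sup>2 \<le>
    (\<Sum>v\<in>{- int (H0 * N)..int (H0 * N)}. 40 * real N / (1 + real N * int_dist (t * of_int v))\<^sup>2) ^ CARD('d)"
proof -
  define a where "a = (\<lambda>i j. \<lfloor>A $ i $ j\<rfloor>)"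
  have a: "A $ i $ j = of_int (a i j)" for i j
    using A by (simp add: a_def integer_form_matrix_def of_int_floor)
  define V :: "int^'d \<Rightarrow> int^'d" where "V = (\<lambda>h. \<chi> i. \<Sum>j\<in>UNIV. 2 * a i j * h $ j)"
  have V: "2 *\<^sub>R (A *v real_vec h) = real_vec (V h)" for h
    by (simp add: V_def vec_eq_iff matrix_vector_mult_def a sum_distrib_left mult_ac)
  \<comment> \<open>The factor 8 is the 2 of 2 A times the 4 of |h_j| <= 4 N; summing over all rows
    bounds every coordinate at once.\<close>
  define H0 where "H0 = nat (\<Sum>i\<in>UNIV. \<Sum>j\<in>UNIV. 8 * \<bar>a i j\<bar>)"
  have "(cmod (kernel A N t \<theta>))\<^sup>2 \<le>
    (\<Sum>v\<in>{- int (H0 * N)..int (H0 * N)}. 40 * real N / (1 + real N * int_dist (t * of_int v))\<^sup>2) ^ CARD('d)"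
    if N: "N \<ge> 1" for N t \<theta>
  proof -
  let ?D = "int_box {- 4 * int N..<4 * int N} :: (int^'d) set"
  let ?g = "\<lambda>v. 40 * real N / (1 + real N * int_dist (t * of_int v))\<^sup>2"
  have inj: "inj_on V ?D"
  proof (rule inj_onI)
    fix h h' assume "V h = V h'"
    then have "A *v real_vec h = A *v real_vec h'" using V by (metis scaleR_cancel_left zero_neq_numeral)
    then show "h = h'" using nd unfolding nondegenerate_def
      by (metis invertible_def matrix_vector_mul_assoc matrix_vector_mul_lid real_vec_eq_iff)
  qed
  have sub: "V ` ?D \<subseteq> int_box {- int (H0 * N)..int (H0 * N)}"
  proof -
    have "V h $ i \<in> {- int (H0 * N)..int (H0 * N)}" if h: "h \<in> ?D" for h i
    proof -
    have "\<bar>V h $ i\<bar> \<le> (\<Sum>j\<in>UNIV. \<bar>2 * a i j * h $ j\<bar>)" by (simp add: V_def)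
    also have "\<dots> \<le> (\<Sum>j\<in>UNIV. 8 * \<bar>a i j\<bar> * int N)"
    proof (rule sum_mono)
      fix j
      have "\<bar>h $ j\<bar> \<le> 4 * int N" using h by (auto simp: int_box_def abs_le_iff dest!: spec[of _ j])
      then have "2 * \<bar>a i j\<bar> * \<bar>h $ j\<bar> \<le> 2 * \<bar>a i j\<bar> * (4 * int N)" by (intro mult_left_mono) auto
      then show "\<bar>2 * a i j * h $ j\<bar> \<le> 8 * \<bar>a i j\<bar> * int N" by (simp add: abs_mult)
    qed
    also have "\<dots> = (\<Sum>j\<in>UNIV. 8 * \<bar>a i j\<bar>) * int N" by (simp add: sum_distrib_right)
    also have "\<dots> \<le> (\<Sum>i\<in>UNIV. \<Sum>j\<in>UNIV. 8 * \<bar>a i j\<bar>) * int N"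
      by (intro mult_right_mono member_le_sum) (auto intro!: sum_nonneg)
    also have "\<dots> = int H0 * int N" unfolding H0_def by (simp add: sum_nonneg)
    finally show ?thesis by (simp add: abs_le_iff)
    qed
    then show ?thesis unfolding int_box_def[of "{- int (H0 * N)..int (H0 * N)}"] by blast
  qed
  have "(cmod (kernel A N t \<theta>))\<^sup>2 \<le> (\<Sum>h\<in>?D. \<Prod>i\<in>UNIV. ?g (V h $ i))"
    using A by (intro norm_kernel_square_le[OF N _ V]) (simp add: integer_form_matrix_def)
  also have "\<dots> = (\<Sum>v\<in>V ` ?D. \<Prod>i\<in>UNIV. ?g (v $ i))" by (simp only: sum.reindex[OF inj] o_def)
  also have "\<dots> \<le> (\<Sum>v\<in>(int_box {- int (H0 * N)..int (H0 * N)} :: (int^'d) set). \<Prod>i\<in>UNIV. ?g (v $ i))"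
  proof (rule sum_mono2)
    show "V ` ?D \<subseteq> int_box {- int (H0 * N)..int (H0 * N)}" by (rule sub)
  qed (auto intro!: prod_nonneg)
  also have "\<dots> = (\<Sum>v\<in>{- int (H0 * N)..int (H0 * N)}. ?g v) ^ CARD('d)"
    by (subst sum_int_box_prod) auto
  finally show ?thesis by simp
  qed
  then show ?thesis by (rule that)
qed

text \<open>Dirichlet's theorem with denominators up to P ~ N^2 / L gives an approximation within L
  / (q N^2), so \<open>minor\<close> forces q > L, while q <= P. The spacing estimate has order
  N^2/q + N + q, and for L < q <= P and L <= N each of the three terms is O(N^2 / L).\<close>

lemma weyl_minor_sum:
  fixes N H0 L :: nat and t :: real
  assumes N: "N \<ge> 1" and L: "1 \<le> L" "L \<le> N"
    and minor: "\<And>q a. 1 \<le> q \<Longrightarrow> q \<le> L \<Longrightarrow> coprime a (int q) \<Longrightarrow> \<bar>t - of_int a / q\<bar> > real L / (real q * (real N)\<^sup>2)"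
  shows "(\<Sum>v\<in>{- int (H0 * N)..int (H0 * N)}. 40 * real N / (1 + real N * int_dist (t * of_int v))\<^sup>2)
    \<le> 80 * (12 * real H0 + 10) * (real N)\<^sup>2 / L"
proof -
  define P where "P = nat \<lceil>(real N)\<^sup>2 / L\<rceil>"
  have NL: "real N \<le> (real N)\<^sup>2 / L" "1 \<le> (real N)\<^sup>2 / L"
  proof -
    have "real N * real L \<le> real N * real N" using L by (intro mult_left_mono) auto
    then show "real N \<le> (real N)\<^sup>2 / L" using L by (simp add: field_simps power2_eq_square)
    moreover have "1 \<le> real N" using N by simp
    ultimately show "1 \<le> (real N)\<^sup>2 / L" by linarith
  qed
  have "real P = of_int \<lceil>(real N)\<^sup>2 / L\<rceil>" unfolding P_def using NL by simp
  then have P: "(real N)\<^sup>2 / L \<le> real P" "real P \<le> 2 * ((real N)\<^sup>2 / L)" "P > 0"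
    using NL by linarith+
  obtain a k where ak: "coprime a k" "0 < k" "k \<le> int P" "\<bar>of_int k * t - of_int a\<bar> < 1 / P"
    using Dirichlet_approx_coprime[OF P(3)] by blast
  define q where "q = nat k"
  have q: "q \<ge> 1" "k = int q" "real q \<le> real P" using ak by (auto simp: q_def)
  have "\<bar>t - of_int a / q\<bar> = \<bar>of_int k * t - of_int a\<bar> / q"
    using q by (simp add: field_simps abs_divide[symmetric])
  also have "\<dots> \<le> 1 / P / q" using ak q by (intro divide_right_mono) auto
  finally have approx: "\<bar>t - of_int a / q\<bar> \<le> 1 / (real P * real q)" by simp
  have "1 / (real P * real q) \<le> 1 / ((real N)\<^sup>2 / L * real q)"
    using P q NL by (intro divide_left_mono mult_right_mono mult_pos_pos) auto
  also have "\<dots> = real L / (real q * (real N)\<^sup>2)" using L by (simp add: field_simps)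
  finally have "\<bar>t - of_int a / q\<bar> \<le> real L / (real q * (real N)\<^sup>2)" using approx by linarith
  then have qL: "q > L" using minor[of q a] ak q by force
  have "1 / (real P * real q) \<le> 1 / (real q)\<^sup>2"
    unfolding power2_eq_square using P q by (intro divide_left_mono mult_right_mono mult_pos_pos) auto
  then have t: "\<bar>t - of_int a / q\<bar> \<le> 1 / (real q)\<^sup>2" using approx by linarith
  have "(\<Sum>v\<in>{- int (H0 * N)..int (H0 * N)}. 40 * real N / (1 + real N * int_dist (t * of_int v))\<^sup>2)
    = 40 * real N * (\<Sum>v\<in>{- int (H0 * N)..int (H0 * N)}. 1 / (1 + real N * int_dist (t * of_int v))\<^sup>2)"
    by (simp add: sum_distrib_left)
  also have "\<dots> \<le> 40 * real N * ((4 * real (H0 * N) / q + 2) * (2 * (1 + 2 * real q / N)))"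
    using ak q by (intro mult_left_mono sum_int_dist_le[OF N q(1) _ t]) auto
  also have "\<dots> = 80 * (4 * real H0 * ((real N)\<^sup>2 / q) + (8 * real H0 + 2) * real N + 4 * real q)"
    using N q by (simp add: field_simps power2_eq_square)
  also have "\<dots> \<le> 80 * (4 * real H0 * ((real N)\<^sup>2 / L) + (8 * real H0 + 2) * ((real N)\<^sup>2 / L) + 4 * (2 * ((real N)\<^sup>2 / L)))"
    using NL P q qL L by (intro mult_left_mono add_mono divide_left_mono) auto
  also have "\<dots> = 80 * (12 * real H0 + 10) * (real N)\<^sup>2 / L" by (simp add: algebra_simps add_divide_distrib)
  finally show ?thesis .
qed

theorem kernel_minor_arc_bound:
  fixes A :: "real^'d^'d"
  assumes A: "integer_form_matrix A" and nd: "nondegenerate A"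
  obtains C :: real where "C \<ge> 1" and "\<And>N L t \<theta>. \<lbrakk>1 \<le> L; L \<le> N;
      \<And>q a. \<lbrakk>1 \<le> q; q \<le> L; coprime a (int q)\<rbrakk> \<Longrightarrow> \<bar>t - of_int a / q\<bar> > real L / (real q * (real N)\<^sup>2)\<rbrakk>
    \<Longrightarrow> (cmod (kernel A N t \<theta>))\<^sup>2 \<le> (C * (real N)\<^sup>2 / L) ^ CARD('d)"
proof -
  obtain H0 :: nat where H0: "\<And>N t \<theta>. N \<ge> 1 \<Longrightarrow> (cmod (kernel A N t \<theta>))\<^sup>2 \<le>
    (\<Sum>v\<in>{- int (H0 * N)..int (H0 * N)}. 40 * real N / (1 + real N * int_dist (t * of_int v))\<^sup>2) ^ CARD('d)"
    using kernel_weyl_sum[OF A nd] by blast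
  show ?thesis
  proof (rule that)
    show "1 \<le> 80 * (12 * real H0 + 10)" by simp
    fix N L :: nat and t \<theta>
    assume L: "1 \<le> L" "L \<le> N"
      and minor: "\<And>q a. \<lbrakk>1 \<le> q; q \<le> L; coprime a (int q)\<rbrakk> \<Longrightarrow> \<bar>t - of_int a / q\<bar> > real L / (real q * (real N)\<^sup>2)"
    have N: "N \<ge> 1" using L by simp
    show "(cmod (kernel A N t \<theta>))\<^sup>2 \<le> (80 * (12 * real H0 + 10) * (real N)\<^sup>2 / L) ^ CARD('d)"
      by (rule order_trans[OF H0[OF N] power_mono[OF weyl_minor_sum[OF N L minor]]]) (auto intro: sum_nonneg)
  qed
qed

section \<open>Divisors\<close>

lemma card_divisors_coprime_mult:
  fixes p a m :: nat
  assumes "prime p" "\<not> p dvd m" "m > 0"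
  shows "card {h. h dvd p ^ a * m} \<le> (a + 1) * card {h. h dvd m}"
proof -
  have "{h. h dvd p ^ a * m} \<subseteq> (\<lambda>(i, h). p ^ i * h) ` ({..a} \<times> {h. h dvd m})"
  proof
    fix h assume "h \<in> {h. h dvd p ^ a * m}"
    then obtain b c where "h = b * c" "b dvd p ^ a" "c dvd m"
      using division_decomp[of h "p ^ a" m] by auto
    moreover from this obtain i where "i \<le> a" "b = p ^ i"
      using divides_primepow_nat[OF assms(1)] by blast
    ultimately show "h \<in> (\<lambda>(i, h). p ^ i * h) ` ({..a} \<times> {h. h dvd m})" by auto
  qed
  moreover have fin: "finite ({..a} \<times> {h. h dvd m})" using assms(3) by simp
  ultimately have "card {h. h dvd p ^ a * m} \<le> card ({..a} \<times> {h. h dvd m})"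
    by (meson card_image_le card_mono finite_imageI order_trans)
  then show ?thesis by (simp add: card_cartesian_product)
qed

text \<open>From 1 + x <= exp x. It serves the small primes p, for which p^(\<eta> a) alone need not
  dominate a + 1.\<close>

lemma Suc_le_const_powr:
  fixes \<eta> :: real assumes "\<eta> > 0"
  obtains C where "C \<ge> 1" "\<And>a. real a + 1 \<le> C * 2 powr (\<eta> * a)"
proof -
  define c where "c = \<eta> * ln 2"
  have c: "c > 0" using assms by (simp add: c_def)
  have "real a + 1 \<le> (1 + 1 / c) * 2 powr (\<eta> * a)" for a :: nat
  proof -
    have "1 + c * a \<le> 2 powr (\<eta> * a)"
      using exp_ge_add_one_self[of "c * a"] by (simp add: powr_def c_def mult_ac)
    then have "(1 + 1 / c) * (1 + c * a) \<le> (1 + 1 / c) * 2 powr (\<eta> * a)"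
      using c by (intro mult_left_mono) auto
    moreover have "(1 + 1 / c) * (1 + c * a) = 1 + 1 / c + c * a + a"
      using c by (simp add: field_simps)
    moreover have "0 \<le> c * a" "0 \<le> 1 / c" using c by simp_all
    ultimately show ?thesis by linarith
  qed
  then show ?thesis using c by (intro that[of "1 + 1 / c"]) auto
qed

text \<open>Peeling off a prime power p^a costs a factor a + 1. For p >= 2^(1/\<eta>) this is at
  most 2^a <= p^(\<eta> a), with no constant; each smaller prime costs a factor C, and there are at
  most P of them.\<close>

theorem divisor_bound:
  fixes \<eta> :: real assumes \<eta>: "\<eta> > 0"
  obtains C where "C \<ge> 1" "\<And>m::nat. m > 0 \<Longrightarrow> real (card {h. h dvd m}) \<le> C * real m powr \<eta>"
proof -
  obtain C where C: "C \<ge> 1" "\<And>a. real a + 1 \<le> C * 2 powr (\<eta> * a)" using Suc_le_const_powr[OF \<eta>] by blast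
  define P where "P = nat \<lceil>2 powr (1 / \<eta>)\<rceil>"
  have big: "real a + 1 \<le> real p powr (\<eta> * a)" if "p \<ge> P" for p a :: nat
  proof -
    have "2 powr (1/\<eta>) \<le> real p" using that unfolding P_def by linarith
    then have "(2 powr (1/\<eta>)) powr (\<eta> * a) \<le> real p powr (\<eta> * a)"
      using \<eta> by (intro powr_mono2) auto
    moreover have "(2 powr (1/\<eta>)) powr (\<eta> * a) = 2 powr real a" using \<eta> by (simp add: powr_powr)
    moreover have "real a + 1 \<le> 2 ^ a" using Bernoulli_inequality[of "1::real" a] by simp
    ultimately show ?thesis by (simp add: powr_realpow)
  qed
  have main: "real (card {h. h dvd m}) \<le> C ^ card {p \<in> prime_factors m. p < P} * real m powr \<eta>" if "m > 0" for m :: nat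
    using that
  proof (induction m rule: less_induct)
    case (less m)
    show ?case
    proof (cases "m = 1")
      case True
      then show ?thesis by simp
    next
      case False
      then obtain p where p: "prime p" "p dvd m" using prime_factor_nat by blast
      define a where "a = multiplicity p m"
      obtain k where k: "m = p ^ a * k" "\<not> p dvd k"
        using multiplicity_decompose'[of m p] less.prems p a_def by (metis not_prime_unit less_numeral_extra(3))
      have a: "a > 0" using k p by (metis gr0I mult_1 power_0)
      have k0: "k > 0" "k < m"
      proof -
        show "k > 0" using k less.prems by (cases k) auto
        have "p ^ a > 1" using p a by (metis one_less_power prime_gt_1_nat)
        then show "k < m" using k \<open>k > 0\<close> by simp
      qed
      have pf: "prime_factors m = insert p (prime_factors k)"
        using k p a k0 by (simp add: prime_factors_product prime_factorization_prime_power)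
      have pk: "p \<notin> prime_factors k" using k by (auto simp: in_prime_factors_iff)
      let ?c = "\<lambda>m. card {p \<in> prime_factors m. p < P}"
      have m_powr: "real m powr \<eta> = real p powr (\<eta> * a) * real k powr \<eta>"
        using k p prime_gt_0_nat[OF p(1)]
        by (simp add: powr_mult powr_realpow[symmetric] powr_powr mult.commute)
      have "real (card {h. h dvd m}) \<le> real ((a + 1) * card {h. h dvd k})"
        unfolding k(1) using card_divisors_coprime_mult[OF p(1) k(2) k0(1)] by (simp only: of_nat_le_iff)
      also have "\<dots> = (real a + 1) * real (card {h. h dvd k})" by (simp add: algebra_simps)
      also have "\<dots> \<le> (real a + 1) * (C ^ ?c k * real k powr \<eta>)"
        using less.IH[OF k0(2) k0(1)] by (intro mult_left_mono) auto
      also have "\<dots> \<le> C ^ ?c m * real m powr \<eta>"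
      proof (cases "p < P")
        case True
        have "{q \<in> prime_factors m. q < P} = insert p {q \<in> prime_factors k. q < P}" unfolding pf using True by auto
        then have c: "?c m = Suc (?c k)" using pk by simp
        have "real a + 1 \<le> C * real p powr (\<eta> * a)"
        proof -
          have "2 powr (\<eta> * a) \<le> real p powr (\<eta> * a)" using \<eta> prime_ge_2_nat[OF p(1)] by (intro powr_mono2) auto
          then have "C * 2 powr (\<eta> * a) \<le> C * real p powr (\<eta> * a)" using C by (intro mult_left_mono) auto
          then show ?thesis using C(2)[of a] by linarith
        qed
        then have "(real a + 1) * (C ^ ?c k * real k powr \<eta>) \<le> (C * real p powr (\<eta> * a)) * (C ^ ?c k * real k powr \<eta>)"
          using C by (intro mult_right_mono) auto
        then show ?thesis unfolding c m_powr by (simp add: mult_ac)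
      next
        case False
        then have "{q \<in> prime_factors m. q < P} = {q \<in> prime_factors k. q < P}" unfolding pf by auto
        then have c: "?c m = ?c k" by simp
        have "(real a + 1) * (C ^ ?c k * real k powr \<eta>) \<le> real p powr (\<eta> * a) * (C ^ ?c k * real k powr \<eta>)"
          using C big[of p a] False by (intro mult_right_mono) auto
        then show ?thesis unfolding c m_powr by (simp add: mult_ac)
      qed
      finally show ?thesis .
    qed
  qed
  show ?thesis
  proof (rule that)
    show "1 \<le> C ^ P" using C by simp
    fix m :: nat assume "m > 0"
    have "card {p \<in> prime_factors m. p < P} \<le> card {..<P}" by (rule card_mono) auto
    then have "C ^ card {p \<in> prime_factors m. p < P} \<le> C ^ P" using C by (intro power_increasing) auto
    then have "C ^ card {p \<in> prime_factors m. p < P} * real m powr \<eta> \<le> C ^ P * real m powr \<eta>" by (intro mult_right_mono) auto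
    then show "real (card {h. h dvd m}) \<le> C ^ P * real m powr \<eta>" using main[OF \<open>m > 0\<close>] by linarith
  qed
qed

section \<open>Moments of the truncated divisor function\<close>

definition small_divisors :: "nat \<Rightarrow> nat \<Rightarrow> nat" where
  "small_divisors L k = card {h \<in> {1..L}. h dvd k}"

lemma harm_eq_sum: "harm L = (\<Sum>q\<in>{1..L}. 1 / real q)"
  by (simp add: harm_def inverse_eq_divide)

lemma sum_multiples_le:
  fixes f :: "nat \<Rightarrow> real"
  assumes m: "m \<ge> 1" and f: "\<And>j. 0 \<le> f j"
  shows "(\<Sum>k\<in>{k\<in>{1..Y}. m dvd k}. f (k div m)) \<le> (\<Sum>j\<in>{1..Y}. f j)"
proof -
  have "(\<Sum>k\<in>{k\<in>{1..Y}. m dvd k}. f (k div m)) = (\<Sum>j\<in>{1..Y div m}. f j)"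
  proof (rule sum.reindex_bij_witness[of _ "\<lambda>j. j * m" "\<lambda>k. k div m"])
    fix k assume k: "k \<in> {k \<in> {1..Y}. m dvd k}"
    then show "k div m * m = k" by simp
    have "m \<le> k" using k by (auto intro: dvd_imp_le)
    then show "k div m \<in> {1..Y div m}" using k m by (simp add: div_le_mono Suc_le_eq div_greater_zero_iff)
  next
    fix j assume j: "j \<in> {1..Y div m}"
    then show "j * m div m = j" using m by simp
    have "j * m \<le> Y" using j m by (simp add: less_eq_div_iff_mult_less_eq)
    then show "j * m \<in> {k \<in> {1..Y}. m dvd k}" using j m by simp
  qed simp
  also have "\<dots> \<le> (\<Sum>j\<in>{1..Y}. f j)"
    by (rule sum_mono2) (auto simp: f intro: order_trans[OF _ div_le_dividend])
  finally show ?thesis .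
qed

lemma sum_multiples_inverse_le:
  assumes "g \<ge> 1"
  shows "(\<Sum>h\<in>{h\<in>{1..L}. g dvd h}. real g / real h) \<le> harm L"
proof -
  have "(\<Sum>h\<in>{h\<in>{1..L}. g dvd h}. real g / real h) = (\<Sum>h\<in>{h\<in>{1..L}. g dvd h}. 1 / real (h div g))"
  proof (rule sum.cong[OF refl])
    fix h assume "h \<in> {h\<in>{1..L}. g dvd h}"
    then have "real (h div g) = real h / real g" by (intro real_of_nat_div) simp
    then show "real g / real h = 1 / real (h div g)" by simp
  qed
  also have "\<dots> \<le> harm L"
    unfolding harm_eq_sum by (rule sum_multiples_le[OF assms, where f = "\<lambda>j. 1 / real j"]) simp
  finally show ?thesis .
qed

text \<open>Write 1/lcm(m, h) = gcd(m, h) / (m h) and enlarge the gcd term to a sum over all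
  divisors g of m that also divide h. For each g the sum of g/h over h is harmonic.\<close>

lemma sum_inverse_lcm_le:
  assumes m: "m \<ge> 1"
  shows "(\<Sum>h\<in>{1..L}. 1 / real (lcm m h)) \<le> real (card {g. g dvd m}) * harm L / m"
proof -
  have "1 / real (lcm m h) \<le> (\<Sum>g\<in>{g. g dvd m}. if g dvd h then real g / real h else 0) / m" if h: "h \<in> {1..L}" for h
  proof -
    have "real (lcm m h) * real (gcd m h) = real m * real h"
      unfolding of_nat_mult[symmetric] by (metis prod_gcd_lcm_nat mult.commute)
    then have "1 / real (lcm m h) = real (gcd m h) / real h / m"
      using h m by (simp add: field_simps lcm_pos_nat)
    also have "real (gcd m h) / real h = (if gcd m h dvd h then real (gcd m h) / real h else 0)" by simp
    also have "\<dots> \<le> (\<Sum>g\<in>{g. g dvd m}. if g dvd h then real g / real h else 0)"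
      by (rule member_le_sum) (use m in auto)
    finally show ?thesis by (simp add: divide_right_mono)
  qed
  then have "(\<Sum>h\<in>{1..L}. 1 / real (lcm m h)) \<le> (\<Sum>h\<in>{1..L}. (\<Sum>g\<in>{g. g dvd m}. if g dvd h then real g / real h else 0) / m)"
    by (rule sum_mono)
  also have "\<dots> = (\<Sum>g\<in>{g. g dvd m}. (\<Sum>h\<in>{1..L}. if g dvd h then real g / real h else 0)) / m"
    unfolding sum_divide_distrib[symmetric] by (subst sum.swap) simp
  also have "\<dots> = (\<Sum>g\<in>{g. g dvd m}. (\<Sum>h\<in>{h\<in>{1..L}. g dvd h}. real g / real h)) / m"
    by (intro arg_cong[where f = "\<lambda>x. x / real m"] sum.cong refl sum.inter_filter[symmetric]) simp
  also have "\<dots> \<le> (\<Sum>g\<in>{g. g dvd m}. harm L) / m"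
    using m by (intro divide_right_mono sum_mono sum_multiples_inverse_le) (auto intro!: Suc_leI gr0I)
  finally show ?thesis by simp
qed

text \<open>Integral comparison along the multiples of m, in telescoped form. It matters that k
  starts at 1: the term 1/T^2 of k = 0 would not carry the saving 1/m.\<close>

lemma sum_inverse_square_multiples_le:
  fixes T :: real
  assumes m: "m \<ge> 1" and T: "T > 0"
  shows "(\<Sum>k\<in>{k\<in>{1..Y}. m dvd k}. 1 / (T + real k)\<^sup>2) \<le> 1 / (T * real m)"
proof -
  have tel: "(\<Sum>j\<in>{1..n}. 1 / (T + real m * real j)\<^sup>2) \<le> (1 / T - 1 / (T + real m * real n)) / m" for n
  proof (induction n)
    case (Suc n)
    define x where "x = T + real m * real n"
    have x: "x > 0" using T by (simp add: x_def add_pos_nonneg)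
    have "1 / (x + m)\<^sup>2 \<le> 1 / (x * (x + m))"
      unfolding power2_eq_square using x m by (intro divide_left_mono mult_right_mono mult_pos_pos) auto
    also have "\<dots> = (1 / x - 1 / (x + m)) / m"
    proof -
      have "1 / x - 1 / (x + m) = m / (x * (x + m))" using x by (simp add: field_simps)
      then show ?thesis using m by simp
    qed
    finally have "1 / (T + real m * real (Suc n))\<^sup>2 \<le> (1 / x - 1 / (T + real m * real (Suc n))) / m"
      by (simp add: x_def algebra_simps)
    then show ?case using Suc.IH by (simp add: x_def diff_divide_distrib)
  qed simp
  have "(\<Sum>k\<in>{k\<in>{1..Y}. m dvd k}. 1 / (T + real k)\<^sup>2)
      = (\<Sum>k\<in>{k\<in>{1..Y}. m dvd k}. 1 / (T + real m * real (k div m))\<^sup>2)"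
  proof (rule sum.cong[OF refl])
    fix k assume "k \<in> {k\<in>{1..Y}. m dvd k}"
    then have "real (k div m) = real k / real m" by (intro real_of_nat_div) simp
    then show "1 / (T + real k)\<^sup>2 = 1 / (T + real m * real (k div m))\<^sup>2" using m by simp
  qed
  also have "\<dots> \<le> (\<Sum>j\<in>{1..Y}. 1 / (T + real m * real j)\<^sup>2)"
    by (rule sum_multiples_le[OF m, where f = "\<lambda>j. 1 / (T + real m * real j)\<^sup>2"]) simp
  also have "\<dots> \<le> (1 / T - 1 / (T + real m * real Y)) / m" by (rule tel)
  also have "\<dots> \<le> (1 / T) / m" using T by (intro divide_right_mono) (auto simp: add_pos_nonneg)
  finally show ?thesis by simp
qed

text \<open>The frequency \<open>k = 0\<close>, where \<open>small_divisors L k = L\<close>, must be left out. The induction on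
  the exponent is over all residue conditions \<open>m dvd k\<close>, since multiplying by another factor
  \<open>small_divisors L k\<close> replaces \<open>m\<close> by \<open>lcm m h\<close>.\<close>

lemma small_divisors_moment:
  fixes T D :: real
  assumes L: "L \<ge> 1" and T: "T > 0" and D: "\<And>m. 1 \<le> m \<Longrightarrow> m \<le> L ^ R \<Longrightarrow> real (card {g. g dvd m}) \<le> D"
  shows "(\<Sum>k\<in>{1..Y}. real (small_divisors L k) ^ R / (T + real k)\<^sup>2) \<le> (D * harm L) ^ R / T"
proof -
  have H: "0 \<le> (harm L :: real)" by (rule harm_nonneg)
  have D0: "D \<ge> 0" using D[of 1] L by simp
  \<comment> \<open>Each of the r remaining factors replaces m by \<open>lcm m h\<close>, which is
    at most m L. The bound L ^ (R - r) therefore keeps all moduli within L ^ R, where D controls the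
    number of divisors.\<close>
  have "(\<Sum>k\<in>{k\<in>{1..Y}. m dvd k}. real (small_divisors L k) ^ r / (T + real k)\<^sup>2) \<le> (D * harm L) ^ r / (T * real m)"
    if "r \<le> R" "1 \<le> m" "m \<le> L ^ (R - r)" for r m
    using that
  proof (induction r arbitrary: m)
    case 0
    then show ?case using sum_inverse_square_multiples_le[of m T Y] T by simp
  next
    case (Suc r)
    let ?f = "\<lambda>k. real (small_divisors L k) ^ r / (T + real k)\<^sup>2"
    have "(\<Sum>k\<in>{k\<in>{1..Y}. m dvd k}. real (small_divisors L k) ^ Suc r / (T + real k)\<^sup>2)
      = (\<Sum>k\<in>{k\<in>{1..Y}. m dvd k}. \<Sum>h\<in>{1..L}. if h dvd k then ?f k else 0)"
    proof (rule sum.cong[OF refl])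
      fix k
      have "(\<Sum>h\<in>{1..L}. if h dvd k then ?f k else 0) = (\<Sum>h\<in>{h\<in>{1..L}. h dvd k}. ?f k)"
        by (rule sum.inter_filter[symmetric]) simp
      also have "\<dots> = real (small_divisors L k) * ?f k"
        by (simp only: sum_constant small_divisors_def[of L k, symmetric])
      finally show "real (small_divisors L k) ^ Suc r / (T + real k)\<^sup>2 = (\<Sum>h\<in>{1..L}. if h dvd k then ?f k else 0)" by simp
    qed
    also have "\<dots> = (\<Sum>h\<in>{1..L}. \<Sum>k\<in>{k\<in>{1..Y}. m dvd k}. if h dvd k then ?f k else 0)" by (rule sum.swap)
    also have "\<dots> = (\<Sum>h\<in>{1..L}. \<Sum>k\<in>{k\<in>{1..Y}. lcm m h dvd k}. ?f k)"
    proof (rule sum.cong[OF refl])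
      fix h
      have "{k\<in>{1..Y}. lcm m h dvd k} = {k\<in>{k\<in>{1..Y}. m dvd k}. h dvd k}" by auto
      then show "(\<Sum>k\<in>{k\<in>{1..Y}. m dvd k}. if h dvd k then ?f k else 0) = (\<Sum>k\<in>{k\<in>{1..Y}. lcm m h dvd k}. ?f k)"
        by (simp only:) (rule sum.inter_filter[symmetric], simp)
    qed
    also have "\<dots> \<le> (\<Sum>h\<in>{1..L}. (D * harm L) ^ r / (T * real (lcm m h)))"
    proof (rule sum_mono)
      fix h assume h: "h \<in> {1..L}"
      have "lcm m h \<le> m * h" using Suc.prems h by (intro dvd_imp_le) (auto simp: lcm_least)
      also have "\<dots> \<le> L ^ (R - Suc r) * L" using Suc.prems h by (intro mult_mono) auto
      also have "\<dots> = L ^ (R - r)" using Suc.prems(1) by (metis Suc_diff_Suc Suc_le_lessD power_Suc2)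
      finally show "(\<Sum>k\<in>{k\<in>{1..Y}. lcm m h dvd k}. ?f k) \<le> (D * harm L) ^ r / (T * real (lcm m h))"
        using Suc.prems h by (intro Suc.IH) (auto simp: Suc_le_eq lcm_pos_nat)
    qed
    also have "\<dots> = (D * harm L) ^ r / T * (\<Sum>h\<in>{1..L}. 1 / real (lcm m h))"
      by (simp add: sum_distrib_left)
    also have "\<dots> \<le> (D * harm L) ^ r / T * (D * harm L / m)"
    proof (rule mult_left_mono)
      have "m \<le> L ^ R" using Suc.prems(3) L by (meson diff_le_self order_trans power_increasing)
      then have "real (card {g. g dvd m}) * harm L / m \<le> D * harm L / m"
        using Suc.prems H by (intro divide_right_mono mult_right_mono D) auto
      then show "(\<Sum>h\<in>{1..L}. 1 / real (lcm m h)) \<le> D * harm L / m"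
        using sum_inverse_lcm_le[OF Suc.prems(2), of L] by linarith
      show "0 \<le> (D * harm L) ^ r / T" using D0 H T by simp
    qed
    finally show ?case by (simp add: mult_ac)
  qed
  from this[of R 1] have "(\<Sum>k\<in>{k\<in>{1..Y}. 1 dvd k}. real (small_divisors L k) ^ R / (T + real k)\<^sup>2) \<le> (D * harm L) ^ R / T"
    by simp
  moreover have "{k\<in>{1..Y}. 1 dvd k} = {1..Y}" by auto
  ultimately show ?thesis by (simp only:)
qed

section \<open>Major arcs\<close>

lemma prod_primes_dvd_iff:
  fixes X :: "nat set"
  assumes "finite X" "\<And>p. p \<in> X \<Longrightarrow> prime p"
  shows "\<Prod>X dvd a \<longleftrightarrow> (\<forall>p\<in>X. p dvd a)"
  using assms
proof (induction X rule: finite_induct)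
  case (insert p X)
  have "coprime p (\<Prod>X)" using insert by (intro prod_coprime_right) (auto intro!: primes_coprime)
  then have "p * \<Prod>X dvd a \<longleftrightarrow> p dvd a \<and> \<Prod>X dvd a"
    by (meson divides_mult dvd_mult_left dvd_mult_right)
  then show ?case using insert by simp
qed simp

text \<open>Moebius inversion over sets of primes: expand the product of 1 - [p divides a] over the
  primes p of q. The sets X stand for the squarefree divisors of q.\<close>

lemma of_bool_coprime_eq:
  fixes q a :: nat assumes "q > 0"
  shows "of_bool (coprime a q) = (\<Sum>X\<in>Pow (prime_factors q). (-1) ^ card X * of_bool (\<Prod>X dvd a) :: complex)"
proof -
  let ?P = "prime_factors q"
  have "coprime a q \<longleftrightarrow> (\<forall>p\<in>?P. \<not> p dvd a)"
  proof (intro iffI ballI)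
    fix p assume "coprime a q" "p \<in> ?P"
    then show "\<not> p dvd a" by (metis coprime_common_divisor in_prime_factors_iff not_prime_unit)
  next
    assume no: "\<forall>p\<in>?P. \<not> p dvd a"
    show "coprime a q"
    proof (rule ccontr)
      assume "\<not> coprime a q"
      then obtain p where "prime p" "p dvd gcd a q" using prime_factor_nat[of "gcd a q"] by (auto simp: coprime_iff_gcd_eq_1)
      then show False using no assms by (auto simp: in_prime_factors_iff)
    qed
  qed
  then have "of_bool (coprime a q) = (\<Prod>p\<in>?P. - of_bool (p dvd a) + 1 :: complex)"
    by (auto simp: prod_zero_iff)
  also have "\<dots> = (\<Sum>X\<in>Pow ?P. (\<Prod>p\<in>X. - of_bool (p dvd a)) * (\<Prod>p\<in>?P - X. 1))"
    by (rule prod_add) simp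
  also have "\<dots> = (\<Sum>X\<in>Pow ?P. (-1) ^ card X * of_bool (\<Prod>X dvd a))"
  proof (rule sum.cong[OF refl])
    fix X assume "X \<in> Pow ?P"
    then have X: "finite X" "\<And>p. p \<in> X \<Longrightarrow> prime p" by (auto intro: finite_subset simp: in_prime_factors_iff)
    have "(\<Prod>p\<in>X. - of_bool (p dvd a) :: complex) = (\<Prod>p\<in>X. (-1) * of_bool (p dvd a))" by simp
    also have "\<dots> = (-1) ^ card X * (\<Prod>p\<in>X. of_bool (p dvd a))" by (subst prod.distrib) simp
    also have "(\<Prod>p\<in>X. of_bool (p dvd a) :: complex) = of_bool (\<Prod>X dvd a)"
    proof -
      have "\<Prod>X dvd a \<longleftrightarrow> (\<forall>p\<in>X. p dvd a)" by (rule prod_primes_dvd_iff[OF X])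
      then show ?thesis using X(1) by (cases "\<forall>p\<in>X. p dvd a") (auto simp: prod_zero_iff)
    qed
    finally show "(\<Prod>p\<in>X. - of_bool (p dvd a)) * (\<Prod>p\<in>?P - X. 1) = ((-1) ^ card X * of_bool (\<Prod>X dvd a) :: complex)" by simp
  qed
  finally show ?thesis .
qed

lemma sum_filter_of_bool:
  fixes f :: "'a \<Rightarrow> complex"
  assumes "finite A"
  shows "(\<Sum>x\<in>{x\<in>A. P x}. f x) = (\<Sum>x\<in>A. of_bool (P x) * f x)"
proof -
  have "(\<Sum>x\<in>A. of_bool (P x) * f x) = (\<Sum>x\<in>A. if P x then f x else 0)" by (intro sum.cong) auto
  then show ?thesis using sum.inter_filter[OF assms, of f P] by simp
qed

lemma sum_e_nat_complete:
  fixes n :: nat and k :: int assumes "n > 0"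
  shows "(\<Sum>b<n. e (real b * of_int k / n)) = (if int n dvd k then of_nat n else 0)"
proof -
  have "(\<Sum>b<n. e (real b * of_int k / n)) = (\<Sum>r\<in>{0..<0 + int n}. e (of_int r * (of_int k / of_int (int n))))"
    by (rule sum.reindex_bij_witness[of _ nat int]) auto
  also have "\<dots> = (if int n dvd k then of_int (int n) else 0)"
    by (rule sum_e_complete) (use assms in simp)
  finally show ?thesis by simp
qed

text \<open>A Ramanujan sum is the sum of \<mu>(q/h) h over the common divisors h of q and k, and
  the triangle inequality removes the signs. Here h = q / \<Prod>X; distinct X give distinct h,
  because a finite set of primes is determined by its product.\<close>

lemma norm_ramanujan_sum_le:
  fixes q :: nat and k :: int assumes q: "q > 0"
  shows "cmod (\<Sum>a\<in>{a\<in>{..<q}. coprime a q}. e (real a * of_int k / q))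
    \<le> (\<Sum>h\<in>{h\<in>{1..q}. h dvd q \<and> int h dvd k}. real h)"
proof -
  let ?P = "prime_factors q"
  have P: "finite X" "\<And>p. p \<in> X \<Longrightarrow> prime p" "\<Prod>X dvd q" "\<Prod>X > 0" if "X \<in> Pow ?P" for X
  proof -
    show X: "finite X" "\<And>p. p \<in> X \<Longrightarrow> prime p" using that by (auto intro: finite_subset simp: in_prime_factors_iff)
    have "\<forall>p\<in>X. p dvd q" using that by (auto simp: in_prime_factors_iff)
    then show "\<Prod>X dvd q" using prod_primes_dvd_iff[OF X, of q] by simp
    then show "\<Prod>X > 0" using q by (meson dvd_pos_nat)
  qed
  have inner: "(\<Sum>a\<in>{a\<in>{..<q}. g dvd a}. e (real a * of_int k / q)) = (if int (q div g) dvd k then of_nat (q div g) else 0)"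
    if g: "g dvd q" "g > 0" for g
  proof -
    obtain n where n: "q = g * n" "n > 0" using g q by (metis dvdE mult_0_right neq0_conv)
    have "(\<Sum>a\<in>{a\<in>{..<q}. g dvd a}. e (real a * of_int k / q)) = (\<Sum>b<n. e (real b * of_int k / n))"
      by (rule sum.reindex_bij_witness[of _ "\<lambda>b. g * b" "\<lambda>a. a div g"]) (use g n in auto)
    then show ?thesis using sum_e_nat_complete[OF n(2)] n g by simp
  qed
  have "(\<Sum>a\<in>{a\<in>{..<q}. coprime a q}. e (real a * of_int k / q)) = (\<Sum>a<q. of_bool (coprime a q) * e (real a * of_int k / q))"
    by (rule sum_filter_of_bool) simp
  also have "\<dots> = (\<Sum>X\<in>Pow ?P. (-1) ^ card X * (\<Sum>a<q. of_bool (\<Prod>X dvd a) * e (real a * of_int k / q)))"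
    unfolding of_bool_coprime_eq[OF q] sum_distrib_right sum_distrib_left by (subst sum.swap) (simp add: mult.assoc)
  also have "\<dots> = (\<Sum>X\<in>Pow ?P. (-1) ^ card X * (if int (q div \<Prod>X) dvd k then of_nat (q div \<Prod>X) else 0))"
  proof (rule sum.cong[OF refl])
    fix X assume X: "X \<in> Pow ?P"
    have "(\<Sum>a<q. of_bool (\<Prod>X dvd a) * e (real a * of_int k / q)) = (\<Sum>a\<in>{a\<in>{..<q}. \<Prod>X dvd a}. e (real a * of_int k / q))"
      by (rule sum_filter_of_bool[symmetric]) simp
    then show "(-1) ^ card X * (\<Sum>a<q. of_bool (\<Prod>X dvd a) * e (real a * of_int k / q))
      = (-1) ^ card X * (if int (q div \<Prod>X) dvd k then of_nat (q div \<Prod>X) else 0)"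
      using inner P[OF X] by simp
  qed
  also have "cmod \<dots> \<le> (\<Sum>X\<in>Pow ?P. if int (q div \<Prod>X) dvd k then real (q div \<Prod>X) else 0)"
    by (rule sum_norm_le) (simp add: norm_mult norm_power)
  also have "\<dots> = (\<Sum>X\<in>{X\<in>Pow ?P. int (q div \<Prod>X) dvd k}. real (q div \<Prod>X))"
    by (rule sum.inter_filter[symmetric]) simp
  also have "\<dots> = (\<Sum>h\<in>(\<lambda>X. q div \<Prod>X) ` {X\<in>Pow ?P. int (q div \<Prod>X) dvd k}. real h)"
  proof (subst sum.reindex)
    show "inj_on (\<lambda>X. q div \<Prod>X) {X\<in>Pow ?P. int (q div \<Prod>X) dvd k}"
    proof (rule inj_onI)
      fix X Y assume "X \<in> {X\<in>Pow ?P. int (q div \<Prod>X) dvd k}" "Y \<in> {X\<in>Pow ?P. int (q div \<Prod>X) dvd k}"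
        and eq: "q div \<Prod>X = q div \<Prod>Y"
      then have XY: "X \<in> Pow ?P" "Y \<in> Pow ?P" by auto
      have pr: "\<Prod>X = \<Prod>Y"
    proof -
      have "(q div \<Prod>X) * \<Prod>X = q" "(q div \<Prod>X) * \<Prod>Y = q"
        using dvd_div_mult_self[OF P(3)[OF XY(1)]] dvd_div_mult_self[OF P(3)[OF XY(2)]] eq by (simp_all only:)
      then have "(q div \<Prod>X) * \<Prod>X = (q div \<Prod>X) * \<Prod>Y" "q div \<Prod>X \<noteq> 0" using q by (simp, metis mult_0 neq0_conv)
      then show ?thesis by (simp only: mult_cancel1) simp
    qed
      have sub: "X' \<subseteq> Y'" if X': "X' \<in> Pow ?P" and Y': "Y' \<in> Pow ?P" and eq': "\<Prod>X' = \<Prod>Y'" for X' Y'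
      proof
        fix p assume p: "p \<in> X'"
        then have "p dvd \<Prod>Y'" using eq' P(1)[OF X'] by (metis dvd_prodI)
        then obtain r where "r \<in> Y'" "p dvd r" using prime_dvd_prod_iff[of Y' p "\<lambda>x. x"] P(1)[OF Y'] P(2)[OF X' p] by auto
        then show "p \<in> Y'" using P(2)[OF X' p] P(2)[OF Y'] primes_dvd_imp_eq by blast
      qed
      show "X = Y" using sub XY pr by (metis subset_antisym)
    qed
  qed simp
  also have "\<dots> \<le> (\<Sum>h\<in>{h\<in>{1..q}. h dvd q \<and> int h dvd k}. real h)"
  proof (rule sum_mono2)
    show "(\<lambda>X. q div \<Prod>X) ` {X\<in>Pow ?P. int (q div \<Prod>X) dvd k} \<subseteq> {h\<in>{1..q}. h dvd q \<and> int h dvd k}"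
    proof (rule image_subsetI)
      fix X assume "X \<in> {X\<in>Pow ?P. int (q div \<Prod>X) dvd k}"
      then have X: "X \<subseteq> ?P" "int (q div \<Prod>X) dvd k" by auto
      then have "\<Prod>X dvd q" "\<Prod>X > 0" using P[of X] by auto
      then have "q div \<Prod>X dvd q" "q div \<Prod>X > 0" using q by (auto simp: div_dvd_iff_mult div_greater_zero_iff dvd_imp_le)
      then show "q div \<Prod>X \<in> {h \<in> {1..q}. h dvd q \<and> int h dvd k}" using X q by (auto intro: dvd_imp_le)
    qed
  qed auto
  finally show ?thesis .
qed

text \<open>The grid \<open>\<int>/M\<close> with \<open>M = grid_size N\<close> contains every \<open>a/q\<close> with \<open>q \<le> N\<close>, and
  \<open>arc_width N L q / M\<close> equals \<open>L / (q N\<^sup>2)\<close> exactly, so the divisions below are exact.\<close>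

definition grid_size :: "nat \<Rightarrow> int" where
  "grid_size N = 2 * (int N)\<^sup>2 * fact N"

definition arc_width :: "nat \<Rightarrow> nat \<Rightarrow> nat \<Rightarrow> int" where
  "arc_width N L q = 2 * int L * (fact N div int q)"

definition arc_index :: "nat \<Rightarrow> nat \<Rightarrow> (nat \<times> nat \<times> int) set" where
  "arc_index N L = (SIGMA q:{1..L}. {a\<in>{..<q}. coprime a q} \<times> {- arc_width N L q..<arc_width N L q + 1})"

definition arc_point :: "nat \<Rightarrow> nat \<times> nat \<times> int \<Rightarrow> int" where
  "arc_point N = (\<lambda>(q, a, r). (int a * (grid_size N div int q) + r) mod grid_size N)"

definition major_arcs :: "nat \<Rightarrow> nat \<Rightarrow> int set" where
  "major_arcs N L = arc_point N ` arc_index N L"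

lemma finite_arc_index [simp]: "finite (arc_index N L)"
  unfolding arc_index_def by (intro finite_SigmaI) auto

lemma finite_major_arcs [simp]: "finite (major_arcs N L)"
  by (simp add: major_arcs_def)

lemma grid_size_pos: "N \<ge> 1 \<Longrightarrow> grid_size N > 0"
  by (simp add: grid_size_def)

lemma grid_size_div:
  assumes "1 \<le> q" "q \<le> N"
  shows "int q * (grid_size N div int q) = grid_size N" "real_of_int (grid_size N div int q) = grid_size N / q"
proof -
  have "int q dvd fact N"
    using assms dvd_fact[of q N] by (metis int_dvd_int_iff of_nat_fact)
  then have d: "int q dvd grid_size N" by (simp add: grid_size_def)
  then show "int q * (grid_size N div int q) = grid_size N" by simp
  show "real_of_int (grid_size N div int q) = grid_size N / q" using d by (simp add: real_of_int_div)
qed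

lemma arc_width_eq:
  assumes "1 \<le> q" "q \<le> N"
  shows "real_of_int (arc_width N L q) = grid_size N * (real L / (real q * (real N)\<^sup>2))"
    and "arc_width N L q \<ge> int L"
proof -
  have d: "int q dvd fact N"
    using assms dvd_fact[of q N] by (metis int_dvd_int_iff of_nat_fact)
  then have "real_of_int (fact N div int q) = fact N / q" by (simp add: real_of_int_div)
  then show "real_of_int (arc_width N L q) = grid_size N * (real L / (real q * (real N)\<^sup>2))"
    using assms by (simp add: arc_width_def grid_size_def field_simps)
  have "int q \<le> fact N" using d by (intro zdvd_imp_le) auto
  then have "fact N div int q \<ge> 1" using assms by (simp add: pos_imp_zdiv_pos_iff int_one_le_iff_zero_less)
  then have "int L * 1 \<le> int L * (2 * (fact N div int q))" by (intro mult_left_mono) auto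
  then show "arc_width N L q \<ge> int L" by (simp add: arc_width_def)
qed

lemma e_arc_point:
  assumes "1 \<le> q" "q \<le> N"
  shows "e (of_int (arc_point N (q, a, r)) * of_int k / grid_size N)
    = e (real a * of_int k / q) * e (of_int r * (of_int k / grid_size N))"
proof -
  let ?M = "grid_size N"
  define x where "x = int a * (?M div int q) + r"
  have M: "?M > 0" using assms grid_size_pos[of N] by simp
  have "of_int (x mod ?M) * of_int k / ?M = of_int x * of_int k / real_of_int ?M + of_int (- (x div ?M) * k)"
  proof -
    have "x mod ?M = x - ?M * (x div ?M)" by (simp add: minus_mult_div_eq_mod)
    then have "real_of_int (x mod ?M) = of_int x - of_int ?M * of_int (x div ?M)" by simp
    then have "of_int (x mod ?M) * of_int k / ?M = (of_int x - of_int ?M * of_int (x div ?M)) * of_int k / real_of_int ?M"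
      by (simp only:)
    also have "\<dots> = of_int x * of_int k / real_of_int ?M + of_int (- (x div ?M) * k)"
    proof -
      have "(x - m * y) * k / m = x * k / m + - y * k" if "m \<noteq> 0" for x m y k :: real
        using that by (simp add: field_simps)
      moreover have "real_of_int ?M \<noteq> 0" using M by simp
      ultimately show ?thesis by (simp only: of_int_mult of_int_minus)
    qed
    finally show ?thesis .
  qed
  then have "e (of_int (x mod ?M) * of_int k / ?M) = e (of_int x * of_int k / real_of_int ?M)"
    by (simp only: e_add e_of_int mult_1_right)
  also have "of_int x * of_int k / real_of_int ?M = real a * of_int k / q + of_int r * (of_int k / ?M)"
  proof -
    have "real_of_int x = real a * (?M / q) + of_int r" by (simp add: x_def grid_size_div(2)[OF assms])
    moreover have "(real a * (m / real q) + r) * k / m = real a * k / q + r * (k / m)" if "m \<noteq> 0" for m r k :: real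
      using assms that by (simp add: field_simps)
    moreover have "real_of_int ?M \<noteq> 0" using M by simp
    ultimately show ?thesis by (simp only:)
  qed
  finally show ?thesis by (simp add: arc_point_def x_def e_add)
qed

text \<open>Distinct fractions a/q and a'/q' differ modulo 1 by at least 1/(q q'), whereas the two
  radii add up to L (q + q') / (q q' N^2), which is smaller as soon as 3 L <= N. After
  multiplication by q q' this says that an integer of modulus below 1 is zero.\<close>

lemma inj_on_arc_point:
  assumes L: "1 \<le> L" "3 * L \<le> N"
  shows "inj_on (arc_point N) (arc_index N L)"
proof (rule inj_onI)
  fix x y assume xy: "x \<in> arc_index N L" "y \<in> arc_index N L" "arc_point N x = arc_point N y"
  obtain q a r q' a' r' where x: "x = (q, a, r)" and y: "y = (q', a', r')" by (metis prod_cases3)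
  have 1: "(q, a, r) \<in> arc_index N L" and 2: "(q', a', r') \<in> arc_index N L"
    and eq: "arc_point N (q, a, r) = arc_point N (q', a', r')" using xy x y by auto
  let ?M = "grid_size N"
  have M: "?M > 0" using L grid_size_pos[of N] by simp
  have q: "1 \<le> q" "q \<le> L" "a < q" "coprime a q" "\<bar>r\<bar> \<le> arc_width N L q"
    and q': "1 \<le> q'" "q' \<le> L" "a' < q'" "coprime a' q'" "\<bar>r'\<bar> \<le> arc_width N L q'"
    using 1 2 by (auto simp: arc_index_def)
  have qN: "q \<le> N" "q' \<le> N" using q q' L by auto
  have "?M dvd (int a * (?M div int q) + r) - (int a' * (?M div int q') + r')"
    using eq by (simp add: arc_point_def mod_eq_dvd_iff)
  then obtain l where l: "int a * (?M div int q) + r - (int a' * (?M div int q') + r') = ?M * l" by blast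
  then have "real_of_int (int a * (?M div int q) + r - (int a' * (?M div int q') + r')) = real_of_int (?M * l)" by simp
  then have "real a * (?M / q) + r - (real a' * (?M / q') + r') = ?M * of_int l"
    using grid_size_div[OF q(1) qN(1)] grid_size_div[OF q'(1) qN(2)] by simp
  then have "?M * (real a / q - real a' / q' - of_int l) = of_int r' - of_int r"
    using q q' by (simp add: field_simps)
  moreover have "\<bar>of_int r' - of_int r\<bar> \<le> ?M * (real L / (real q * (real N)\<^sup>2) + real L / (real q' * (real N)\<^sup>2))"
  proof -
    have "\<bar>of_int r' - of_int r\<bar> \<le> real_of_int (arc_width N L q) + real_of_int (arc_width N L q')" using q q' by linarith
    then show ?thesis unfolding arc_width_eq(1)[OF q(1) qN(1)] arc_width_eq(1)[OF q'(1) qN(2)] by (simp add: distrib_left)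
  qed
  ultimately have "?M * \<bar>real a / q - real a' / q' - of_int l\<bar> \<le> ?M * (real L / (real q * (real N)\<^sup>2) + real L / (real q' * (real N)\<^sup>2))"
    using M by (metis abs_mult abs_of_pos of_int_0_less_iff)
  then have "\<bar>real a / q - real a' / q' - of_int l\<bar> \<le> real L / (real q * (real N)\<^sup>2) + real L / (real q' * (real N)\<^sup>2)"
    using M by simp
  then have "real q * real q' * \<bar>real a / q - real a' / q' - of_int l\<bar> \<le> real q * real q' * (real L / (real q * (real N)\<^sup>2) + real L / (real q' * (real N)\<^sup>2))"
    by (intro mult_left_mono) auto
  moreover have "real q * real q' * \<bar>real a / q - real a' / q' - of_int l\<bar> = \<bar>real_of_int (int a * int q' - int a' * int q - l * int q * int q')\<bar>"
  proof -
    have "real q * real q' * \<bar>real a / q - real a' / q' - of_int l\<bar> = \<bar>real q * real q' * (real a / q - real a' / q' - of_int l)\<bar>"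
      by (simp add: abs_mult)
    also have "real q * real q' * (real a / q - real a' / q' - of_int l) = real_of_int (int a * int q' - int a' * int q - l * int q * int q')"
      using q q' by (simp add: field_simps)
    finally show ?thesis .
  qed
  moreover have "real q * real q' * (real L / (real q * (real N)\<^sup>2) + real L / (real q' * (real N)\<^sup>2)) = real L * (real q + real q') / (real N)\<^sup>2"
    using q q' L by (simp add: field_simps)
  moreover have "real L * (real q + real q') / (real N)\<^sup>2 < 1"
  proof -
    have "real L * (real q + real q') \<le> real L * (2 * real L)" using q q' by (intro mult_left_mono) auto
    also have "\<dots> < (3 * real L) * (3 * real L)" using L by simp
    also have "\<dots> \<le> (real N)\<^sup>2" unfolding power2_eq_square using L by (intro mult_mono) auto
    finally show ?thesis using L by simp
  qed
  ultimately have "\<bar>real_of_int (int a * int q' - int a' * int q - l * int q * int q')\<bar> < 1" by linarith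
  then have z: "int a * int q' - int a' * int q - l * int q * int q' = 0" by linarith
  have "int q dvd int a * int q'"
  proof -
    have "int a * int q' = int q * (int a' + l * int q')" using z by (simp add: algebra_simps)
    then show ?thesis by simp
  qed
  then have "q dvd q'"
    using q(4) by (simp only: of_nat_mult[symmetric] int_dvd_int_iff) (simp add: coprime_commute coprime_dvd_mult_right_iff)
  moreover have "int q' dvd int a' * int q"
  proof -
    have "int a' * int q = int q' * (int a - l * int q)" using z by (simp add: algebra_simps)
    then show ?thesis by simp
  qed
  then have "q' dvd q"
    using q'(4) by (simp only: of_nat_mult[symmetric] int_dvd_int_iff) (simp add: coprime_commute coprime_dvd_mult_right_iff)
  ultimately have qq: "q = q'" by (simp add: dvd_antisym)
  have "int q * (int a - int a' - l * int q) = 0" using z qq by (simp add: algebra_simps)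
  then have ll: "int a - int a' = l * int q" using q by simp
  have "\<bar>int a - int a'\<bar> < int q" using q q' qq by linarith
  have "l = 0"
  proof (rule ccontr)
    assume "l \<noteq> 0"
    then have "1 * int q \<le> \<bar>l\<bar> * int q" by (intro mult_right_mono) auto
    then show False using \<open>\<bar>int a - int a'\<bar> < int q\<close> unfolding ll abs_mult by simp
  qed
  then have aa: "a = a'" using ll by simp
  have "r = r'" using l \<open>l = 0\<close> qq aa by simp
  then show "x = y" using qq aa x y by simp
qed

text \<open>The arcs are closed, complementing the strict inequality in the Weyl bound. The
  numerator may be any representative modulo q, as Dirichlet's theorem supplies it; it is reduced to
  b here, and the multiple of q removed is a multiple of the grid size in j.\<close>

lemma major_arcsI:
  assumes L: "L \<le> N" and q: "1 \<le> q" "q \<le> L" and cop: "coprime a (int q)"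
    and j: "\<bar>of_int j / grid_size N - of_int a / q\<bar> \<le> real L / (real q * (real N)\<^sup>2)"
  shows "j mod grid_size N \<in> major_arcs N L"
proof -
  let ?M = "grid_size N"
  have qN: "q \<le> N" using L q by simp
  have M: "?M > 0" using q qN grid_size_pos[of N] by simp
  define b where "b = nat (a mod int q)"
  have b: "int b = a mod int q" "b < q" using q by (auto simp: b_def nat_less_iff)
  have "coprime (int b) (int q)" unfolding b(1) using cop q by (simp add: coprime_mod_left_iff)
  then have cb: "coprime b q" by simp
  define r where "r = j - a * (?M div int q)"
  have "real_of_int r = ?M * (of_int j / ?M - of_int a / q)"
    using grid_size_div[OF q(1) qN] M by (simp add: r_def field_simps)
  then have "\<bar>real_of_int r\<bar> \<le> ?M * (real L / (real q * (real N)\<^sup>2))"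
  proof -
    have "\<bar>real_of_int r\<bar> = ?M * \<bar>of_int j / ?M - of_int a / q\<bar>"
      using \<open>real_of_int r = _\<close> M by (simp add: abs_mult)
    also have "\<dots> \<le> ?M * (real L / (real q * (real N)\<^sup>2))"
      by (rule mult_left_mono[OF j]) (use M in simp)
    finally show ?thesis .
  qed
  then have "\<bar>r\<bar> \<le> arc_width N L q" unfolding arc_width_eq(1)[OF q(1) qN, symmetric] by linarith
  then have "(q, b, r) \<in> arc_index N L" using q b cb by (auto simp: arc_index_def)
  moreover have "arc_point N (q, b, r) = j mod ?M"
  proof -
    have bq: "int b = a - int q * (a div int q)" using b by (simp add: minus_mult_div_eq_mod)
    have "int b * (?M div int q) + r = j - (int q * (?M div int q)) * (a div int q)"
    proof -
      have "(a - q * c) * w + (j - a * w) = j - (q * w) * c" for q c w :: int by (simp add: algebra_simps)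
      then show ?thesis unfolding r_def bq .
    qed
    then show ?thesis using grid_size_div(1)[OF q(1) qN] by (simp add: arc_point_def mod_eq_dvd_iff)
  qed
  ultimately show ?thesis unfolding major_arcs_def by (metis image_eqI)
qed

lemma major_arcs_range: "N \<ge> 1 \<Longrightarrow> i \<in> major_arcs N L \<Longrightarrow> 0 \<le> i \<and> i < grid_size N"
  using grid_size_pos[of N] by (auto simp: major_arcs_def arc_point_def)

text \<open>Denominator q carries at most q arcs of relative length O(L / (q N^2)), so all q <= L
  contribute equally. The constant 3 absorbs the closed endpoint: 2 W + 1 <= 3 W for the width
  W.\<close>

lemma card_major_arcs_le:
  assumes L: "1 \<le> L" "L \<le> N"
  shows "real (card (major_arcs N L)) \<le> 3 * (real L)\<^sup>2 / (real N)\<^sup>2 * grid_size N"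
proof -
  have "card (major_arcs N L) \<le> card (arc_index N L)"
    unfolding major_arcs_def by (rule card_image_le) simp
  also have "\<dots> = (\<Sum>q\<in>{1..L}. card {a\<in>{..<q}. coprime a q} * nat (2 * arc_width N L q + 1))"
    unfolding arc_index_def by (subst card_SigmaI) (auto simp: card_cartesian_product)
  finally have "real (card (major_arcs N L)) \<le> (\<Sum>q\<in>{1..L}. real (card {a\<in>{..<q}. coprime a q}) * real (nat (2 * arc_width N L q + 1)))"
    by (simp only: of_nat_le_iff[where 'a = real, symmetric] of_nat_sum of_nat_mult)
  also have "\<dots> \<le> (\<Sum>q\<in>{1..L}. 3 * real L / (real N)\<^sup>2 * grid_size N)"
  proof (rule sum_mono)
    fix q assume q: "q \<in> {1..L}"
    then have qN: "1 \<le> q" "q \<le> N" using L by auto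
    have "card {a\<in>{..<q}. coprime a q} \<le> card {..<q}" by (rule card_mono) auto
    moreover have "real (nat (2 * arc_width N L q + 1)) \<le> 3 * real_of_int (arc_width N L q)"
      using arc_width_eq(2)[OF qN, of L] L by simp
    ultimately have "real (card {a\<in>{..<q}. coprime a q}) * real (nat (2 * arc_width N L q + 1)) \<le> real q * (3 * real_of_int (arc_width N L q))"
      by (intro mult_mono) auto
    also have "\<dots> = 3 * real L / (real N)\<^sup>2 * grid_size N"
      using arc_width_eq(1)[OF qN] qN by simp
    finally show "real (card {a\<in>{..<q}. coprime a q}) * real (nat (2 * arc_width N L q + 1)) \<le> 3 * real L / (real N)\<^sup>2 * grid_size N" .
  qed
  also have "\<dots> = 3 * (real L)\<^sup>2 / (real N)\<^sup>2 * grid_size N" by (simp add: power2_eq_square)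
  finally show ?thesis .
qed

section \<open>Fourier coefficients of the major-arc indicator\<close>

definition major_coeff :: "nat \<Rightarrow> nat \<Rightarrow> int \<Rightarrow> complex" where
  "major_coeff N L k = (\<Sum>i\<in>major_arcs N L. e (of_int i * of_int (- k) / grid_size N)) / grid_size N"

abbreviation freqs :: "nat \<Rightarrow> int set" where
  "freqs N \<equiv> {- (int N)\<^sup>2 * fact N..<(int N)\<^sup>2 * fact N}"

lemma freqs_eq: "freqs N = {- (int N)\<^sup>2 * fact N..<- (int N)\<^sup>2 * fact N + grid_size N}"
  by (simp add: grid_size_def mult_ac)

lemma major_coeff_inversion:
  assumes N: "N \<ge> 1"
  shows "(\<Sum>k\<in>freqs N. major_coeff N L k * e (of_int k * (of_int j / grid_size N)))
    = of_bool (j mod grid_size N \<in> major_arcs N L)"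
proof -
  let ?M = "grid_size N"
  have M: "?M > 0" using grid_size_pos[OF N] .
  have dvd: "?M dvd j - i \<longleftrightarrow> i = j mod ?M" if "i \<in> major_arcs N L" for i
  proof -
    have "i mod ?M = i" using major_arcs_range[OF N that] by simp
    then show ?thesis by (metis mod_eq_dvd_iff)
  qed
  have "(\<Sum>k\<in>freqs N. major_coeff N L k * e (of_int k * (of_int j / ?M)))
    = (\<Sum>k\<in>freqs N. \<Sum>i\<in>major_arcs N L. e (of_int k * (of_int (j - i) / ?M)) / ?M)"
    unfolding major_coeff_def sum_divide_distrib sum_distrib_right
    by (intro sum.cong refl) (simp add: e_add[symmetric] algebra_simps diff_divide_distrib)
  also have "\<dots> = (\<Sum>i\<in>major_arcs N L. (\<Sum>k\<in>freqs N. e (of_int k * (of_int (j - i) / ?M))) / ?M)"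
    by (subst sum.swap) (simp add: sum_divide_distrib)
  also have "\<dots> = (\<Sum>i\<in>major_arcs N L. of_bool (i = j mod ?M))"
  proof (rule sum.cong[OF refl])
    fix i assume i: "i \<in> major_arcs N L"
    show "(\<Sum>k\<in>freqs N. e (of_int k * (of_int (j - i) / ?M))) / ?M = of_bool (i = j mod ?M)"
      unfolding freqs_eq sum_e_complete[OF M] dvd[OF i] using M by simp
  qed
  also have "\<dots> = of_bool (j mod ?M \<in> major_arcs N L)"
    by (simp add: of_bool_def sum.delta)
  finally show ?thesis .
qed

text \<open>The zero coefficient is the density of the major arcs, at most 3 L^2 / N^2 <=
  1/3.\<close>

lemma major_coeff_0_le:
  assumes L: "1 \<le> L" "3 * L \<le> N"
  shows "cmod (major_coeff N L 0) \<le> 1/2"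
proof -
  have M: "grid_size N > 0" using grid_size_pos[of N] L by simp
  have "cmod (major_coeff N L 0) = real (card (major_arcs N L)) / grid_size N"
    using M by (simp add: major_coeff_def norm_divide)
  also have "\<dots> \<le> 3 * (real L)\<^sup>2 / (real N)\<^sup>2"
    using card_major_arcs_le[of L N] L M by (simp add: pos_divide_le_eq)
  also have "\<dots> \<le> 1/2"
  proof -
    have "(3 * real L)\<^sup>2 \<le> (real N)\<^sup>2" using L by (intro power_mono) auto
    then have "3 * (real L)\<^sup>2 \<le> (real N)\<^sup>2 / 2"
    proof -
      have "9 * (real L)\<^sup>2 \<le> (real N)\<^sup>2" using \<open>(3 * real L)\<^sup>2 \<le> _\<close> by (simp add: power_mult_distrib)
      then show ?thesis using zero_le_power2[of "real L"] by linarith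
    qed
    then show ?thesis using L by (simp add: field_simps)
  qed
  finally show ?thesis .
qed

text \<open>As the arcs are disjoint, the coefficient is a sum over q of a Ramanujan sum times a
  Dirichlet kernel. The former contributes h for each common divisor h of q and k, the latter a
  factor 1/q; summing h/q over the multiples q of h gives at most \<open>harm L\<close> for each h
  <= L that divides k.\<close>

lemma norm_major_coeff_le:
  assumes L: "1 \<le> L" "3 * L \<le> N" and k: "k \<in> freqs N" "k \<noteq> 0"
  shows "cmod (major_coeff N L k) \<le> 6 * real L * harm L * small_divisors L (nat \<bar>k\<bar>) / ((real N)\<^sup>2 + \<bar>k\<bar>)"
proof -
  let ?M = "grid_size N" and ?W = "arc_width N L"
  let ?ram = "\<lambda>q::nat. \<Sum>a\<in>{a\<in>{..<q}. coprime a q}. e (real a * of_int (-k) / q)"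
  let ?dir = "\<lambda>q. \<Sum>r\<in>{- ?W q..<?W q + 1}. e (of_int r * (of_int (-k) / ?M))"
  have M: "?M > 0" using grid_size_pos[of N] L by simp
  have absk: "2 * \<bar>k\<bar> \<le> ?M" using k by (auto simp: grid_size_def)
  have divisor_sum: "(\<Sum>q\<in>{1..L}. \<Sum>h\<in>{1..L}. if int h dvd k then (if h dvd q then real h / real q else 0) else 0)
    \<le> harm L * small_divisors L (nat \<bar>k\<bar>)"
  proof -
    have "(\<Sum>q\<in>{1..L}. \<Sum>h\<in>{1..L}. if int h dvd k then (if h dvd q then real h / real q else 0) else 0)
      = (\<Sum>h\<in>{1..L}. if int h dvd k then (\<Sum>q\<in>{1..L}. if h dvd q then real h / real q else 0) else 0)"
      by (subst sum.swap) (intro sum.cong, auto)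
    also have "\<dots> = (\<Sum>h\<in>{h\<in>{1..L}. int h dvd k}. (\<Sum>q\<in>{1..L}. if h dvd q then real h / real q else 0))"
      by (rule sum.inter_filter[symmetric]) simp
    also have "\<dots> = (\<Sum>h\<in>{h\<in>{1..L}. int h dvd k}. (\<Sum>q\<in>{q\<in>{1..L}. h dvd q}. real h / real q))"
      by (intro sum.cong refl sum.inter_filter[symmetric]) simp
    also have "\<dots> \<le> (\<Sum>h\<in>{h\<in>{1..L}. int h dvd k}. harm L)"
      by (intro sum_mono sum_multiples_inverse_le) auto
    also have "\<dots> = harm L * small_divisors L (nat \<bar>k\<bar>)"
      by (simp add: small_divisors_def dvd_nat_abs_iff mult.commute)
    finally show ?thesis .
  qed
  have "(\<Sum>i\<in>major_arcs N L. e (of_int i * of_int (- k) / ?M)) = (\<Sum>x\<in>arc_index N L. e (of_int (arc_point N x) * of_int (- k) / ?M))"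
    unfolding major_arcs_def by (subst sum.reindex[OF inj_on_arc_point[OF L]]) simp
  also have "\<dots> = (\<Sum>(q, x)\<in>arc_index N L. e (of_int (arc_point N (q, x)) * of_int (- k) / ?M))"
    by (simp only: case_prod_eta split_def prod.collapse)
  also have "\<dots> = (\<Sum>q\<in>{1..L}. \<Sum>x\<in>{a\<in>{..<q}. coprime a q} \<times> {- ?W q..<?W q + 1}.
      e (of_int (arc_point N (q, x)) * of_int (- k) / ?M))"
    unfolding arc_index_def by (rule sum.Sigma[symmetric]) auto
  also have "\<dots> = (\<Sum>q\<in>{1..L}. \<Sum>(a, r)\<in>{a\<in>{..<q}. coprime a q} \<times> {- ?W q..<?W q + 1}.
      e (real a * of_int (-k) / q) * e (of_int r * (of_int (-k) / ?M)))"
  proof (intro sum.cong refl)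
    fix q and x :: "nat \<times> int" assume "q \<in> {1..L}"
    then have q: "1 \<le> q" "q \<le> N" using L by auto
    obtain a r where x: "x = (a, r)" by (cases x)
    show "e (of_int (arc_point N (q, x)) * of_int (- k) / ?M)
      = (case x of (a, r) \<Rightarrow> e (real a * of_int (-k) / q) * e (of_int r * (of_int (-k) / ?M)))"
      unfolding x prod.case by (rule e_arc_point[OF q])
  qed
  also have "\<dots> = (\<Sum>q\<in>{1..L}. ?ram q * ?dir q)"
    by (simp only: sum.cartesian_product[symmetric] sum_product)
  finally have "cmod (major_coeff N L k) = cmod (\<Sum>q\<in>{1..L}. ?ram q * ?dir q / ?M)"
    by (simp only: major_coeff_def sum_divide_distrib)
  also have "\<dots> \<le> (\<Sum>q\<in>{1..L}. (\<Sum>h\<in>{h\<in>{1..q}. h dvd q \<and> int h dvd k}. real h) * (6 * real L / (real q * ((real N)\<^sup>2 + \<bar>k\<bar>))))"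
  proof (rule sum_norm_le)
    fix q assume q: "q \<in> {1..L}"
    then have qN: "1 \<le> q" "q \<le> N" "q \<le> L" using L by auto
    have dir1: "cmod (?dir q) \<le> 3 * real_of_int (?W q)"
    proof -
      have "cmod (?dir q) \<le> (\<Sum>r\<in>{- ?W q..<?W q + 1}. 1)" by (rule sum_norm_le) simp
      also have "\<dots> \<le> 3 * real_of_int (?W q)" using arc_width_eq(2)[OF qN(1,2), of L] L by simp
      finally show ?thesis .
    qed
    have dist: "int_dist (of_int (-k) / ?M) = \<bar>k\<bar> / ?M"
    proof -
      have "2 * \<bar>real_of_int k\<bar> \<le> ?M" using absk by linarith
      then show ?thesis using M by (subst int_dist_eq_abs) (auto simp: field_simps)
    qed
    have dir2: "cmod (?dir q) \<le> ?M / (2 * \<bar>real_of_int k\<bar>)"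
      using norm_sum_e_le[of "of_int (-k) / ?M" "- ?W q" "?W q + 1"] M k unfolding dist by simp
    \<comment> \<open>Up to |k| = N^2 the arc length is used, beyond it the geometric sum; in the
      second range the factor L / q >= 1 is given away.\<close>
    have "cmod (?dir q) / ?M \<le> 6 * real L / (real q * ((real N)\<^sup>2 + \<bar>k\<bar>))"
    proof (cases "\<bar>k\<bar> \<le> (real N)\<^sup>2")
      case True
      have "cmod (?dir q) / ?M \<le> 3 * real_of_int (?W q) / ?M" using dir1 M by (intro divide_right_mono) auto
      also have "\<dots> = 6 * real L / (real q * (2 * (real N)\<^sup>2))" using arc_width_eq(1)[OF qN(1,2)] M by simp
      also have "\<dots> \<le> 6 * real L / (real q * ((real N)\<^sup>2 + \<bar>k\<bar>))"
        using True qN L by (intro divide_left_mono mult_left_mono mult_pos_pos add_pos_nonneg) auto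
      finally show ?thesis .
    next
      case False
      have "cmod (?dir q) / ?M \<le> ?M / (2 * \<bar>real_of_int k\<bar>) / ?M" using dir2 M by (intro divide_right_mono) auto
      also have "\<dots> = 1 / (2 * \<bar>real_of_int k\<bar>)" using M by simp
      also have "\<dots> \<le> 1 / ((real N)\<^sup>2 + \<bar>k\<bar>)" using False qN by (intro divide_left_mono mult_pos_pos add_pos_nonneg) auto
      also have "\<dots> \<le> (6 * real L / real q) * (1 / ((real N)\<^sup>2 + \<bar>k\<bar>))"
      proof -
        have "1 \<le> 6 * real L / real q" using qN by (simp add: field_simps)
        from mult_right_mono[OF this, of "1 / ((real N)\<^sup>2 + \<bar>k\<bar>)"] show ?thesis by simp
      qed
      finally show ?thesis by simp
    qed
    then have "cmod (?ram q) * (cmod (?dir q) / ?M) \<le> (\<Sum>h\<in>{h\<in>{1..q}. h dvd q \<and> int h dvd (-k)}. real h) * (6 * real L / (real q * ((real N)\<^sup>2 + \<bar>k\<bar>)))"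
      using qN M by (intro mult_mono norm_ramanujan_sum_le) (auto intro: sum_nonneg)
    then show "cmod (?ram q * ?dir q / ?M) \<le> (\<Sum>h\<in>{h\<in>{1..q}. h dvd q \<and> int h dvd k}. real h) * (6 * real L / (real q * ((real N)\<^sup>2 + \<bar>k\<bar>)))"
      using M by (simp add: norm_divide norm_mult)
  qed
  also have "\<dots> = 6 * real L / ((real N)\<^sup>2 + \<bar>k\<bar>) * (\<Sum>q\<in>{1..L}. \<Sum>h\<in>{1..L}. if int h dvd k then (if h dvd q then real h / real q else 0) else 0)"
  proof (subst sum_distrib_left, rule sum.cong[OF refl])
    fix q assume q: "q \<in> {1..L}"
    have "(\<Sum>h\<in>{1..L}. if int h dvd k then (if h dvd q then real h / real q else 0) else 0)
      = (\<Sum>h\<in>{1..L}. if h dvd q \<and> int h dvd k then real h / real q else 0)" by (intro sum.cong) auto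
    also have "\<dots> = (\<Sum>h\<in>{h\<in>{1..L}. h dvd q \<and> int h dvd k}. real h / real q)"
      by (rule sum.inter_filter[symmetric]) simp
    also have "{h\<in>{1..L}. h dvd q \<and> int h dvd k} = {h\<in>{1..q}. h dvd q \<and> int h dvd k}"
      using q by (auto dest: dvd_imp_le)
    finally show "(\<Sum>h\<in>{h\<in>{1..q}. h dvd q \<and> int h dvd k}. real h) * (6 * real L / (real q * ((real N)\<^sup>2 + \<bar>k\<bar>)))
      = 6 * real L / ((real N)\<^sup>2 + \<bar>k\<bar>) * (\<Sum>h\<in>{1..L}. if int h dvd k then (if h dvd q then real h / real q else 0) else 0)"
      by (simp only: sum_divide_distrib[symmetric]) (simp add: mult_ac)
  qed
  also have "\<dots> \<le> 6 * real L / ((real N)\<^sup>2 + \<bar>k\<bar>) * (harm L * small_divisors L (nat \<bar>k\<bar>))"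
    by (rule mult_left_mono[OF divisor_sum]) simp
  finally show ?thesis by (simp add: mult_ac)
qed

lemma sum_over_nonzero_freqs_le:
  fixes f :: "nat \<Rightarrow> real"
  assumes "\<And>m. 0 \<le> f m"
  shows "(\<Sum>k\<in>freqs N - {0}. f (nat \<bar>k\<bar>)) \<le> 2 * (\<Sum>m\<in>{1..N\<^sup>2 * fact N}. f m)"
proof -
  let ?Y = "N\<^sup>2 * fact N"
  have Y: "int ?Y = (int N)\<^sup>2 * fact N" by (simp add: of_nat_fact)
  have "freqs N - {0} \<subseteq> int ` {1..?Y} \<union> (\<lambda>m. - int m) ` {1..?Y}"
  proof
    fix k assume k: "k \<in> freqs N - {0}"
    then have "\<bar>k\<bar> \<le> int ?Y" unfolding Y by auto
    then have m: "nat \<bar>k\<bar> \<in> {1..?Y}" using k by (auto simp: nat_le_iff simp del: of_nat_mult of_nat_power)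
    have "k = int (nat \<bar>k\<bar>) \<or> k = - int (nat \<bar>k\<bar>)" by auto
    then show "k \<in> int ` {1..?Y} \<union> (\<lambda>m. - int m) ` {1..?Y}" using m by blast
  qed
  then have "(\<Sum>k\<in>freqs N - {0}. f (nat \<bar>k\<bar>)) \<le> (\<Sum>k\<in>int ` {1..?Y} \<union> (\<lambda>m. - int m) ` {1..?Y}. f (nat \<bar>k\<bar>))"
    by (intro sum_mono2) (auto simp: assms)
  also have "\<dots> \<le> (\<Sum>k\<in>int ` {1..?Y}. f (nat \<bar>k\<bar>)) + (\<Sum>k\<in>(\<lambda>m. - int m) ` {1..?Y}. f (nat \<bar>k\<bar>))"
    by (subst sum.union_inter[symmetric]) (auto intro!: sum_nonneg simp: assms)
  also have "\<dots> = 2 * (\<Sum>m\<in>{1..?Y}. f m)"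
    by (subst (1 2) sum.reindex) (auto simp: inj_on_def)
  finally show ?thesis .
qed

text \<open>Two factors of the denominator are kept for summability and lead to the moment of
  \<open>small_divisors\<close>; the other R - 2 are bounded below by N^2 each. Hence the condition
  R >= 2.\<close>

lemma major_coeff_moment:
  fixes D :: real
  assumes L: "1 \<le> L" "3 * L \<le> N" and R: "R \<ge> 2"
    and D: "\<And>m. 1 \<le> m \<Longrightarrow> m \<le> L ^ R \<Longrightarrow> real (card {g. g dvd m}) \<le> D"
  shows "(\<Sum>k\<in>freqs N - {0}. cmod (major_coeff N L k) ^ R) \<le> 2 * (6 * real L * (harm L)\<^sup>2 * D) ^ R / ((real N)\<^sup>2) ^ (R - 1)"
proof -
  define T where "T = (real N)\<^sup>2"
  have T: "T > 0" using L by (simp add: T_def)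
  have H: "0 \<le> (harm L :: real)" by (rule harm_nonneg)
  let ?f = "\<lambda>m. (6 * real L * harm L) ^ R / T ^ (R - 2) * (real (small_divisors L m) ^ R / (T + real m)\<^sup>2)"
  have "cmod (major_coeff N L k) ^ R \<le> ?f (nat \<bar>k\<bar>)" if k: "k \<in> freqs N - {0}" for k
  proof -
    have "cmod (major_coeff N L k) ^ R \<le> (6 * real L * harm L * small_divisors L (nat \<bar>k\<bar>) / (T + \<bar>k\<bar>)) ^ R"
      unfolding T_def by (intro power_mono norm_major_coeff_le L) (use k in auto)
    also have "\<dots> = (6 * real L * harm L) ^ R * real (small_divisors L (nat \<bar>k\<bar>)) ^ R / (T + \<bar>k\<bar>) ^ R"
      by (simp add: power_mult_distrib power_divide)
    also have "\<dots> \<le> (6 * real L * harm L) ^ R * real (small_divisors L (nat \<bar>k\<bar>)) ^ R / (T ^ (R - 2) * (T + \<bar>k\<bar>)\<^sup>2)"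
    proof (rule divide_left_mono)
      have "(T + \<bar>k\<bar>) ^ R = (T + \<bar>k\<bar>) ^ (R - 2) * (T + \<bar>k\<bar>)\<^sup>2"
        by (metis R le_add_diff_inverse2 power_add)
      moreover have "T ^ (R - 2) \<le> (T + \<bar>k\<bar>) ^ (R - 2)" using T by (intro power_mono) auto
      ultimately show "T ^ (R - 2) * (T + \<bar>k\<bar>)\<^sup>2 \<le> (T + \<bar>k\<bar>) ^ R" by (simp add: mult_right_mono)
      show "0 < (T + \<bar>k\<bar>) ^ R * (T ^ (R - 2) * (T + \<bar>k\<bar>)\<^sup>2)"
        using T by (intro mult_pos_pos zero_less_power add_pos_nonneg) auto
    qed (use H in simp)
    finally show ?thesis by simp
  qed
  then have "(\<Sum>k\<in>freqs N - {0}. cmod (major_coeff N L k) ^ R) \<le> (\<Sum>k\<in>freqs N - {0}. ?f (nat \<bar>k\<bar>))"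
    by (rule sum_mono)
  also have "\<dots> \<le> 2 * (\<Sum>m\<in>{1..N\<^sup>2 * fact N}. ?f m)"
    by (rule sum_over_nonzero_freqs_le) (use T H in simp)
  also have "\<dots> = 2 * ((6 * real L * harm L) ^ R / T ^ (R - 2) * (\<Sum>m\<in>{1..N\<^sup>2 * fact N}. real (small_divisors L m) ^ R / (T + real m)\<^sup>2))"
    by (simp only: sum_distrib_left)
  also have "\<dots> \<le> 2 * ((6 * real L * harm L) ^ R / T ^ (R - 2) * ((D * harm L) ^ R / T))"
    by (intro mult_left_mono small_divisors_moment L T D) (use T H in auto)
  also have "\<dots> = 2 * (6 * real L * (harm L)\<^sup>2 * D) ^ R / T ^ (R - 1)"
  proof -
    have "T ^ (R - 1) = T ^ (R - 2) * T" using R by (metis Suc_1 Suc_diff_Suc diff_Suc_1 less_eq_Suc_le power_Suc2 One_nat_def)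
    moreover have "(6 * real L * (harm L)\<^sup>2 * D) ^ R = (6 * real L * harm L) ^ R * (D * harm L) ^ R"
      unfolding power_mult_distrib[symmetric] by (simp add: power2_eq_square mult_ac)
    ultimately show ?thesis by simp
  qed
  finally show ?thesis unfolding T_def .
qed

section \<open>Duality on the grid\<close>

text \<open>The finite dual of the frequency set \<open>freqs N \<times> weight_box N\<close>: the
  steps, 1 / \<open>grid_size N\<close> in time and 1/(4N) in space, make all character sums
  complete.\<close>

definition torus_grid :: "nat \<Rightarrow> (int \<times> (int^'d)) set" where
  "torus_grid N = {0..<grid_size N} \<times> int_box {0..<4 * int N}"

definition grid_time :: "nat \<Rightarrow> int \<times> (int^'d) \<Rightarrow> real" where
  "grid_time N x = of_int (fst x) / grid_size N"

definition grid_space :: "nat \<Rightarrow> int \<times> (int^'d) \<Rightarrow> real^'d" where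
  "grid_space N x = (1 / (4 * real N)) *\<^sub>R real_vec (snd x)"

text \<open>Frequencies are labelled by their offset k from the quadratic surface: (k, n) stands for
  (R(n) + k, n). The surface itself is k = 0, and multiplying the kernel by a character in time
  shifts k.\<close>

definition grid_char :: "real^'d^'d \<Rightarrow> nat \<Rightarrow> int \<Rightarrow> int^'d \<Rightarrow> int \<times> (int^'d) \<Rightarrow> complex" where
  "grid_char A N k n x = e (grid_time N x * (quad_form A (real_vec n) + of_int k) + grid_space N x \<bullet> real_vec n)"

lemma finite_torus_grid [simp]: "finite (torus_grid N)"
  by (simp add: torus_grid_def)

lemma card_torus_grid:
  assumes "N \<ge> 1"
  shows "real (card (torus_grid N :: (int \<times> (int^'d)) set)) = grid_size N * (4 * real N) ^ CARD('d)"
  using grid_size_pos[OF assms] by (simp add: torus_grid_def card_cartesian_product card_int_box)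

lemma grid_char_mult_cnj:
  "grid_char A N k n x * cnj (grid_char A N k n y)
    = e ((grid_time N x - grid_time N y) * quad_form A (real_vec n) + (grid_space N x - grid_space N y) \<bullet> real_vec n)
      * e (of_int k * (of_int (fst x - fst y) / grid_size N))"
proof -
  have diff: "of_int (fst x - fst y) / grid_size N = grid_time N x - grid_time N y"
    by (simp add: grid_time_def diff_divide_distrib)
  show ?thesis
    unfolding diff grid_char_def cnj_e e_add[symmetric]
    by (intro arg_cong[where f = e]) (simp add: algebra_simps inner_diff_left)
qed

text \<open>The sum over k forces equal times; then the quadratic phases cancel, and the sum over n
  is a product of complete sums modulo 4N. The shear by R(n) thus leaves orthogonality
  intact.\<close>

lemma grid_char_orthogonal:
  fixes x y :: "int \<times> (int^'d)"
  assumes N: "N \<ge> 1" and x: "x \<in> torus_grid N" and y: "y \<in> torus_grid N"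
  shows "(\<Sum>(k, n)\<in>freqs N \<times> weight_box N. grid_char A N k n x * cnj (grid_char A N k n y))
    = (if x = y then of_nat (card (torus_grid N :: (int \<times> (int^'d)) set)) else 0)"
proof -
  let ?M = "grid_size N"
  have M: "?M > 0" using grid_size_pos[OF N] .
  have unif: "i = j" if "m dvd i - j" "0 \<le> i" "i < m" "0 \<le> j" "j < m" for i j m :: int
    using that by (metis mod_eq_dvd_iff mod_pos_pos_trivial)
  have time: "(\<Sum>k\<in>freqs N. e (of_int k * (of_int (fst x - fst y) / ?M))) = (if fst x = fst y then of_int ?M else 0)"
    unfolding freqs_eq sum_e_complete[OF M]
    using x y unif[of ?M "fst x" "fst y"] by (auto simp: torus_grid_def)
  have space: "(\<Sum>n\<in>weight_box N. e ((grid_space N x - grid_space N y) \<bullet> real_vec n))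
    = (if snd x = snd y then of_nat ((4 * N) ^ CARD('d)) else 0)"
  proof -
    let ?z = "\<lambda>i. snd x $ i - snd y $ i"
    have "(grid_space N x - grid_space N y) \<bullet> real_vec n = (\<Sum>i\<in>UNIV. of_int (n $ i) * (of_int (?z i) / of_int (4 * int N)))" for n
      by (simp add: grid_space_def inner_vec_def diff_divide_distrib algebra_simps)
    then have "(\<Sum>n\<in>weight_box N. e ((grid_space N x - grid_space N y) \<bullet> real_vec n))
      = (\<Sum>n\<in>weight_box N. \<Prod>i\<in>UNIV. e (of_int (n $ i) * (of_int (?z i) / of_int (4 * int N))))"
      by (simp only: e_sum)
    also have "\<dots> = (\<Prod>i\<in>UNIV. \<Sum>m\<in>{- 2 * int N..<2 * int N}. e (of_int m * (of_int (?z i) / of_int (4 * int N))))"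
      by (rule sum_int_box_prod) simp
    also have "\<dots> = (\<Prod>i\<in>UNIV. if 4 * int N dvd ?z i then of_int (4 * int N) else 0)"
    proof -
      have interval: "{- 2 * int N..<2 * int N} = {- 2 * int N..<- 2 * int N + 4 * int N}" by simp
      show ?thesis unfolding interval using N by (intro prod.cong refl sum_e_complete) simp
    qed
    also have "\<dots> = (\<Prod>i\<in>UNIV. if snd x $ i = snd y $ i then of_nat (4 * N) else 0)"
    proof (rule prod.cong[OF refl])
      fix i
      have "0 \<le> snd x $ i \<and> snd x $ i < 4 * int N" "0 \<le> snd y $ i \<and> snd y $ i < 4 * int N"
        using x y by (auto simp: torus_grid_def int_box_def)
      then have "4 * int N dvd ?z i \<longleftrightarrow> snd x $ i = snd y $ i" using unif[of "4 * int N" "snd x $ i" "snd y $ i"] by auto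
      then show "(if 4 * int N dvd ?z i then of_int (4 * int N) else 0) = (if snd x $ i = snd y $ i then of_nat (4 * N) else (0::complex))" by simp
    qed
    also have "\<dots> = (if snd x = snd y then of_nat ((4 * N) ^ CARD('d)) else 0)"
    proof (cases "snd x = snd y")
      case False
      then obtain i where "snd x $ i \<noteq> snd y $ i" by (auto simp: vec_eq_iff)
      then show ?thesis using False by (auto simp: prod_zero_iff)
    qed simp
    finally show ?thesis .
  qed
  have "(\<Sum>(k, n)\<in>freqs N \<times> weight_box N. grid_char A N k n x * cnj (grid_char A N k n y))
    = (\<Sum>n\<in>weight_box N. e ((grid_time N x - grid_time N y) * quad_form A (real_vec n) + (grid_space N x - grid_space N y) \<bullet> real_vec n)
        * (\<Sum>k\<in>freqs N. e (of_int k * (of_int (fst x - fst y) / ?M))))"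
    by (simp only: sum.cartesian_product[symmetric] grid_char_mult_cnj sum_distrib_left) (rule sum.swap)
  also have "\<dots> = (if x = y then of_nat (card (torus_grid N :: (int \<times> (int^'d)) set)) else 0)"
  proof (cases "fst x = fst y")
    case False
    then show ?thesis unfolding time by auto
  next
    case True
    then have "grid_time N x = grid_time N y" by (simp add: grid_time_def)
    then have "(\<Sum>n\<in>weight_box N. e ((grid_time N x - grid_time N y) * quad_form A (real_vec n) + (grid_space N x - grid_space N y) \<bullet> real_vec n)
        * (\<Sum>k\<in>freqs N. e (of_int k * (of_int (fst x - fst y) / ?M))))
      = (if snd x = snd y then of_nat ((4 * N) ^ CARD('d)) else 0) * of_int ?M"
      unfolding time sum_distrib_right[symmetric] using True space by simp
    also have "\<dots> = (if x = y then of_nat (card (torus_grid N :: (int \<times> (int^'d)) set)) else 0)"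
    proof -
      have "(of_nat ((4 * N) ^ CARD('d)) * of_int ?M :: complex) = of_real (grid_size N * (4 * real N) ^ CARD('d))" by simp
      also have "\<dots> = of_real (real (card (torus_grid N :: (int \<times> (int^'d)) set)))" by (simp only: card_torus_grid[OF N])
      finally show ?thesis using True by (auto simp: prod_eq_iff)
    qed
    finally show ?thesis .
  qed
  finally show ?thesis .
qed

lemma norm_sum_square_expand:
  fixes f :: "'a \<Rightarrow> complex"
  shows "of_real ((cmod (\<Sum>x\<in>X. f x))\<^sup>2) = (\<Sum>x\<in>X. \<Sum>y\<in>X. f x * cnj (f y))"
  by (simp only: complex_norm_square cnj_sum sum_product)

text \<open>Parseval, with the orthogonality taken between the points x, y instead of between the
  characters.\<close>

lemma sum_norm_square_orthogonal:
  fixes \<psi> :: "'b \<Rightarrow> 'a \<Rightarrow> complex"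
  assumes "finite X"
    and orth: "\<And>x y. x \<in> X \<Longrightarrow> y \<in> X \<Longrightarrow> (\<Sum>b\<in>B. \<psi> b x * cnj (\<psi> b y)) = (if x = y then of_real Q else 0)"
  shows "(\<Sum>b\<in>B. (cmod (\<Sum>x\<in>X. c x * \<psi> b x))\<^sup>2) = Q * (\<Sum>x\<in>X. (cmod (c x))\<^sup>2)"
proof -
  have "of_real (\<Sum>b\<in>B. (cmod (\<Sum>x\<in>X. c x * \<psi> b x))\<^sup>2)
    = (\<Sum>b\<in>B. \<Sum>x\<in>X. \<Sum>y\<in>X. (c x * cnj (c y)) * (\<psi> b x * cnj (\<psi> b y)))"
    by (simp only: of_real_sum norm_sum_square_expand complex_cnj_mult mult_ac)
  also have "\<dots> = (\<Sum>x\<in>X. \<Sum>y\<in>X. (c x * cnj (c y)) * (\<Sum>b\<in>B. \<psi> b x * cnj (\<psi> b y)))"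
    unfolding sum_distrib_left by (subst sum.swap, rule sum.cong[OF refl], rule sum.swap)
  also have "\<dots> = (\<Sum>x\<in>X. \<Sum>y\<in>X. if x = y then c x * cnj (c x) * of_real Q else 0)"
    by (intro sum.cong refl) (simp add: orth)
  also have "\<dots> = (\<Sum>x\<in>X. c x * cnj (c x) * of_real Q)" using assms(1) by (simp add: sum.delta)
  also have "\<dots> = of_real (Q * (\<Sum>x\<in>X. (cmod (c x))\<^sup>2))"
    by (simp add: complex_norm_square[symmetric] sum_distrib_left mult_ac)
  finally show ?thesis by (simp only: of_real_eq_iff)
qed

definition dual_sum :: "real^'d^'d \<Rightarrow> nat \<Rightarrow> (int \<times> (int^'d)) set \<Rightarrow> (int \<times> (int^'d) \<Rightarrow> complex) \<Rightarrow> int \<Rightarrow> int^'d \<Rightarrow> complex" where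
  "dual_sum A N E c k n = (\<Sum>x\<in>E. c x * grid_char A N k n x)"

lemma dual_sum_square_sum:
  fixes E :: "(int \<times> (int^'d)) set"
  assumes N: "N \<ge> 1" and E: "E \<subseteq> torus_grid N"
  shows "(\<Sum>(k, n)\<in>freqs N \<times> weight_box N. (cmod (dual_sum A N E c k n))\<^sup>2)
    = real (card (torus_grid N :: (int \<times> (int^'d)) set)) * (\<Sum>x\<in>E. (cmod (c x))\<^sup>2)"
proof -
  have "finite E" using E finite_torus_grid by (rule finite_subset)
  then have "(\<Sum>b\<in>freqs N \<times> weight_box N. (cmod (\<Sum>x\<in>E. c x * (case b of (k, n) \<Rightarrow> grid_char A N k n x)))\<^sup>2)
     = real (card (torus_grid N :: (int \<times> (int^'d)) set)) * (\<Sum>x\<in>E. (cmod (c x))\<^sup>2)"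
  proof (rule sum_norm_square_orthogonal)
    fix x y assume "x \<in> E" "y \<in> E"
    then have "x \<in> torus_grid N" "y \<in> torus_grid N" using E by auto
    from grid_char_orthogonal[OF N this, of A]
    show "(\<Sum>b\<in>freqs N \<times> weight_box N. (case b of (k, n) \<Rightarrow> grid_char A N k n x) * cnj (case b of (k, n) \<Rightarrow> grid_char A N k n y))
      = (if x = y then of_real (real (card (torus_grid N :: (int \<times> (int^'d)) set))) else 0)"
      by (simp add: split_def)
  qed
  then show ?thesis by (simp only: dual_sum_def split_def)
qed

text \<open>For k = 0 this is the form <f * K, f>, and for other k the same form with K modulated in
  time. As a weighted sum of squares it is nonnegative, so the triangle inequality only affects the
  coefficients in front of it.\<close>

definition dual_energy :: "real^'d^'d \<Rightarrow> nat \<Rightarrow> (int \<times> (int^'d)) set \<Rightarrow> (int \<times> (int^'d) \<Rightarrow> complex) \<Rightarrow> int \<Rightarrow> real" where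
  "dual_energy A N E c k = (\<Sum>n\<in>weight_box N. box_weight N n * (cmod (dual_sum A N E c k n))\<^sup>2)"

lemma dual_energy_nonneg: "0 \<le> dual_energy A N E c k"
  by (simp add: dual_energy_def sum_nonneg)

lemma dual_energy_eq_kernel_sum:
  "of_real (dual_energy A N E c k) = (\<Sum>x\<in>E. \<Sum>y\<in>E. c x * cnj (c y)
    * kernel A N (grid_time N x - grid_time N y) (grid_space N x - grid_space N y)
    * e (of_int k * (of_int (fst x - fst y) / grid_size N)))"
proof -
  have "of_real (dual_energy A N E c k) = (\<Sum>n\<in>weight_box N. \<Sum>x\<in>E. \<Sum>y\<in>E. of_real (box_weight N n) * ((c x * cnj (c y))
    * (grid_char A N k n x * cnj (grid_char A N k n y))))"
    by (simp only: dual_energy_def dual_sum_def of_real_sum of_real_mult norm_sum_square_expand complex_cnj_mult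
      sum_distrib_left mult_ac)
  also have "\<dots> = (\<Sum>x\<in>E. \<Sum>y\<in>E. \<Sum>n\<in>weight_box N. of_real (box_weight N n) * ((c x * cnj (c y))
    * (grid_char A N k n x * cnj (grid_char A N k n y))))"
    by (subst sum.swap, rule sum.cong[OF refl], rule sum.swap)
  finally show ?thesis
    unfolding grid_char_mult_cnj kernel_def sum_distrib_left sum_distrib_right by (simp only: mult_ac)
qed

text \<open>The zero frequency of the major-arc indicator reproduces the energy itself, with a factor at
  most \<open>1/2\<close>, so it is absorbed on the left instead of being estimated.\<close>

lemma dual_energy_bound:
  fixes E :: "(int \<times> (int^'d)) set" and V \<kappa> :: real
  assumes L: "1 \<le> L" "3 * L \<le> N" and E: "E \<subseteq> torus_grid N" and c: "\<And>x. cmod (c x) \<le> 1"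
    and \<kappa>: "\<And>j \<theta>. j mod grid_size N \<notin> major_arcs N L \<Longrightarrow> cmod (kernel A N (of_int j / grid_size N) \<theta>) \<le> \<kappa>"
    and \<kappa>0: "0 \<le> \<kappa>" and V: "V > 0" and R: "R \<ge> 1"
  shows "dual_energy A N E c 0 / 2 \<le> \<kappa> * (real (card E))\<^sup>2
    + 2 ^ CARD('d) * (V * real (card (torus_grid N :: (int \<times> (int^'d)) set)) * card E
      + (real (card E))\<^sup>2 * (4 * real N) ^ CARD('d) * (\<Sum>k\<in>freqs N - {0}. cmod (major_coeff N L k) ^ R) / V ^ (R - 1))"
proof -
  have N: "N \<ge> 1" using L by simp
  let ?K = "\<lambda>x y. kernel A N (grid_time N x - grid_time N y) (grid_space N x - grid_space N y)"
  let ?\<phi> = "\<lambda>x y. of_bool ((fst x - fst y) mod grid_size N \<in> major_arcs N L) :: complex"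
  let ?Q = "real (card (torus_grid N :: (int \<times> (int^'d)) set))"
  let ?en = "dual_energy A N E c"
  have zero: "0 \<in> freqs N" using N by simp
  have "(\<Sum>x\<in>E. \<Sum>y\<in>E. c x * cnj (c y) * ?K x y * ?\<phi> x y) = (\<Sum>k\<in>freqs N. major_coeff N L k * of_real (?en k))"
  proof -
    have "(\<Sum>x\<in>E. \<Sum>y\<in>E. c x * cnj (c y) * ?K x y * ?\<phi> x y)
      = (\<Sum>x\<in>E. \<Sum>y\<in>E. \<Sum>k\<in>freqs N. major_coeff N L k * (c x * cnj (c y) * ?K x y * e (of_int k * (of_int (fst x - fst y) / grid_size N))))"
      unfolding major_coeff_inversion[OF N, symmetric] sum_distrib_left by (simp only: mult_ac)
    also have "\<dots> = (\<Sum>x\<in>E. \<Sum>k\<in>freqs N. \<Sum>y\<in>E. major_coeff N L k * (c x * cnj (c y) * ?K x y * e (of_int k * (of_int (fst x - fst y) / grid_size N))))"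
      by (intro sum.cong refl sum.swap)
    also have "\<dots> = (\<Sum>k\<in>freqs N. \<Sum>x\<in>E. \<Sum>y\<in>E. major_coeff N L k * (c x * cnj (c y) * ?K x y * e (of_int k * (of_int (fst x - fst y) / grid_size N))))"
      by (rule sum.swap)
    finally show ?thesis unfolding dual_energy_eq_kernel_sum sum_distrib_left .
  qed
  \<comment> \<open>The kernel is split as K \<phi> + K (1 - \<phi>), with \<phi> the major-arc
    indicator of the time difference; the first half is on the Fourier side by the previous
    identity.\<close>
  moreover have "of_real (?en 0) = (\<Sum>x\<in>E. \<Sum>y\<in>E. c x * cnj (c y) * ?K x y * ?\<phi> x y) + (\<Sum>x\<in>E. \<Sum>y\<in>E. c x * cnj (c y) * ?K x y * (1 - ?\<phi> x y))"
    unfolding dual_energy_eq_kernel_sum sum.distrib[symmetric] by (intro sum.cong refl) (simp add: algebra_simps)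
  ultimately have "of_real (?en 0) = (\<Sum>k\<in>freqs N. major_coeff N L k * of_real (?en k)) + (\<Sum>x\<in>E. \<Sum>y\<in>E. c x * cnj (c y) * ?K x y * (1 - ?\<phi> x y))"
    by simp
  then have "?en 0 = cmod ((\<Sum>k\<in>freqs N. major_coeff N L k * of_real (?en k)) + (\<Sum>x\<in>E. \<Sum>y\<in>E. c x * cnj (c y) * ?K x y * (1 - ?\<phi> x y)))"
    by (metis abs_of_nonneg dual_energy_nonneg norm_of_real)
  also have "\<dots> \<le> cmod (\<Sum>k\<in>freqs N. major_coeff N L k * of_real (?en k)) + cmod (\<Sum>x\<in>E. \<Sum>y\<in>E. c x * cnj (c y) * ?K x y * (1 - ?\<phi> x y))"
    by (rule norm_triangle_ineq)
  also have "cmod (\<Sum>x\<in>E. \<Sum>y\<in>E. c x * cnj (c y) * ?K x y * (1 - ?\<phi> x y)) \<le> (\<Sum>x\<in>E. \<Sum>y\<in>E. \<kappa>)"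
  proof (intro sum_norm_le)
    fix x y
    show "cmod (c x * cnj (c y) * ?K x y * (1 - ?\<phi> x y)) \<le> \<kappa>"
    proof (cases "(fst x - fst y) mod grid_size N \<in> major_arcs N L")
      case False
      have "grid_time N x - grid_time N y = of_int (fst x - fst y) / grid_size N"
        by (simp add: grid_time_def diff_divide_distrib)
      then have "cmod (?K x y) \<le> \<kappa>" using \<kappa>[OF False] by simp
      then have "cmod (c x) * cmod (c y) * cmod (?K x y) \<le> 1 * 1 * \<kappa>"
        using c by (intro mult_mono) auto
      then show ?thesis using False by (simp add: norm_mult)
    qed (use \<kappa>0 in simp)
  qed
  also have "(\<Sum>x\<in>E. \<Sum>y\<in>E. \<kappa>) = \<kappa> * (real (card E))\<^sup>2" by (simp add: power2_eq_square)
  also have "cmod (\<Sum>k\<in>freqs N. major_coeff N L k * of_real (?en k)) \<le> (\<Sum>k\<in>freqs N. cmod (major_coeff N L k) * ?en k)"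
    by (rule sum_norm_le) (simp add: norm_mult dual_energy_nonneg)
  also have "(\<Sum>k\<in>freqs N. cmod (major_coeff N L k) * ?en k) = cmod (major_coeff N L 0) * ?en 0 + (\<Sum>k\<in>freqs N - {0}. cmod (major_coeff N L k) * ?en k)"
    using zero by (subst sum.remove) auto
  also have "cmod (major_coeff N L 0) * ?en 0 \<le> 1/2 * ?en 0"
    by (intro mult_right_mono major_coeff_0_le L dual_energy_nonneg)
  finally have main: "?en 0 / 2 \<le> \<kappa> * (real (card E))\<^sup>2 + (\<Sum>k\<in>freqs N - {0}. cmod (major_coeff N L k) * ?en k)" by simp
  have S_le: "cmod (dual_sum A N E c k n) \<le> card E" for k n
  proof -
    have "cmod (dual_sum A N E c k n) \<le> (\<Sum>x\<in>E. 1)"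
      unfolding dual_sum_def by (rule sum_norm_le) (simp add: norm_mult grid_char_def c)
    then show ?thesis by simp
  qed
  \<comment> \<open>replaces Hoelder's inequality: truncate the coefficients at height \<open>V\<close>\<close>
  have split: "m * s\<^sup>2 \<le> V * s\<^sup>2 + (real (card E))\<^sup>2 * (m ^ R / V ^ (R - 1))" if "0 \<le> m" "0 \<le> s" "s \<le> card E" for m s :: real
  proof (cases "m \<le> V")
    case True
    then have "m * s\<^sup>2 \<le> V * s\<^sup>2" by (intro mult_right_mono) auto
    moreover have "0 \<le> (real (card E))\<^sup>2 * (m ^ R / V ^ (R - 1))" using that V by simp
    ultimately show ?thesis by linarith
  next
    case False
    have "m * V ^ (R - 1) \<le> m * m ^ (R - 1)" using False V by (intro mult_left_mono power_mono) auto
    also have "\<dots> = m ^ R" using R by (metis Suc_diff_1 less_eq_Suc_le One_nat_def power_Suc)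
    finally have "m \<le> m ^ R / V ^ (R - 1)" using V by (simp add: pos_le_divide_eq)
    moreover have "s\<^sup>2 \<le> (real (card E))\<^sup>2" using that by (intro power_mono) auto
    ultimately have "m * s\<^sup>2 \<le> m ^ R / V ^ (R - 1) * (real (card E))\<^sup>2" using that by (intro mult_mono) auto
    moreover have "0 \<le> V * s\<^sup>2" using V by simp
    ultimately show ?thesis by (simp add: mult.commute)
  qed
  have "(\<Sum>k\<in>freqs N - {0}. cmod (major_coeff N L k) * ?en k)
    \<le> (\<Sum>k\<in>freqs N - {0}. \<Sum>n\<in>weight_box N. 2 ^ CARD('d) * (V * (cmod (dual_sum A N E c k n))\<^sup>2 + (real (card E))\<^sup>2 * (cmod (major_coeff N L k) ^ R / V ^ (R - 1))))"
  proof (rule sum_mono)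
    fix k
    have "cmod (major_coeff N L k) * ?en k = (\<Sum>n\<in>weight_box N. box_weight N n * (cmod (major_coeff N L k) * (cmod (dual_sum A N E c k n))\<^sup>2))"
      unfolding dual_energy_def sum_distrib_left by (simp only: mult_ac)
    also have "\<dots> \<le> (\<Sum>n\<in>weight_box N. 2 ^ CARD('d) * (V * (cmod (dual_sum A N E c k n))\<^sup>2 + (real (card E))\<^sup>2 * (cmod (major_coeff N L k) ^ R / V ^ (R - 1))))"
      by (intro sum_mono mult_mono box_weight_le split S_le) auto
    finally show "cmod (major_coeff N L k) * ?en k \<le> (\<Sum>n\<in>weight_box N. 2 ^ CARD('d) * (V * (cmod (dual_sum A N E c k n))\<^sup>2 + (real (card E))\<^sup>2 * (cmod (major_coeff N L k) ^ R / V ^ (R - 1))))" .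
  qed
  also have "\<dots> = 2 ^ CARD('d) * (V * (\<Sum>k\<in>freqs N - {0}. \<Sum>n\<in>weight_box N. (cmod (dual_sum A N E c k n))\<^sup>2)
     + (real (card E))\<^sup>2 * (4 * real N) ^ CARD('d) * (\<Sum>k\<in>freqs N - {0}. cmod (major_coeff N L k) ^ R) / V ^ (R - 1))"
  proof -
    have "real (card (weight_box N :: (int^'d) set)) = (4 * real N) ^ CARD('d)" by (simp add: card_int_box)
    then show ?thesis
      by (simp add: sum_distrib_left[symmetric] sum.distrib sum_divide_distrib[symmetric] mult_ac)
  qed
  also have "\<dots> \<le> 2 ^ CARD('d) * (V * (?Q * card E)
     + (real (card E))\<^sup>2 * (4 * real N) ^ CARD('d) * (\<Sum>k\<in>freqs N - {0}. cmod (major_coeff N L k) ^ R) / V ^ (R - 1))"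
  proof (intro mult_left_mono add_right_mono)
    \<comment> \<open>Restoring k = 0 makes the frequency set complete, so that Parseval
      applies.\<close>
    have "(\<Sum>k\<in>freqs N - {0}. \<Sum>n\<in>weight_box N. (cmod (dual_sum A N E c k n))\<^sup>2) \<le> (\<Sum>k\<in>freqs N. \<Sum>n\<in>weight_box N. (cmod (dual_sum A N E c k n))\<^sup>2)"
      by (rule sum_mono2) (auto intro: sum_nonneg)
    also have "\<dots> = ?Q * (\<Sum>x\<in>E. (cmod (c x))\<^sup>2)"
      unfolding sum.cartesian_product by (rule dual_sum_square_sum[OF N E])
    also have "\<dots> \<le> ?Q * (\<Sum>x\<in>E. 1)"
      using c by (intro mult_left_mono sum_mono) (auto simp: power_le_one)
    finally show "(\<Sum>k\<in>freqs N - {0}. \<Sum>n\<in>weight_box N. (cmod (dual_sum A N E c k n))\<^sup>2) \<le> ?Q * card E" by simp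
  qed (use V in auto)
  also have "\<dots> = 2 ^ CARD('d) * (V * ?Q * card E
     + (real (card E))\<^sup>2 * (4 * real N) ^ CARD('d) * (\<Sum>k\<in>freqs N - {0}. cmod (major_coeff N L k) ^ R) / V ^ (R - 1))"
    by (simp only: mult.assoc)
  finally show ?thesis using add_left_mono order_trans[OF main] by blast
qed

definition grid_F :: "real^'d^'d \<Rightarrow> nat \<Rightarrow> (int^'d \<Rightarrow> complex) \<Rightarrow> int \<times> (int^'d) \<Rightarrow> complex" where
  "grid_F A N a x = (\<Sum>n\<in>weight_box N. a n * grid_char A N 0 n x)"

text \<open>The multiplier c is the conjugate sign of F, so the sum of c F over E is at least t |E|.
  After exchanging the sums, the square root of the weight, which is at least 1 wherever a is
  nonzero, is inserted before Cauchy-Schwarz.\<close>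

lemma level_set_duality:
  fixes E :: "(int \<times> (int^'d)) set" and a :: "int^'d \<Rightarrow> complex"
  assumes N: "N \<ge> 1" and a: "supported_on_box N a" and fin: "finite E"
    and E: "\<And>x. x \<in> E \<Longrightarrow> t \<le> cmod (grid_F A N a x)" and t: "t > 0"
  obtains c where "\<And>x. cmod (c x) \<le> 1"
    "t\<^sup>2 * (real (card E))\<^sup>2 \<le> (\<Sum>n\<in>weight_box N. (cmod (a n))\<^sup>2) * dual_energy A N E c 0"
proof (rule that)
  define c where "c = (\<lambda>x. cnj (sgn (grid_F A N a x)))"
  show "cmod (c x) \<le> 1" for x by (simp add: c_def norm_sgn)
  have cF: "c x * grid_F A N a x = of_real (cmod (grid_F A N a x))" for x
    by (simp add: c_def sgn_eq complex_norm_square[symmetric] power2_eq_square mult.commute)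
  have "t * card E \<le> (\<Sum>x\<in>E. cmod (grid_F A N a x))" using sum_mono[of E "\<lambda>_. t"] E by (simp add: mult.commute)
  also have "\<dots> = cmod (\<Sum>x\<in>E. c x * grid_F A N a x)"
    unfolding cF of_real_sum[symmetric] norm_of_real by (simp add: sum_nonneg)
  also have "(\<Sum>x\<in>E. c x * grid_F A N a x) = (\<Sum>n\<in>weight_box N. a n * dual_sum A N E c 0 n)"
    unfolding grid_F_def dual_sum_def sum_distrib_left by (subst sum.swap) (simp only: mult_ac)
  also have "cmod \<dots> \<le> (\<Sum>n\<in>weight_box N. cmod (a n) * (sqrt (box_weight N n) * cmod (dual_sum A N E c 0 n)))"
  proof (rule sum_norm_le)
    fix n
    show "cmod (a n * dual_sum A N E c 0 n) \<le> cmod (a n) * (sqrt (box_weight N n) * cmod (dual_sum A N E c 0 n))"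
    proof (cases "a n = 0")
      case False
      then have "1 \<le> box_weight N n" using a N by (intro box_weight_ge_1) (auto simp: supported_on_box_def)
      then have "1 * cmod (dual_sum A N E c 0 n) \<le> sqrt (box_weight N n) * cmod (dual_sum A N E c 0 n)"
        by (intro mult_right_mono) auto
      then show ?thesis by (simp add: norm_mult mult_left_mono)
    qed simp
  qed
  finally have "(t * card E)\<^sup>2 \<le> (\<Sum>n\<in>weight_box N. cmod (a n) * (sqrt (box_weight N n) * cmod (dual_sum A N E c 0 n)))\<^sup>2"
    using t by (intro power_mono) auto
  also have "\<dots> \<le> (\<Sum>n\<in>weight_box N. (cmod (a n))\<^sup>2) * (\<Sum>n\<in>weight_box N. (sqrt (box_weight N n) * cmod (dual_sum A N E c 0 n))\<^sup>2)"
    by (rule Cauchy_Schwarz_ineq_sum)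
  also have "(\<Sum>n\<in>weight_box N. (sqrt (box_weight N n) * cmod (dual_sum A N E c 0 n))\<^sup>2) = dual_energy A N E c 0"
    by (simp add: dual_energy_def power_mult_distrib)
  finally show "t\<^sup>2 * (real (card E))\<^sup>2 \<le> (\<Sum>n\<in>weight_box N. (cmod (a n))\<^sup>2) * dual_energy A N E c 0"
    by (simp add: power_mult_distrib)
qed

section \<open>Level sets on the grid\<close>

lemma harm_le_ln: "L \<ge> 1 \<Longrightarrow> harm L \<le> 1 + ln (real L)"
proof (induction L rule: dec_induct)
  case base
  then show ?case by (simp add: harm_eq_sum)
next
  case (step n)
  have "ln (real n / real (Suc n)) \<le> real n / real (Suc n) - 1"
    using step by (intro ln_le_minus_one) auto
  also have "\<dots> = - 1 / real (Suc n)" by (simp add: field_simps)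
  finally have "1 / real (Suc n) \<le> ln (real (Suc n)) - ln (real n)"
    using step by (simp add: ln_div)
  moreover have "harm (Suc n) = harm n + 1 / real (Suc n)" by (simp add: harm_eq_sum)
  ultimately show ?case using step.IH by linarith
qed

lemma harm_le_powr:
  assumes "\<eta> > 0" "L \<ge> 1"
  shows "harm L \<le> (1 + 1 / \<eta>) * real L powr \<eta>"
proof -
  have "1 \<le> real L powr \<eta>" using assms by (intro ge_one_powr_ge_zero) auto
  moreover have "ln (real L) \<le> real L powr \<eta> / \<eta>" using assms by (intro ln_powr_bound) auto
  ultimately show ?thesis using harm_le_ln[OF assms(2)] by (simp add: distrib_right)
qed

text \<open>The divisor bound with exponent \<eta>/R, applied to m <= L^R, yields L^\<eta>; the two
  harmonic factors yield L^(2 \<eta>).\<close>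

lemma moment_base_le:
  fixes \<eta> :: real
  assumes \<eta>: "\<eta> > 0" and R: "R \<ge> 1"
  obtains C where "C \<ge> 1" "\<And>L. L \<ge> 1 \<Longrightarrow> \<exists>D. (\<forall>m. 1 \<le> m \<and> m \<le> L ^ R \<longrightarrow> real (card {g. g dvd m}) \<le> D)
    \<and> 6 * real L * (harm L)\<^sup>2 * D \<le> C * real L powr (1 + 3 * \<eta>)"
proof -
  obtain B where B: "B \<ge> 1" "\<And>m::nat. m > 0 \<Longrightarrow> real (card {h. h dvd m}) \<le> B * real m powr (\<eta> / R)"
    using divisor_bound[of "\<eta> / R"] \<eta> R by auto
  show ?thesis
  proof (rule that)
    have "1 \<le> (1 + 1 / \<eta>)\<^sup>2" using \<eta> by (intro one_le_power) auto
    then show "1 \<le> 6 * (1 + 1 / \<eta>)\<^sup>2 * B" using B mult_mono[of 1 "6 * (1 + 1 / \<eta>)\<^sup>2" 1 B] by simp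
    fix L :: nat assume L: "L \<ge> 1"
    show "\<exists>D. (\<forall>m. 1 \<le> m \<and> m \<le> L ^ R \<longrightarrow> real (card {g. g dvd m}) \<le> D)
      \<and> 6 * real L * (harm L)\<^sup>2 * D \<le> 6 * (1 + 1 / \<eta>)\<^sup>2 * B * real L powr (1 + 3 * \<eta>)"
    proof (intro exI conjI allI impI)
      fix m assume m: "1 \<le> m \<and> m \<le> L ^ R"
      then have "real m powr (\<eta> / R) \<le> real (L ^ R) powr (\<eta> / R)"
        using \<eta> by (intro powr_mono2) (auto simp del: of_nat_power)
      also have "\<dots> = (real L powr real R) powr (\<eta> / R)" using L by (simp add: powr_realpow)
      also have "\<dots> = real L powr \<eta>" using R by (simp add: powr_powr)
      finally show "real (card {g. g dvd m}) \<le> B * real L powr \<eta>"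
        using B(2)[of m] m B(1) by (smt (verit) mult_left_mono less_eq_Suc_le One_nat_def)
    next
      have H: "0 \<le> (harm L :: real)" by (rule harm_nonneg)
      have "(harm L)\<^sup>2 \<le> ((1 + 1 / \<eta>) * real L powr \<eta>)\<^sup>2"
        by (intro power_mono harm_le_powr \<eta> L H)
      then have "6 * real L * (harm L)\<^sup>2 * (B * real L powr \<eta>) \<le> 6 * real L * ((1 + 1 / \<eta>) * real L powr \<eta>)\<^sup>2 * (B * real L powr \<eta>)"
        using B(1) by (intro mult_right_mono mult_left_mono) auto
      also have "\<dots> = 6 * (1 + 1 / \<eta>)\<^sup>2 * B * (real L powr 1 * real L powr \<eta> * real L powr \<eta> * real L powr \<eta>)"
        using L by (simp add: power_mult_distrib power2_eq_square mult_ac)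
      also have "real L powr 1 * real L powr \<eta> * real L powr \<eta> * real L powr \<eta> = real L powr (1 + 3 * \<eta>)"
        by (simp only: powr_add[symmetric]) (simp add: algebra_simps)
      finally show "6 * real L * (harm L)\<^sup>2 * (B * real L powr \<eta>) \<le> 6 * (1 + 1 / \<eta>)\<^sup>2 * B * real L powr (1 + 3 * \<eta>)" .
    qed
  qed
qed

text \<open>Let \<tau> = t^2 / S and G = |E|. Duality gives \<tau> G^2 <= energy, and half of the
  energy is at most \<tau> G^2 / 8 from the minor arcs, plus \<tau> G^2 / 8 from the coefficients
  above V (this is \<open>V_large\<close>), plus a term linear in G. What is left, \<tau> G^2 / 4,
  is divided by G.\<close>

lemma card_level_set_le:
  fixes E :: "(int \<times> (int^'d)) set" and a :: "int^'d \<Rightarrow> complex" and t V D :: real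
  assumes L: "1 \<le> L" "3 * L \<le> N" and a: "supported_on_box N a" and E: "E \<subseteq> torus_grid N"
    and level: "\<And>x. x \<in> E \<Longrightarrow> t \<le> cmod (grid_F A N a x)" and t: "t > 0"
    and S: "S = (\<Sum>n\<in>weight_box N. (cmod (a n))\<^sup>2)" "S > 0"
    and \<kappa>: "\<And>j \<theta>. j mod grid_size N \<notin> major_arcs N L \<Longrightarrow> cmod (kernel A N (of_int j / grid_size N) \<theta>) \<le> t\<^sup>2 / S / 8"
    and R: "R \<ge> 2" and D: "\<And>m. 1 \<le> m \<Longrightarrow> m \<le> L ^ R \<Longrightarrow> real (card {g. g dvd m}) \<le> D"
    and V: "V > 0" and V_large: "2 * 8 ^ CARD('d) * real N ^ CARD('d) * (6 * real L * (harm L)\<^sup>2 * D) ^ R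
      / ((real N)\<^sup>2 * V) ^ (R - 1) \<le> t\<^sup>2 / S / 8"
  shows "real (card E) \<le> 4 * 2 ^ CARD('d) * V / (t\<^sup>2 / S) * real (card (torus_grid N :: (int \<times> (int^'d)) set))"
proof (cases "card E = 0")
  case True
  then show ?thesis using V S t by simp
next
  case False
  define \<tau> where "\<tau> = t\<^sup>2 / S"
  define Q where "Q = real (card (torus_grid N :: (int \<times> (int^'d)) set))"
  define G where "G = real (card E)"
  have pos: "\<tau> > 0" "G > 0" using S t False by (auto simp: \<tau>_def G_def)
  have N: "N \<ge> 1" using L by simp
  have fin: "finite E" using E finite_torus_grid by (rule finite_subset)
  obtain c where c: "\<And>x. cmod (c x) \<le> 1" "t\<^sup>2 * G\<^sup>2 \<le> S * dual_energy A N E c 0"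
    using level_set_duality[OF N a fin level t] unfolding S(1)[symmetric] G_def by blast
  have "\<tau> * G\<^sup>2 \<le> dual_energy A N E c 0" using c(2) S(2) by (simp add: \<tau>_def field_simps)
  moreover have "dual_energy A N E c 0 / 2 \<le> \<tau> / 8 * G\<^sup>2 + 2 ^ CARD('d) * (V * Q * G
      + G\<^sup>2 * (4 * real N) ^ CARD('d) * (\<Sum>k\<in>freqs N - {0}. cmod (major_coeff N L k) ^ R) / V ^ (R - 1))"
    unfolding G_def Q_def by (rule dual_energy_bound[OF L E c(1)]) (use \<kappa> V R pos in \<open>auto simp: \<tau>_def\<close>)
  moreover have "2 ^ CARD('d) * (G\<^sup>2 * (4 * real N) ^ CARD('d) * (\<Sum>k\<in>freqs N - {0}. cmod (major_coeff N L k) ^ R) / V ^ (R - 1)) \<le> \<tau> / 8 * G\<^sup>2"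
  proof -
    let ?s = "\<Sum>k\<in>freqs N - {0}. cmod (major_coeff N L k) ^ R"
    have "2 ^ CARD('d) * (4 * real N) ^ CARD('d) * ?s / V ^ (R - 1) \<le> 2 ^ CARD('d) * (4 * real N) ^ CARD('d) *
       (2 * (6 * real L * (harm L)\<^sup>2 * D) ^ R / ((real N)\<^sup>2) ^ (R - 1)) / V ^ (R - 1)"
      using major_coeff_moment[OF L R D] V by (intro divide_right_mono mult_left_mono) auto
    also have "\<dots> = 2 * (2 ^ CARD('d) * 4 ^ CARD('d)) * real N ^ CARD('d) * (6 * real L * (harm L)\<^sup>2 * D) ^ R / ((real N)\<^sup>2 * V) ^ (R - 1)"
      by (simp add: power_mult_distrib)
    also have "(2 ^ CARD('d) * 4 ^ CARD('d) :: real) = 8 ^ CARD('d)" by (simp add: power_mult_distrib[symmetric])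
    also have "2 * 8 ^ CARD('d) * real N ^ CARD('d) * (6 * real L * (harm L)\<^sup>2 * D) ^ R / ((real N)\<^sup>2 * V) ^ (R - 1) \<le> \<tau> / 8"
      using V_large by (simp add: \<tau>_def)
    finally have "2 ^ CARD('d) * (4 * real N) ^ CARD('d) * ?s / V ^ (R - 1) * G\<^sup>2 \<le> \<tau> / 8 * G\<^sup>2"
      by (rule mult_right_mono) simp
    then show ?thesis by (simp add: mult_ac)
  qed
  ultimately have "\<tau> * G\<^sup>2 / 4 \<le> 2 ^ CARD('d) * (V * Q * G)" unfolding distrib_left by linarith
  then have "\<tau> * G * G \<le> 4 * 2 ^ CARD('d) * V * Q * G" by (simp add: power2_eq_square mult_ac)
  then have "\<tau> * G \<le> 4 * 2 ^ CARD('d) * V * Q" using pos by simp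
  then show ?thesis using pos unfolding G_def[symmetric] Q_def[symmetric] \<tau>_def[symmetric] by (simp add: field_simps)
qed

lemma norm_grid_F_square_le:
  fixes a :: "int^'d \<Rightarrow> complex"
  shows "(cmod (grid_F A N a x))\<^sup>2 \<le> 4 ^ CARD('d) * real N ^ CARD('d) * (\<Sum>n\<in>weight_box N. (cmod (a n))\<^sup>2)"
proof -
  have "cmod (grid_F A N a x) \<le> (\<Sum>n\<in>weight_box N. cmod (a n) * 1)"
    unfolding grid_F_def by (rule sum_norm_le) (simp add: norm_mult grid_char_def)
  then have "(cmod (grid_F A N a x))\<^sup>2 \<le> (\<Sum>n\<in>weight_box N. cmod (a n) * 1)\<^sup>2" by (intro power_mono) auto
  also have "\<dots> \<le> (\<Sum>n\<in>weight_box N. (cmod (a n))\<^sup>2) * (\<Sum>n\<in>(weight_box N :: (int^'d) set). 1\<^sup>2)"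
    by (rule Cauchy_Schwarz_ineq_sum)
  also have "(\<Sum>n\<in>(weight_box N :: (int^'d) set). 1\<^sup>2) = 4 ^ CARD('d) * real N ^ CARD('d)"
    by (simp add: card_int_box power_mult_distrib)
  finally show ?thesis by (simp add: mult_ac)
qed

lemma kernel_off_major_arcs:
  assumes L: "1 \<le> L" "L \<le> N"
    and minor: "\<And>t \<theta>. (\<And>q a. \<lbrakk>1 \<le> q; q \<le> L; coprime a (int q)\<rbrakk> \<Longrightarrow> \<bar>t - of_int a / q\<bar> > real L / (real q * (real N)\<^sup>2))
      \<Longrightarrow> cmod (kernel A N t \<theta>) \<le> \<kappa>"
    and j: "j mod grid_size N \<notin> major_arcs N L"
  shows "cmod (kernel A N (of_int j / grid_size N) \<theta>) \<le> \<kappa>"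
proof (rule minor)
  fix q a assume "1 \<le> q" "q \<le> L" "coprime a (int q)"
  then show "\<bar>of_int j / grid_size N - of_int a / q\<bar> > real L / (real q * (real N)\<^sup>2)"
    using major_arcsI[OF L(2), of q a j] j by force
qed

text \<open>Here \<delta> is the height relative to N^(d/2) ||a||, the order of the Cauchy-Schwarz
  bound for |F|. The constant C is fixed before p, while p' and K depend on p; any p' < p suffices
  for the later summation over heights.\<close>

theorem grid_level_set:
  fixes A :: "real^'d^'d"
  assumes A: "integer_form_matrix A" and nd: "nondegenerate A"
  obtains C where "C > 0" and "\<And>p. p > 2 * (real CARD('d) + 2) / real CARD('d) \<Longrightarrow>
    \<exists>p' K. 0 < p' \<and> p' < p \<and> K > 0 \<and> (\<forall>N\<ge>1. \<forall>a \<delta>. supported_on_box N a \<longrightarrow> (\<Sum>n\<in>weight_box N. (cmod (a n))\<^sup>2) > 0 \<longrightarrow>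
      \<delta> \<ge> C * real N powr (- real CARD('d) / 4) \<longrightarrow>
      real (card {x \<in> torus_grid N. \<delta> * real N powr (real CARD('d) / 2) * sqrt (\<Sum>n\<in>weight_box N. (cmod (a n))\<^sup>2) \<le> cmod (grid_F A N a x)})
      \<le> K * real N powr (- (real CARD('d) + 2)) * \<delta> powr (- p') * real (card (torus_grid N :: (int \<times> (int^'d)) set)))"
proof -
  define d where "d = real CARD('d)"
  have d: "d \<ge> 1" by (simp add: d_def Suc_leI)
  obtain C2 where C2: "C2 \<ge> 1" "\<And>N L t \<theta>. \<lbrakk>1 \<le> L; L \<le> N;
      \<And>q a. \<lbrakk>1 \<le> q; q \<le> L; coprime a (int q)\<rbrakk> \<Longrightarrow> \<bar>t - of_int a / q\<bar> > real L / (real q * (real N)\<^sup>2)\<rbrakk>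
    \<Longrightarrow> (cmod (kernel A N t \<theta>))\<^sup>2 \<le> (C2 * (real N)\<^sup>2 / L) ^ CARD('d)"
    using kernel_minor_arc_bound[OF A nd] by blast
  \<comment> \<open>The 64 puts a factor 64^d >= 8^2 into the denominator of the squared minor-arc
    bound, which provides the 1/8 needed for absorption.\<close>
  define C0 where "C0 = 64 * C2"
  have C0: "C0 \<ge> 64" using C2 by (simp add: C0_def)
  \<comment> \<open>With this C, the condition \<delta> >= C N^(-d/4) reads 6 C0 \<delta>^(-4/d) <=
    N, hence 3 L <= N.\<close>
  define C where "C = (6 * C0) powr (d / 4)"
  show ?thesis
  proof (rule that)
    show "C > 0" using C0 by (simp add: C_def)
    fix p :: real assume "p > 2 * (real CARD('d) + 2) / real CARD('d)"
    then have p: "p > 2 + 4 / d" using d unfolding d_def by (simp add: field_simps)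
    define s where "s = p - (2 + 4 / d)"
    have s: "s > 0" using p by (simp add: s_def)
    \<comment> \<open>Makes the loss (4/d) 3 \<eta> equal to s/2, half of the margin; the other half
      pays for R being finite.\<close>
    define \<eta> where "\<eta> = s * d / 24"
    have \<eta>: "\<eta> > 0" using s d by (simp add: \<eta>_def)
    define R where "R = nat \<lceil>2 * (2 + 4 / d + s) / s\<rceil> + 2"
    have R: "R \<ge> 2" by (simp add: R_def)
    have R_large: "real R * s > 2 * (2 + 4 / d + s)"
    proof -
      have "2 * (2 + 4 / d + s) / s < real R" unfolding R_def by linarith
      then show ?thesis using s by (simp add: pos_divide_less_eq)
    qed
    define r where "r = 1 / real (R - 1)"
    have r: "r > 0" "r * real (R - 1) = 1" "real (R - 1) = real R - 1" using R by (auto simp: r_def)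
    obtain C3 where C3: "C3 \<ge> 1" "\<And>L. L \<ge> 1 \<Longrightarrow> \<exists>D. (\<forall>m. 1 \<le> m \<and> m \<le> L ^ R \<longrightarrow> real (card {g. g dvd m}) \<le> D)
      \<and> 6 * real L * (harm L)\<^sup>2 * D \<le> C3 * real L powr (1 + 3 * \<eta>)"
      using moment_base_le[OF \<eta>, of R] R by auto
    define C4 where "C4 = C3 * (2 * C0) powr (1 + 3 * \<eta>)"
    have C4: "C4 > 0" using C3 C0 by (simp add: C4_def)
    define B :: real where "B = 16 * 8 ^ CARD('d)"
    have B: "B > 0" by (simp add: B_def)
    \<comment> \<open>The exponent that the choice of V below produces; it tends to 2 + 4/d as
      \<eta> tends to 0 and R to infinity.\<close>
    define p' where "p' = 2 + (4 / d * (1 + 3 * \<eta>) * R + 2) * r"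
    define K where "K = 4 * 2 ^ CARD('d) * (B * C4 ^ R) powr r"
    have K: "K > 0" using B C4 by (simp add: K_def)
    have p'0: "0 < p'" using r \<eta> d by (auto simp: p'_def intro!: add_pos_nonneg mult_nonneg_nonneg)
    have p'p: "p' < p"
    proof -
      have "4 / d * (1 + 3 * \<eta>) = 4 / d + s / 2" using d by (simp add: \<eta>_def field_simps)
      moreover have "(4 / d + s / 2) * R + 2 < (4 / d + s) * (real R - 1)"
      proof -
        have "(u + s / 2) * x + 2 < (u + s) * (x - 1)" if "x * s > 2 * (2 + u + s)" for u x :: real
          using that by (simp add: algebra_simps)
        then show ?thesis using R_large .
      qed
      ultimately have "(4 / d * (1 + 3 * \<eta>) * R + 2) < (4 / d + s) * real (R - 1)" using r by simp
      then have "(4 / d * (1 + 3 * \<eta>) * R + 2) * r < (4 / d + s) * real (R - 1) * r" using r by (intro mult_strict_right_mono)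
      also have "\<dots> = (4 / d + s) * (r * real (R - 1))" by (simp only: mult_ac)
      also have "\<dots> = 4 / d + s" unfolding r(2) by simp
      finally show ?thesis by (simp add: p'_def s_def)
    qed
    have bound: "real (card {x \<in> torus_grid N. \<delta> * real N powr (d / 2) * sqrt S \<le> cmod (grid_F A N a x)})
      \<le> K * real N powr (- (d + 2)) * \<delta> powr (- p') * real (card (torus_grid N :: (int \<times> (int^'d)) set))"
      if N: "N \<ge> 1" and a: "supported_on_box N a" and S: "S = (\<Sum>n\<in>weight_box N. (cmod (a n))\<^sup>2)" "S > 0" and \<delta>: "\<delta> \<ge> C * real N powr (- d / 4)"
      for N and a :: "int^'d \<Rightarrow> complex" and \<delta> S :: real
    proof -
      define E where "E = {x \<in> torus_grid N. \<delta> * real N powr (d / 2) * sqrt S \<le> cmod (grid_F A N a x)}"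
      have "C * real N powr (- d / 4) > 0" using \<open>C > 0\<close> N by simp
      then have \<delta>0: "\<delta> > 0" using \<delta> by linarith
      have Nd: "(real N powr (d / 2))\<^sup>2 = real N ^ CARD('d)"
        using N by (simp add: d_def powr_realpow[symmetric] powr_powr)
      show ?thesis
      proof (cases "E = {}")
        case True
        then show ?thesis unfolding E_def[symmetric] using K by simp
      next
        case False
        then obtain x where x: "\<delta> * real N powr (d / 2) * sqrt S \<le> cmod (grid_F A N a x)" by (auto simp: E_def)
        \<comment> \<open>Chosen so that (N^2 / y)^(d/2) = \<delta>^2 N^d = t^2 / S: up to
          constants, the minor-arc bound with L ~ y equals the threshold for absorption.\<close>
        define y where "y = \<delta> powr (- 4 / d)"
        have y0: "y > 0" using \<delta>0 by (simp add: y_def)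
        have y_pow: "y ^ CARD('d) = 1 / \<delta> ^ 4"
        proof -
          have "y ^ CARD('d) = y powr d" using y0 by (simp add: d_def powr_realpow)
          also have "\<dots> = \<delta> powr (-4)" using d by (simp add: y_def powr_powr)
          also have "\<dots> = 1 / \<delta> ^ 4" using \<delta>0 by (simp add: powr_minus powr_numeral divide_inverse)
          finally show ?thesis .
        qed
        \<comment> \<open>A point of E exists, so the trivial bound gives \<delta> <= 2^d. This
          keeps C0 y >= 4, and rounding up to the integer L costs at most a factor 2.\<close>
        have y_lower: "y \<ge> 1 / 16"
        proof -
          have "(\<delta> * real N powr (d / 2) * sqrt S)\<^sup>2 \<le> (cmod (grid_F A N a x))\<^sup>2"
            using x \<delta>0 S(2) by (intro power_mono) auto
          also have "\<dots> \<le> 4 ^ CARD('d) * real N ^ CARD('d) * S" unfolding S(1) by (rule norm_grid_F_square_le)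
          finally have "\<delta>\<^sup>2 * (real N ^ CARD('d) * S) \<le> 4 ^ CARD('d) * (real N ^ CARD('d) * S)"
            using S(2) by (simp add: power_mult_distrib Nd mult_ac)
          moreover have "real N ^ CARD('d) * S > 0" using N S(2) by simp
          ultimately have "\<delta>\<^sup>2 \<le> 4 ^ CARD('d)" by (rule mult_right_le_imp_le)
          also have "\<dots> = (2 ^ CARD('d))\<^sup>2" by (simp add: power2_eq_square power_mult_distrib[symmetric])
          finally have "\<delta>\<^sup>2 \<le> (2 ^ CARD('d))\<^sup>2" .
          then have "\<delta> \<le> 2 ^ CARD('d)" by (rule power2_le_imp_le) simp
          also have "\<dots> = 2 powr d" by (simp add: d_def powr_realpow)
          finally have "(2 powr d) powr (-4 / d) \<le> y" unfolding y_def using \<delta>0 d by (intro powr_mono2') auto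
          also have "(2 powr d) powr (-4 / d) = 1 / 16" using d by (simp add: powr_powr powr_minus powr_numeral)
          finally show ?thesis .
        qed
        have y_upper: "6 * C0 * y \<le> real N"
        proof -
          have "y \<le> (C * real N powr (- d / 4)) powr (- 4 / d)"
            unfolding y_def using \<delta> d \<open>C * real N powr (- d / 4) > 0\<close> by (intro powr_mono2') auto
          also have "\<dots> = (6 * C0) powr (-1) * real N"
            using d C0 N by (simp add: C_def powr_mult powr_powr)
          finally show ?thesis using C0 by (simp add: powr_minus field_simps)
        qed
        define L where "L = nat \<lceil>C0 * y\<rceil>"
        have C0y: "C0 * y \<ge> 4" using mult_mono[of 64 C0 "1/16" y] C0 y_lower y0 by simp
        have "real L = of_int \<lceil>C0 * y\<rceil>" unfolding L_def using C0y by simp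
        then have L_real: "C0 * y \<le> real L" "real L \<le> 2 * C0 * y" using C0y by linarith+
        have L: "1 \<le> L" "3 * L \<le> N"
        proof -
          show "1 \<le> L" using L_real C0y by linarith
          have "3 * real L \<le> real N" using L_real y_upper by linarith
          then show "3 * L \<le> N" by linarith
        qed
        obtain D where D: "\<And>m. 1 \<le> m \<Longrightarrow> m \<le> L ^ R \<Longrightarrow> real (card {g. g dvd m}) \<le> D"
          and D_le: "6 * real L * (harm L)\<^sup>2 * D \<le> C3 * real L powr (1 + 3 * \<eta>)"
          using C3(2)[OF L(1)] by blast
        have D0: "D \<ge> 0" using D[of 1] L by simp
        define Z where "Z = 6 * real L * (harm L)\<^sup>2 * D"
        have Z0: "Z \<ge> 0" using D0 by (simp add: Z_def)
        have Z_le: "Z \<le> C4 * y powr (1 + 3 * \<eta>)"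
        proof -
          have "real L powr (1 + 3 * \<eta>) \<le> (2 * C0 * y) powr (1 + 3 * \<eta>)"
            using L_real \<eta> by (intro powr_mono2) auto
          also have "\<dots> = (2 * C0) powr (1 + 3 * \<eta>) * y powr (1 + 3 * \<eta>)" using C0 y0 by (simp add: powr_mult)
          finally show ?thesis using D_le C3(1) unfolding Z_def C4_def
            by (smt (verit) mult.assoc mult_left_mono)
        qed
        \<comment> \<open>W and V solve the truncation condition with equality, with Z replaced by
          its upper bound C4 y^(1 + 3 \<eta>). The factor N^d there cancels against t^2 / S =
          \<delta>^2 N^d, so W depends on \<delta> but not on N.\<close>
        define W where "W = B * (C4 * y powr (1 + 3 * \<eta>)) ^ R / \<delta>\<^sup>2"
        have W0: "W > 0" using B C4 y0 \<delta>0 by (simp add: W_def)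
        define V where "V = W powr r / (real N)\<^sup>2"
        have V0: "V > 0" using W0 N by (simp add: V_def)
        have W_eq: "W powr r = (B * C4 ^ R) powr r * \<delta> powr (2 - p')"
        proof -
          have "(y powr (1 + 3 * \<eta>)) ^ R = \<delta> powr (- (4 / d * (1 + 3 * \<eta>) * R))"
            using \<delta>0 y0 by (simp add: y_def powr_powr powr_realpow[symmetric] mult_ac)
          moreover have "1 / \<delta>\<^sup>2 = \<delta> powr (-2)" using \<delta>0 by (simp add: powr_minus powr_numeral divide_inverse)
          ultimately have "W = B * C4 ^ R * (\<delta> powr (- (4 / d * (1 + 3 * \<eta>) * R)) * \<delta> powr (-2))"
            unfolding W_def power_mult_distrib by (simp add: divide_inverse mult_ac)
          also have "\<dots> = (B * C4 ^ R) * \<delta> powr (- (4 / d * (1 + 3 * \<eta>) * R + 2))"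
            by (simp add: powr_add[symmetric])
          finally have "W powr r = (B * C4 ^ R) powr r * (\<delta> powr (- (4 / d * (1 + 3 * \<eta>) * R + 2))) powr r"
            using B C4 by (simp add: powr_mult)
          also have "(\<delta> powr (- (4 / d * (1 + 3 * \<eta>) * R + 2))) powr r = \<delta> powr (2 - p')"
            unfolding powr_powr p'_def by (rule arg_cong[where f = "(powr) \<delta>"]) (simp add: algebra_simps)
          finally show ?thesis .
        qed
        define t where "t = \<delta> * real N powr (d / 2) * sqrt S"
        have t0: "t > 0" using \<delta>0 N S(2) by (simp add: t_def)
        have tS: "t\<^sup>2 / S = \<delta>\<^sup>2 * real N ^ CARD('d)"
          using S(2) by (simp add: t_def power_mult_distrib Nd)
        have "real (card E) \<le> 4 * 2 ^ CARD('d) * V / (t\<^sup>2 / S) * real (card (torus_grid N :: (int \<times> (int^'d)) set))"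
        proof (rule card_level_set_le[OF L a _ _ t0 S _ R D V0])
          show "E \<subseteq> torus_grid N" "\<And>x. x \<in> E \<Longrightarrow> t \<le> cmod (grid_F A N a x)" by (auto simp: E_def t_def)
        next
          fix j \<theta> assume j: "j mod grid_size N \<notin> major_arcs N L"
          have LN: "L \<le> N" using L by simp
          show "cmod (kernel A N (of_int j / grid_size N) \<theta>) \<le> t\<^sup>2 / S / 8"
          proof (rule kernel_off_major_arcs[OF L(1) LN _ j])
            fix t' \<theta>
            assume "\<And>q a. \<lbrakk>1 \<le> q; q \<le> L; coprime a (int q)\<rbrakk> \<Longrightarrow> \<bar>t' - of_int a / q\<bar> > real L / (real q * (real N)\<^sup>2)"
            then have "(cmod (kernel A N t' \<theta>))\<^sup>2 \<le> (C2 * (real N)\<^sup>2 / L) ^ CARD('d)"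
              by (rule C2(2)[OF L(1) LN])
            also have "\<dots> \<le> ((real N)\<^sup>2 / (64 * y)) ^ CARD('d)"
            proof (rule power_mono)
              have "C2 * (real N)\<^sup>2 / L \<le> C2 * (real N)\<^sup>2 / (C0 * y)"
                using L_real C2 C0 y0 L by (intro divide_left_mono mult_pos_pos) auto
              also have "\<dots> = (real N)\<^sup>2 / (64 * y)" using C2 by (simp add: C0_def)
              finally show "C2 * (real N)\<^sup>2 / L \<le> (real N)\<^sup>2 / (64 * y)" .
            qed (use C2 in simp)
            also have "\<dots> = (real N ^ CARD('d))\<^sup>2 * \<delta> ^ 4 / 64 ^ CARD('d)"
              using \<delta>0 by (simp add: power_divide power_mult_distrib y_pow power_mult[symmetric] mult.commute)
            also have "\<dots> \<le> (real N ^ CARD('d))\<^sup>2 * \<delta> ^ 4 / 64 ^ 1"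
            proof (rule divide_left_mono)
              show "(64::real) ^ 1 \<le> 64 ^ CARD('d)" by (rule power_increasing) (simp_all add: Suc_leI)
            qed auto
            also have "\<dots> = (t\<^sup>2 / S / 8)\<^sup>2" unfolding tS by (simp add: power_divide power_mult_distrib power_mult[symmetric])
            finally show "cmod (kernel A N t' \<theta>) \<le> t\<^sup>2 / S / 8"
              by (rule power2_le_imp_le) (use S(2) in simp)
          qed
        next
          have "((real N)\<^sup>2 * V) ^ (R - 1) = W"
          proof -
            have "(real N)\<^sup>2 * V = W powr r" using N by (simp add: V_def)
            then have "((real N)\<^sup>2 * V) ^ (R - 1) = (W powr r) powr real (R - 1)" using W0 by (simp add: powr_realpow)
            then show ?thesis unfolding powr_powr r(2) using W0 by simp
          qed
          moreover have "Z ^ R / W \<le> \<delta>\<^sup>2 / B"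
          proof -
            have "Z ^ R \<le> (C4 * y powr (1 + 3 * \<eta>)) ^ R" by (intro power_mono Z_le Z0)
            also have "\<dots> = \<delta>\<^sup>2 / B * W" using B \<delta>0 by (simp add: W_def)
            finally show ?thesis using W0 by (simp add: pos_divide_le_eq)
          qed
          then have "2 * 8 ^ CARD('d) * real N ^ CARD('d) * (Z ^ R / W) \<le> 2 * 8 ^ CARD('d) * real N ^ CARD('d) * (\<delta>\<^sup>2 / B)"
            by (intro mult_left_mono) auto
          ultimately show "2 * 8 ^ CARD('d) * real N ^ CARD('d) * (6 * real L * (harm L)\<^sup>2 * D) ^ R / ((real N)\<^sup>2 * V) ^ (R - 1) \<le> t\<^sup>2 / S / 8"
            unfolding tS Z_def[symmetric] by (simp add: B_def)
        qed
        also have "4 * 2 ^ CARD('d) * V / (t\<^sup>2 / S) = K * real N powr (- (d + 2)) * \<delta> powr (- p')"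
        proof -
          have "real N powr (- (d + 2)) = 1 / (real N ^ CARD('d) * (real N)\<^sup>2)"
            using N by (simp only: powr_minus_divide powr_add) (simp add: d_def powr_realpow)
          moreover have "\<delta> powr (2 - p') = \<delta>\<^sup>2 * \<delta> powr (- p')"
            using \<delta>0 powr_add[of \<delta> 2 "- p'"] by (simp add: powr_numeral)
          ultimately show ?thesis unfolding tS V_def W_eq K_def using \<delta>0 N by (simp add: mult_ac)
        qed
        finally show ?thesis unfolding E_def .
      qed
    qed
    show "\<exists>p' K. 0 < p' \<and> p' < p \<and> K > 0 \<and> (\<forall>N\<ge>1. \<forall>a \<delta>. supported_on_box N a \<longrightarrow> (\<Sum>n\<in>weight_box N. (cmod (a n))\<^sup>2) > 0 \<longrightarrow>
      \<delta> \<ge> C * real N powr (- real CARD('d) / 4) \<longrightarrow>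
      real (card {x \<in> torus_grid N. \<delta> * real N powr (real CARD('d) / 2) * sqrt (\<Sum>n\<in>weight_box N. (cmod (a n))\<^sup>2) \<le> cmod (grid_F A N a x)})
      \<le> K * real N powr (- (real CARD('d) + 2)) * \<delta> powr (- p') * real (card (torus_grid N :: (int \<times> (int^'d)) set)))"
    proof (intro exI conjI allI impI)
      show "0 < p'" "p' < p" "K > 0" by (rule p'0 p'p K)+
    qed (rule bound[unfolded d_def, OF _ _ refl], auto)
  qed
qed

section \<open>From the grid to the torus\<close>

text \<open>Dyadic layers between U / 2^(j+1) and U / 2^j, clipped at \<delta>: layer j contributes
  at most B 2^q (U / 2^j)^(p - q), a geometric series of ratio 2^(q - p) < 1. The bound is thus free
  of the number of layers and of \<delta>.\<close>

lemma sum_powr_le_of_level_sets: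
  fixes u :: "'a \<Rightarrow> real" and B U \<delta> p q :: real
  assumes fin: "finite X" and u: "\<And>x. x \<in> X \<Longrightarrow> u x < U" and U: "U > 0" and \<delta>: "\<delta> > 0"
    and q: "0 < q" "q < p"
    and level: "\<And>s. s \<ge> \<delta> \<Longrightarrow> real (card {x\<in>X. s \<le> u x}) \<le> B * s powr (- q)"
  shows "(\<Sum>x\<in>{x\<in>X. \<delta> \<le> u x}. u x powr p) \<le> B * U powr (p - q) * 2 powr q / (1 - 2 powr (q - p))"
proof -
  define \<rho> :: real where "\<rho> = 2 powr (q - p)"
  have \<rho>: "0 < \<rho>" "\<rho> < 1"
    using q powr_less_mono[of "q - p" 0 2] by (auto simp: \<rho>_def)
  have "0 \<le> B * \<delta> powr (- q)" using level[of \<delta>] by (meson of_nat_0_le_iff order_refl order_trans)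
  then have B: "0 \<le> B" using \<delta> by (simp add: zero_le_mult_iff)
  have ind: "(\<Sum>x\<in>{x\<in>X. max \<delta> (U / 2 ^ j) \<le> u x}. u x powr p) \<le> B * U powr (p - q) * 2 powr q * (\<Sum>i<j. \<rho> ^ i)" for j
  proof (induction j)
    case 0
    have "{x\<in>X. max \<delta> (U / 2 ^ 0) \<le> u x} = {}" using u by force
    then show ?case by (simp only: sum.empty lessThan_0 mult_zero_right order_refl)
  next
    case (Suc j)
    define s where "s = max \<delta> (U / 2 ^ Suc j)"
    let ?new = "{x\<in>X. s \<le> u x \<and> u x < max \<delta> (U / 2 ^ j)}"
    have s: "s \<ge> \<delta>" "s \<ge> U / 2 ^ Suc j" "s > 0" using \<delta> by (auto simp: s_def)
    have "{x\<in>X. s \<le> u x} = {x\<in>X. max \<delta> (U / 2 ^ j) \<le> u x} \<union> ?new"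
    proof -
      have "U / 2 ^ Suc j \<le> U / 2 ^ j" using U by (simp add: field_simps)
      then have "s \<le> max \<delta> (U / 2 ^ j)" unfolding s_def by linarith
      then show ?thesis by auto
    qed
    then have "(\<Sum>x\<in>{x\<in>X. s \<le> u x}. u x powr p) = (\<Sum>x\<in>{x\<in>X. max \<delta> (U / 2 ^ j) \<le> u x}. u x powr p) + (\<Sum>x\<in>?new. u x powr p)"
      using fin by (simp only:) (rule sum.union_disjoint, auto)
    also have "(\<Sum>x\<in>?new. u x powr p) \<le> B * U powr (p - q) * 2 powr q * \<rho> ^ j"
    proof -
      have "u x powr p \<le> (U / 2 ^ j) powr p" if "x \<in> ?new" for x
        using that s q by (intro powr_mono2) (auto simp: max_def split: if_splits)
      then have "(\<Sum>x\<in>?new. u x powr p) \<le> real (card ?new) * (U / 2 ^ j) powr p"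
        by (rule sum_bounded_above)
      also have "real (card ?new) \<le> real (card {x\<in>X. s \<le> u x})"
        using fin by (intro of_nat_mono card_mono) auto
      also have "\<dots> \<le> B * s powr (- q)" by (rule level[OF s(1)])
      also have "\<dots> \<le> B * (U / 2 ^ Suc j) powr (- q)"
        using s U q B by (intro mult_left_mono powr_mono2') auto
      finally have "(\<Sum>x\<in>?new. u x powr p) \<le> B * (U / 2 ^ Suc j) powr (- q) * (U / 2 ^ j) powr p"
        by (simp add: mult_right_mono)
      also have "\<dots> = B * U powr (p - q) * 2 powr q * \<rho> ^ j"
      proof -
        define w where "w = U / 2 ^ j"
        have w: "w > 0" using U by (simp add: w_def)
        have half: "U / 2 ^ Suc j = w / 2" by (simp add: w_def)
        have "(U / 2 ^ Suc j) powr (- q) = w powr (- q) * 2 powr q"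
          unfolding half using w by (simp add: powr_divide powr_minus_divide)
        then have "B * (U / 2 ^ Suc j) powr (- q) * (U / 2 ^ j) powr p = B * 2 powr q * (w powr (- q) * w powr p)"
          unfolding w_def[symmetric] by simp
        also have "w powr (- q) * w powr p = w powr (p - q)" by (simp add: powr_add[symmetric])
        also have "w powr (p - q) = U powr (p - q) * \<rho> ^ j"
        proof -
          have "(2 ^ j :: real) powr (p - q) = (2 powr (p - q)) ^ j"
            by (simp add: powr_realpow[symmetric] powr_powr mult.commute)
          moreover have "(2 powr (p - q)) ^ j = 1 / \<rho> ^ j"
            by (simp add: \<rho>_def powr_minus_divide[of 2 "p - q", simplified] power_divide)
          ultimately show ?thesis using U \<rho> by (simp add: w_def powr_divide)
        qed
        finally show ?thesis by (simp add: mult_ac)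
      qed
      finally show ?thesis .
    qed
    finally show ?case using Suc.IH unfolding s_def[symmetric] by (simp add: distrib_left)
  qed
  obtain j where "U / \<delta> < 2 ^ j" using real_arch_pow[of 2 "U / \<delta>"] by auto
  then have "max \<delta> (U / 2 ^ j) = \<delta>" using \<delta> by (simp add: field_simps max_def)
  then have "(\<Sum>x\<in>{x\<in>X. \<delta> \<le> u x}. u x powr p) \<le> B * U powr (p - q) * 2 powr q * (\<Sum>i<j. \<rho> ^ i)" using ind[of j] by simp
  also have "\<dots> \<le> B * U powr (p - q) * 2 powr q * (1 / (1 - \<rho>))"
  proof (rule mult_left_mono)
    have "(\<Sum>i<j. \<rho> ^ i) = (1 - \<rho> ^ j) / (1 - \<rho>)" using \<rho> by (simp add: sum_gp_strict)
    also have "\<dots> \<le> 1 / (1 - \<rho>)" using \<rho> by (intro divide_right_mono) auto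
    finally show "(\<Sum>i<j. \<rho> ^ i) \<le> 1 / (1 - \<rho>)" .
  qed (use B in simp)
  finally show ?thesis by (simp add: \<rho>_def)
qed

section \<open>Averaging over translates of the grid\<close>

definition unit_cube :: "(real \<times> (real^'d)) set" where
  "unit_cube = {0..<1} \<times> {\<theta>. \<forall>i. 0 \<le> \<theta> $ i \<and> \<theta> $ i < 1}"

definition grid_cell :: "nat \<Rightarrow> (real \<times> (real^'d)) set" where
  "grid_cell N = {0..<1 / grid_size N} \<times> {\<theta>. \<forall>i. 0 \<le> \<theta> $ i \<and> \<theta> $ i < 1 / (4 * real N)}"

definition grid_point :: "nat \<Rightarrow> int \<times> (int^'d) \<Rightarrow> real \<times> (real^'d)" where
  "grid_point N x = (grid_time N x, grid_space N x)"

lemma half_open_cube_measurable: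
  "{0..<b} \<times> {\<theta>. \<forall>i. 0 \<le> \<theta> $ i \<and> \<theta> $ i < c} \<in> sets (lborel :: (real \<times> (real^'d)) measure)"
proof -
  have "{0..<b} \<times> {\<theta>. \<forall>i. 0 \<le> \<theta> $ i \<and> \<theta> $ i < c}
    = {z :: real \<times> (real^'d). 0 \<le> fst z} \<inter> {z. fst z < b} \<inter> (\<Inter>i. {z. 0 \<le> snd z $ i} \<inter> {z. snd z $ i < c})"
    by auto
  also have "\<dots> \<in> sets borel"
  proof (intro sets.Int sets.finite_INT)
    show "{z :: real \<times> (real^'d). 0 \<le> fst z} \<in> sets borel" by (intro borel_closed closed_Collect_le continuous_intros)
    show "{z :: real \<times> (real^'d). fst z < b} \<in> sets borel" by (intro borel_open open_Collect_less continuous_intros)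
    fix i
    show "{z :: real \<times> (real^'d). 0 \<le> snd z $ i} \<in> sets borel" by (intro borel_closed closed_Collect_le continuous_intros)
    show "{z :: real \<times> (real^'d). snd z $ i < c} \<in> sets borel" by (intro borel_open open_Collect_less continuous_intros)
  qed auto
  finally show ?thesis by simp
qed

lemma unit_cube_measurable [measurable]: "unit_cube \<in> sets lborel"
  unfolding unit_cube_def by (rule half_open_cube_measurable)

lemma grid_cell_measurable [measurable]: "grid_cell N \<in> sets lborel"
  unfolding grid_cell_def by (rule half_open_cube_measurable)

lemma emeasure_unit_cube_le: "emeasure lborel (unit_cube :: (real \<times> (real^'d)) set) \<le> 1"
proof -
  have "(unit_cube :: (real \<times> (real^'d)) set) \<subseteq> cbox 0 One"
  proof
    fix z :: "real \<times> (real^'d)" assume z: "z \<in> unit_cube"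
    show "z \<in> cbox 0 One"
      unfolding mem_box
    proof
      fix b :: "real \<times> (real^'d)" assume b: "b \<in> Basis"
      have one: "One \<bullet> b = 1" using inner_sum_left_Basis[OF b, of "\<lambda>_. 1"] by simp
      show "0 \<bullet> b \<le> z \<bullet> b \<and> z \<bullet> b \<le> One \<bullet> b"
        unfolding one using b z by (auto simp: unit_cube_def Basis_prod_def Basis_vec_def inner_axis less_imp_le)
    qed
  qed
  then have "emeasure lborel (unit_cube :: (real \<times> (real^'d)) set) \<le> emeasure lborel (cbox 0 One :: (real \<times> (real^'d)) set)"
    by (intro emeasure_mono) auto
  also have "\<dots> = 1" by (subst emeasure_lborel_cbox) auto
  finally show ?thesis .
qed

text \<open>Half-open cells tile without overlap: z lies in exactly one translated cell, whose index
  consists of the floors of the rescaled coordinates of z.\<close>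

lemma indicator_unit_cube_eq_sum:
  fixes z :: "real \<times> (real^'d)"
  assumes N: "N \<ge> 1"
  shows "(\<Sum>x\<in>torus_grid N. indicator (grid_cell N) (z - grid_point N x)) = (indicator unit_cube z :: ennreal)"
proof -
  let ?M = "grid_size N"
  have M: "real_of_int ?M > 0" using grid_size_pos[OF N] by simp
  have P: "4 * real N > 0" "4 * real N = of_int (4 * int N)" using N by simp_all
  define idx where "idx = (\<lfloor>?M * fst z\<rfloor>, (\<chi> i. \<lfloor>4 * real N * snd z $ i\<rfloor>) :: int^'d)"
  have cell1: "0 \<le> t - of_int j / m \<and> t - of_int j / m < 1 / m \<longleftrightarrow> j = \<lfloor>m * t\<rfloor>" if "m > 0" for t m :: real and j :: int
  proof -
    have eq: "t - of_int j / m = (m * t - of_int j) / m" using that by (simp add: field_simps)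
    have "0 \<le> t - of_int j / m \<longleftrightarrow> of_int j \<le> m * t" "t - of_int j / m < 1 / m \<longleftrightarrow> m * t < of_int j + 1"
      unfolding eq using that by (auto simp: divide_less_cancel zero_le_divide_iff)
    then show ?thesis by (metis floor_eq_iff)
  qed
  have cell: "z - grid_point N x \<in> grid_cell N \<longleftrightarrow> x = idx" for x
  proof -
    have "z - grid_point N x \<in> grid_cell N \<longleftrightarrow> (0 \<le> fst z - of_int (fst x) / ?M \<and> fst z - of_int (fst x) / ?M < 1 / ?M)
      \<and> (\<forall>i. 0 \<le> snd z $ i - of_int (snd x $ i) / (4 * real N) \<and> snd z $ i - of_int (snd x $ i) / (4 * real N) < 1 / (4 * real N))"
      by (cases z) (auto simp: grid_point_def grid_cell_def grid_time_def grid_space_def)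
    also have "\<dots> \<longleftrightarrow> fst x = \<lfloor>?M * fst z\<rfloor> \<and> (\<forall>i. snd x $ i = \<lfloor>4 * real N * snd z $ i\<rfloor>)"
      by (simp only: cell1[OF M] cell1[OF P(1)])
    also have "\<dots> \<longleftrightarrow> x = idx" by (auto simp: idx_def prod_eq_iff vec_eq_iff)
    finally show ?thesis .
  qed
  have mem1: "0 \<le> \<lfloor>m * t\<rfloor> \<and> \<lfloor>m * t\<rfloor> < k \<longleftrightarrow> 0 \<le> t \<and> t < 1" if "m > 0" "m = of_int k" for t m :: real and k :: int
  proof -
    have "\<lfloor>m * t\<rfloor> < k \<longleftrightarrow> m * t < m" using that by (simp add: floor_less_iff)
    then show ?thesis using that by (simp add: zero_le_mult_iff)
  qed
  have mem: "idx \<in> torus_grid N \<longleftrightarrow> z \<in> unit_cube"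
  proof -
    have "idx \<in> torus_grid N \<longleftrightarrow> (0 \<le> \<lfloor>?M * fst z\<rfloor> \<and> \<lfloor>?M * fst z\<rfloor> < ?M)
       \<and> (\<forall>i. 0 \<le> \<lfloor>4 * real N * snd z $ i\<rfloor> \<and> \<lfloor>4 * real N * snd z $ i\<rfloor> < 4 * int N)"
      by (auto simp: idx_def torus_grid_def int_box_def)
    also have "\<dots> \<longleftrightarrow> (0 \<le> fst z \<and> fst z < 1) \<and> (\<forall>i. 0 \<le> snd z $ i \<and> snd z $ i < 1)"
      by (simp only: mem1[OF M refl] mem1[OF P])
    also have "\<dots> \<longleftrightarrow> z \<in> unit_cube" by (cases z) (auto simp: unit_cube_def)
    finally show ?thesis .
  qed
  have "(\<Sum>x\<in>torus_grid N. indicator (grid_cell N) (z - grid_point N x)) = (\<Sum>x\<in>torus_grid N. if x = idx then 1 else (0::ennreal))"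
    by (intro sum.cong refl) (simp add: indicator_def cell)
  also have "\<dots> = indicator unit_cube z" using mem by (simp add: sum.delta' indicator_def)
  finally show ?thesis .
qed

lemma nn_integral_unit_cube_eq:
  fixes h :: "real \<times> (real^'d) \<Rightarrow> ennreal"
  assumes N: "N \<ge> 1" and [measurable]: "h \<in> borel_measurable borel"
  shows "(\<integral>\<^sup>+z. h z * indicator unit_cube z \<partial>lborel)
    = (\<integral>\<^sup>+z. (\<Sum>x\<in>torus_grid N. h (grid_point N x + z)) * indicator (grid_cell N) z \<partial>lborel)"
proof -
  have "(\<integral>\<^sup>+z. h z * indicator unit_cube z \<partial>lborel)
    = (\<integral>\<^sup>+z. (\<Sum>x\<in>torus_grid N. h z * indicator (grid_cell N) (z - grid_point N x)) \<partial>lborel)"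
    unfolding indicator_unit_cube_eq_sum[OF N, symmetric] sum_distrib_left ..
  also have "\<dots> = (\<Sum>x\<in>torus_grid N. \<integral>\<^sup>+z. h z * indicator (grid_cell N) (z - grid_point N x) \<partial>lborel)"
    by (rule nn_integral_sum) measurable
  also have "\<dots> = (\<Sum>x\<in>torus_grid N. \<integral>\<^sup>+z. h (grid_point N x + z) * indicator (grid_cell N) z \<partial>lborel)"
  proof (rule sum.cong[OF refl])
    fix x :: "int \<times> (int^'d)"
    have "(\<integral>\<^sup>+z. h z * indicator (grid_cell N) (z - grid_point N x) \<partial>lborel)
      = (\<integral>\<^sup>+z. h z * indicator (grid_cell N) (z - grid_point N x) \<partial>distr lborel borel ((+) (grid_point N x)))"
      by (simp only: lborel_distr_plus)
    also have "\<dots> = (\<integral>\<^sup>+z. h (grid_point N x + z) * indicator (grid_cell N) (grid_point N x + z - grid_point N x) \<partial>lborel)"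
      by (rule nn_integral_distr) measurable
    finally show "(\<integral>\<^sup>+z. h z * indicator (grid_cell N) (z - grid_point N x) \<partial>lborel)
      = (\<integral>\<^sup>+z. h (grid_point N x + z) * indicator (grid_cell N) z \<partial>lborel)" by simp
  qed
  also have "\<dots> = (\<integral>\<^sup>+z. (\<Sum>x\<in>torus_grid N. h (grid_point N x + z) * indicator (grid_cell N) z) \<partial>lborel)"
    by (rule nn_integral_sum[symmetric]) measurable
  finally show ?thesis by (simp only: sum_distrib_right)
qed

text \<open>The integral over the cube equals the integral over a single cell of the sums over
  translated grids. The cell volume times the number of grid points is the volume of the cube, so a
  bound on grid averages, uniform in the translation, passes to the integral.\<close>

lemma nn_integral_unit_cube_le:
  fixes h :: "real \<times> (real^'d) \<Rightarrow> ennreal"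
  assumes N: "N \<ge> 1" and h: "h \<in> borel_measurable borel"
    and b: "\<And>z. (\<Sum>x\<in>torus_grid N. h (grid_point N x + z)) \<le> b * of_nat (card (torus_grid N :: (int \<times> (int^'d)) set))"
  shows "(\<integral>\<^sup>+z. h z * indicator unit_cube z \<partial>lborel) \<le> b"
proof -
  let ?Q = "of_nat (card (torus_grid N :: (int \<times> (int^'d)) set)) :: ennreal"
  have "?Q * emeasure lborel (grid_cell N :: (real \<times> (real^'d)) set) = emeasure lborel (unit_cube :: (real \<times> (real^'d)) set)"
    using nn_integral_unit_cube_eq[OF N, of "\<lambda>_. 1", symmetric]
    by (simp add: nn_integral_cmult unit_cube_measurable[simplified] grid_cell_measurable[simplified])
  then have vol: "?Q * emeasure lborel (grid_cell N :: (real \<times> (real^'d)) set) \<le> 1" using emeasure_unit_cube_le by simp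
  have "(\<integral>\<^sup>+z. h z * indicator unit_cube z \<partial>lborel) = (\<integral>\<^sup>+z. (\<Sum>x\<in>torus_grid N. h (grid_point N x + z)) * indicator (grid_cell N) z \<partial>lborel)"
    by (rule nn_integral_unit_cube_eq[OF N h])
  also have "\<dots> \<le> (\<integral>\<^sup>+z. b * ?Q * indicator (grid_cell N) z \<partial>(lborel :: (real \<times> (real^'d)) measure))"
    by (intro nn_integral_mono mult_right_mono b) auto
  also have "\<dots> = b * ?Q * emeasure lborel (grid_cell N :: (real \<times> (real^'d)) set)"
    by (rule nn_integral_cmult_indicator) measurable
  also have "\<dots> \<le> b * 1" unfolding mult.assoc by (intro mult_left_mono vol) auto
  finally show ?thesis by simp
qed

lemma supported_on_box_eq_0:
  assumes N: "N \<ge> 1" and a: "supported_on_box N a" and n: "n \<notin> weight_box N"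
  shows "a n = 0"
proof (rule ccontr)
  assume "a n \<noteq> 0"
  then have "n $ i \<in> {- 2 * int N..<2 * int N}" for i
    using a N by (auto simp: supported_on_box_def abs_le_iff dest!: spec[of _ n] spec[of _ i])
  then show False using n by (simp add: int_box_def)
qed

lemma F_eq_sum:
  fixes a :: "int^'d \<Rightarrow> complex"
  assumes N: "N \<ge> 1" and a: "supported_on_box N a"
  shows "F A a z = (\<Sum>n\<in>weight_box N. a n * e (fst z * quad_form A (real_vec n) + snd z \<bullet> real_vec n))"
proof -
  have "F A a z = (\<Sum>\<^sub>\<infinity>n\<in>weight_box N. a n * e (fst z * quad_form A (real_vec n) + snd z \<bullet> real_vec n))"
    unfolding F_def split_def by (rule infsum_cong_neutral) (auto simp: supported_on_box_eq_0[OF N a])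
  then show ?thesis by simp
qed

lemma l2norm_eq_sqrt_sum:
  fixes a :: "int^'d \<Rightarrow> complex"
  assumes N: "N \<ge> 1" and a: "supported_on_box N a"
  shows "l2norm a = sqrt (\<Sum>n\<in>weight_box N. (cmod (a n))\<^sup>2)"
proof -
  have "(\<Sum>\<^sub>\<infinity>n. (cmod (a n))\<^sup>2) = (\<Sum>\<^sub>\<infinity>n\<in>weight_box N. (cmod (a n))\<^sup>2)"
    by (rule infsum_cong_neutral) (auto simp: supported_on_box_eq_0[OF N a])
  then show ?thesis by (simp add: l2norm_def)
qed

lemma F_grid_shift:
  fixes A :: "real^'d^'d" and a :: "int^'d \<Rightarrow> complex"
  assumes N: "N \<ge> 1" and a: "supported_on_box N a"
  shows "F A a (grid_point N x + z) = grid_F A N (\<lambda>n. a n * e (fst z * quad_form A (real_vec n) + snd z \<bullet> real_vec n)) x"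
  unfolding F_eq_sum[OF N a] grid_F_def grid_char_def
  by (intro sum.cong refl) (simp add: grid_point_def algebra_simps inner_add_left e_add[symmetric])

lemma F_measurable:
  fixes A :: "real^'d^'d"
  assumes N: "N \<ge> 1" and a: "supported_on_box N a"
  shows "F A a \<in> borel_measurable borel"
proof -
  have "continuous_on UNIV (\<lambda>z. \<Sum>n\<in>weight_box N. a n * e (fst z * quad_form A (real_vec n) + snd z \<bullet> real_vec n))"
    unfolding e_def by (intro continuous_intros)
  then have "continuous_on UNIV (F A a)" unfolding F_eq_sum[OF N a, abs_def] .
  then show ?thesis by (rule borel_measurable_continuous_onI)
qed

theorem theorem1p2:
  fixes A :: "real^'d^'d"
  assumes "integer_form_matrix A"
    and "nondegenerate A"
    and "indefinite A"
  shows "\<exists>C>0. \<forall>p::real. p > 2 * (real CARD('d) + 2) / real CARD('d) \<longrightarrow>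
    (\<exists>K>0. \<forall>N::nat. N \<ge> 1 \<longrightarrow> (\<forall>a :: int^'d \<Rightarrow> complex. supported_on_box N a \<longrightarrow>
      (LINT x:{x. cmod (F A a x) \<ge> C * real N powr (real CARD('d) / 4) * l2norm a}|torus.
         cmod (F A a x) powr p)
      \<le> K * real N powr (real CARD('d) * p / 2 - (real CARD('d) + 2)) * l2norm a powr p))"
proof -
  define d where "d = real CARD('d)"
  obtain C where C: "C > 0" and level: "\<And>p. p > 2 * (d + 2) / d \<Longrightarrow>
    \<exists>p' K. 0 < p' \<and> p' < p \<and> K > 0 \<and> (\<forall>N\<ge>1. \<forall>a \<delta>. supported_on_box N a \<longrightarrow> (\<Sum>n\<in>weight_box N. (cmod (a n))\<^sup>2) > 0 \<longrightarrow>
      \<delta> \<ge> C * real N powr (- d / 4) \<longrightarrow>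
      real (card {x \<in> torus_grid N. \<delta> * real N powr (d / 2) * sqrt (\<Sum>n\<in>weight_box N. (cmod (a n))\<^sup>2) \<le> cmod (grid_F A N a x)})
      \<le> K * real N powr (- (d + 2)) * \<delta> powr (- p') * real (card (torus_grid N :: (int \<times> (int^'d)) set)))"
    using grid_level_set[OF assms(1,2)] unfolding d_def by blast
  have "\<exists>K>0. \<forall>N::nat. N \<ge> 1 \<longrightarrow> (\<forall>a :: int^'d \<Rightarrow> complex. supported_on_box N a \<longrightarrow>
      (LINT x:{x. cmod (F A a x) \<ge> C * real N powr (d / 4) * l2norm a}|torus. cmod (F A a x) powr p)
      \<le> K * real N powr (d * p / 2 - (d + 2)) * l2norm a powr p)" if p: "p > 2 * (d + 2) / d" for p :: real
  proof -
    obtain q K where q: "0 < q" "q < p" and K: "K > 0"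
      and card_le: "\<And>N a \<delta>. N \<ge> 1 \<Longrightarrow> supported_on_box N a \<Longrightarrow> (\<Sum>n\<in>weight_box N. (cmod (a n))\<^sup>2) > 0 \<Longrightarrow>
      \<delta> \<ge> C * real N powr (- d / 4) \<Longrightarrow>
      real (card {x \<in> torus_grid N. \<delta> * real N powr (d / 2) * sqrt (\<Sum>n\<in>weight_box N. (cmod (a n))\<^sup>2) \<le> cmod (grid_F A N a x)})
      \<le> K * real N powr (- (d + 2)) * \<delta> powr (- q) * real (card (torus_grid N :: (int \<times> (int^'d)) set))"
      using level[OF p] by blast
    \<comment> \<open>The trivial bound gives u <= 2^d; the dyadic summation starts from a strict
      upper bound, hence the + 1.\<close>
    define U :: real where "U = 2 ^ CARD('d) + 1"
    have U: "U > 0" by (simp add: U_def add_pos_pos)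
    define K' where "K' = K * (U powr (p - q) * 2 powr q / (1 - 2 powr (q - p)))"
    have K': "K' > 0"
    proof -
      have "2 powr (q - p) < (1::real)" using powr_less_mono[of "q - p" 0 2] q by simp
      then show ?thesis unfolding K'_def using K U by (intro mult_pos_pos divide_pos_pos) auto
    qed
    show ?thesis
    proof (intro exI[of _ K'] conjI K' allI impI)
      fix N :: nat and a :: "int^'d \<Rightarrow> complex"
      assume N: "N \<ge> 1" and a: "supported_on_box N a"
      define S where "S = (\<Sum>n\<in>weight_box N. (cmod (a n))\<^sup>2)"
      have S0: "S \<ge> 0" by (simp add: S_def sum_nonneg)
      have l2: "l2norm a = sqrt S" unfolding S_def by (rule l2norm_eq_sqrt_sum[OF N a])
      define c where "c = real N powr (d / 2) * sqrt S"
      define thr where "thr = C * real N powr (d / 4) * l2norm a"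
      define h where "h = (\<lambda>z. indicator {z. thr \<le> cmod (F A a z)} z * cmod (F A a z) powr p)"
      define bound where "bound = K' * real N powr (d * p / 2 - (d + 2)) * l2norm a powr p"
      have bound0: "bound \<ge> 0" using K' by (simp add: bound_def)
      note [measurable] = F_measurable[OF N a]
      have h_meas [measurable]: "h \<in> borel_measurable borel" unfolding h_def by measurable
      have h0: "0 \<le> h z" for z by (simp add: h_def)
      have grid: "(\<Sum>x\<in>torus_grid N. h (grid_point N x + z)) \<le> bound * real (card (torus_grid N :: (int \<times> (int^'d)) set))" for z
      proof (cases "S = 0")
        \<comment> \<open>The threshold is 0 and the level set is everything, but F vanishes and
          \<open>0 powr p = 0\<close>.\<close>
        case True
        then have "\<forall>n\<in>weight_box N. a n = 0" unfolding S_def by (subst (asm) sum_nonneg_eq_0_iff) auto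
        then have "F A a y = 0" for y unfolding F_eq_sum[OF N a] by simp
        then show ?thesis using bound0 by (simp add: h_def)
      next
        case False
        then have S: "S > 0" using S0 by simp
        have c0: "c > 0" using S N by (simp add: c_def)
        define b where "b = (\<lambda>n. a n * e (fst z * quad_form A (real_vec n) + snd z \<bullet> real_vec n))"
        have b: "supported_on_box N b" using a by (simp add: supported_on_box_def b_def)
        have Sb: "(\<Sum>n\<in>weight_box N. (cmod (b n))\<^sup>2) = S" by (simp add: S_def b_def norm_mult)
        have Fb: "F A a (grid_point N x + z) = grid_F A N b x" for x
          unfolding b_def by (rule F_grid_shift[OF N a])
        define u where "u = (\<lambda>x. cmod (grid_F A N b x) / c)"
        define \<delta> where "\<delta> = C * real N powr (- d / 4)"
        have \<delta>0: "\<delta> > 0" using C N by (simp add: \<delta>_def)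
        have thr: "thr = \<delta> * c"
        proof -
          have "real N powr (- d / 4) * real N powr (d / 2) = real N powr (d / 4)"
            unfolding powr_add[symmetric] by (rule arg_cong[where f = "(powr) (real N)"]) (simp add: field_simps)
          then show ?thesis by (simp add: thr_def \<delta>_def c_def l2 mult.assoc)
        qed
        have u_less: "u x < U" for x
        proof -
          have "(cmod (grid_F A N b x))\<^sup>2 \<le> 4 ^ CARD('d) * real N ^ CARD('d) * S"
            using norm_grid_F_square_le[of A N b x] unfolding Sb .
          also have "\<dots> = (2 ^ CARD('d) * c)\<^sup>2"
          proof -
            have "(real N powr (d / 2))\<^sup>2 = real N ^ CARD('d)"
              using N by (simp add: d_def powr_realpow[symmetric] powr_powr)
            moreover have "(4::real) ^ CARD('d) = (2 ^ CARD('d))\<^sup>2" by (simp add: power2_eq_square power_mult_distrib[symmetric])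
            ultimately show ?thesis using S0 by (simp add: c_def power_mult_distrib)
          qed
          finally have "cmod (grid_F A N b x) \<le> 2 ^ CARD('d) * c" by (rule power2_le_imp_le) (use c0 in simp)
          then have "u x \<le> 2 ^ CARD('d)" using c0 by (simp add: u_def pos_divide_le_eq)
          then show ?thesis by (simp add: U_def)
        qed
        let ?B = "K * real N powr (- (d + 2)) * real (card (torus_grid N :: (int \<times> (int^'d)) set))"
        have "(\<Sum>x\<in>{x\<in>torus_grid N. \<delta> \<le> u x}. u x powr p) \<le> ?B * U powr (p - q) * 2 powr q / (1 - 2 powr (q - p))"
        proof (rule sum_powr_le_of_level_sets[OF finite_torus_grid u_less U \<delta>0 q])
          fix s assume s: "s \<ge> \<delta>"
          have "s * real N powr (d / 2) * sqrt S \<le> cmod (grid_F A N b x) \<longleftrightarrow> s \<le> u x" for x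
            using c0 by (simp add: u_def pos_le_divide_eq c_def mult.assoc)
          then show "real (card {x\<in>torus_grid N. s \<le> u x}) \<le> ?B * s powr (- q)"
            using card_le[OF N b, of s] s S unfolding Sb \<delta>_def by (simp add: mult_ac)
        qed
        also have "\<dots> = K' * real N powr (- (d + 2)) * real (card (torus_grid N :: (int \<times> (int^'d)) set))"
          by (simp add: K'_def)
        finally have main: "(\<Sum>x\<in>{x\<in>torus_grid N. \<delta> \<le> u x}. u x powr p) \<le> K' * real N powr (- (d + 2)) * real (card (torus_grid N :: (int \<times> (int^'d)) set))" .
        have "(\<Sum>x\<in>torus_grid N. h (grid_point N x + z)) = (\<Sum>x\<in>torus_grid N. if \<delta> \<le> u x then c powr p * u x powr p else 0)"
        proof (rule sum.cong[OF refl])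
          fix x :: "int \<times> (int^'d)"
          have "thr \<le> cmod (grid_F A N b x) \<longleftrightarrow> \<delta> \<le> u x" using c0 by (simp add: thr u_def pos_le_divide_eq)
          moreover have "c powr p * u x powr p = cmod (grid_F A N b x) powr p"
            using c0 by (simp add: u_def powr_mult[symmetric])
          ultimately show "h (grid_point N x + z) = (if \<delta> \<le> u x then c powr p * u x powr p else 0)"
            by (simp add: h_def Fb)
        qed
        also have "\<dots> = c powr p * (\<Sum>x\<in>{x\<in>torus_grid N. \<delta> \<le> u x}. u x powr p)"
          unfolding sum_distrib_left by (rule sum.inter_filter[symmetric]) simp
        also have "\<dots> \<le> c powr p * (K' * real N powr (- (d + 2)) * real (card (torus_grid N :: (int \<times> (int^'d)) set)))"
          by (rule mult_left_mono[OF main]) simp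
        also have "\<dots> = bound * real (card (torus_grid N :: (int \<times> (int^'d)) set))"
        proof -
          have "c powr p = real N powr (d * p / 2) * l2norm a powr p"
            using S0 by (simp add: c_def l2 powr_mult powr_powr)
          moreover have "real N powr (d * p / 2) * real N powr (- (d + 2)) = real N powr (d * p / 2 - (d + 2))"
            unfolding powr_add[symmetric] by (simp only: diff_conv_add_uminus)
          ultimately show ?thesis unfolding bound_def by (simp add: mult_ac)
        qed
        finally show ?thesis .
      qed
      have "(\<integral>\<^sup>+z. ennreal (h z) * indicator unit_cube z \<partial>lborel) \<le> ennreal bound"
      proof (rule nn_integral_unit_cube_le[OF N])
        fix z
        have "(\<Sum>x\<in>torus_grid N. ennreal (h (grid_point N x + z))) = ennreal (\<Sum>x\<in>torus_grid N. h (grid_point N x + z))"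
          by (rule sum_ennreal) (rule h0)
        also have "\<dots> \<le> ennreal (bound * real (card (torus_grid N :: (int \<times> (int^'d)) set)))"
          by (rule ennreal_leI[OF grid])
        also have "\<dots> = ennreal bound * of_nat (card (torus_grid N :: (int \<times> (int^'d)) set))"
          using bound0 by (simp add: ennreal_mult ennreal_of_nat_eq_real_of_nat)
        finally show "(\<Sum>x\<in>torus_grid N. ennreal (h (grid_point N x + z))) \<le> ennreal bound * of_nat (card (torus_grid N :: (int \<times> (int^'d)) set))" .
      qed measurable
      also have "(\<integral>\<^sup>+z. ennreal (h z) * indicator unit_cube z \<partial>lborel) = (\<integral>\<^sup>+z. ennreal (indicator unit_cube z * h z) \<partial>lborel)"
        by (intro nn_integral_cong) (auto simp: indicator_def)
      finally have nn: "(\<integral>\<^sup>+z. ennreal (indicator unit_cube z * h z) \<partial>lborel) \<le> ennreal bound" .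
      have "(LINT x:{x. cmod (F A a x) \<ge> C * real N powr (d / 4) * l2norm a}|torus. cmod (F A a x) powr p)
        = (\<integral>z. h z \<partial>(restrict_space lborel unit_cube))"
        by (simp add: set_lebesgue_integral_def torus_def unit_cube_def h_def thr_def)
      also have "\<dots> = (\<integral>z. indicator unit_cube z * h z \<partial>lborel)"
        by (subst integral_restrict_space) (simp_all add: unit_cube_measurable[simplified])
      \<comment> \<open>By \<open>nn\<close> the nonnegative integral is finite, so its value here
        is not the default 0 of a divergent integral.\<close>
      also have "\<dots> = enn2real (\<integral>\<^sup>+z. ennreal (indicator unit_cube z * h z) \<partial>lborel)"
        by (rule integral_eq_nn_integral) (auto simp: h0 unit_cube_measurable[simplified])
      also have "\<dots> \<le> bound" by (rule enn2real_leI[OF bound0 nn])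
      finally show "(LINT x:{x. cmod (F A a x) \<ge> C * real N powr (d / 4) * l2norm a}|torus. cmod (F A a x) powr p)
        \<le> K' * real N powr (d * p / 2 - (d + 2)) * l2norm a powr p" unfolding bound_def .
    qed
  qed
  then show ?thesis using C unfolding d_def by blast
qed

end
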